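(* Let $E$ be a relative natural bundle on a parabolic geometry $(p:\mathcal G\to M,\omega)$ of type $(G,Q)$. The fundamental derivative induces a well defined operator $$D^\rho:\Gamma(\mathcal A_\rho M)\times\Gamma(E)\to\Gamma(E),\qquad (s,\sigma)\mapsto D^\rho_s\sigma:=D_{\tilde s}\sigma,$$ where $\tilde s\in\Gamma(\mathcal G\times_Q\mathfrak p)\subset\Gamma(\mathcal AM)$ is any section projecting to $s\in\Gamma(\mathcal A_\rho M)$. These operators have the following properties. (1) For $s\in\Gamma(\mathcal A^0_\rho M)$ and $\sigma\in\Gamma(E)$ one has $D^\rho_s\sigma=-s\bullet\sigma$. (2) For $E=M\times\mathbb R$, one has $D^\rho_sf=\Pi_\rho(s)\cdot f$ for all $s\in\Gamma(\mathcal A_\rho M)$ and $f\in C^\infty(M,\mathbb R)$. (3) The operators $D^\rho$ are compatible with any bundle map $\Phi:E\to F$ between relative natural bundles induced by a $Q$-equivariant linear map between the inducing representations, i.e. $D^\rho_s(\Phi(\sigma))=\Phi(D^\rho_s\sigma)$. In particular, for relative natural bundles $E,F$, $s\in\Gamma(\mathcal A_\rho M)$, $\sigma\in\Gamma(E)$, $\tau\in\Gamma(F)$, $\lambda\in\Gamma(E^* )$, $f\in C^\infty(M,\mathbb R)$ one has the Leibniz rules $D^\rho_s(f\sigma)=(\Pi_\rho(s)\cdot f)\sigma+fD^\rho_s\sigma$ and $D^\rho_s(\sigma\otimes\tau)=D^\rho_s\sigma\otimes\tau+\sigma\otimes D^\rho_s\tau$, and the compatibility with duals $\Pi_\rho(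s)\cdot(\lambda(\sigma))=(D^\rho_s\lambda)(\sigma)+\lambda(D^\rho_s\sigma)$.
   Context: $G$ is a real or complex semisimple Lie group with Lie algebra $\mathfrak g$; $\mathfrak q\subset\mathfrak p\subset\mathfrak g$ are nested parabolic subalgebras ($\mathfrak p=\mathfrak g$ allowed); $P\subset G$ is a parabolic subgroup with Lie algebra $\mathfrak p$, and $Q\subset P$ is the normalizer of $\mathfrak q$ in $P$, which has Lie algebra $\mathfrak q$. The nilradicals satisfy $\mathfrak p_+\subset\mathfrak q_+\subset\mathfrak q\subset\mathfrak p$; $P_+=\exp(\mathfrak p_+)$. A parabolic geometry of type $(G,Q)$ on $M$ is a principal $Q$-bundle $p:\mathcal G\to M$ together with a Cartan connection $\omega\in\Omega^1(\mathcal G,\mathfrak g)$. A (finite dimensional) representation $\mathbb W$ of $Q$ induces the natural bundle $\mathcal G\times_Q\mathbb W$; it is a relative natural bundle if $P_+$ acts trivially on $\mathbb W$. $TM=\mathcal G\times_Q(\mathfrak g/\mathfrak q)$; the relative tangent bundle is $T_\rho M=\mathcal G\times_Q(\mathfrak p/\mathfrak q)\subset TM$. The adjoint tractor bundle is $\mathcal AM=\mathcal G\times_Q\mathfrak g$. The relative adjoint tractor bundle is $\mathcal A_\rho M=\mathcal G\times_Q(\mathfrak p/\mathfrak p_+)$, a quotient of $\mathcal G\times_Q\mathfrak p\subset\mathcal AM$; $\mathcal A^0_\rho M=\mathcal G\times_Q(\mathfrak q/\mathfrak p_+)$; $\Pi_\rho:\Gamma(\mathcal A_\rho M)\to\Gamma(T_\rho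 M)\subset\mathfrak X(M)$ is induced by $\mathfrak p/\mathfrak p_+\to\mathfrak p/\mathfrak q$. Fundamental derivative: via $\omega$, sections of $\mathcal AM$ are identified with $Q$-invariant vector fields on $\mathcal G$, and sections of a natural bundle $E=\mathcal G\times_Q\mathbb W$ with $Q$-equivariant functions $\mathcal G\to\mathbb W$; $D_s\sigma$ ($s\in\Gamma(\mathcal AM)$, $\sigma\in\Gamma(E)$) corresponds to the derivative of the function of $\sigma$ along the vector field of $s$. If $E$ is relative natural, the infinitesimal representation descends to $\mathfrak q/\mathfrak p_+\times\mathbb W\to\mathbb W$ and induces the bundle map $\bullet:\mathcal A^0_\rho M\times E\to E$. *)

theory Defs
  imports "HOL-Analysis.Analysis" "HOL-Algebra.Group"
begin

section \<open>Smooth manifolds\<close>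

text \<open>
  Finite-dimensional real vector spaces (possibly of dimension 0) are types of sort
  \<open>{real_normed_vector, heine_borel}\<close>: by the theorem of Riesz, a normed space has the
  Heine--Borel property iff it is finite dimensional. The class \<open>euclidean_space\<close> would
  exclude dimension 0. The sort constraints appear where manifolds and
  representations are fixed; the definitions only need normed spaces.
\<close>

primrec Ck_on :: "nat \<Rightarrow> 'a::real_normed_vector set \<Rightarrow> ('a \<Rightarrow> 'b::real_normed_vector) \<Rightarrow> bool" where
  "Ck_on 0 S f \<longleftrightarrow> continuous_on S f"
| "Ck_on (Suc k) S f \<longleftrightarrow> (\<forall>x\<in>S. f differentiable (at x)) \<and>
     (\<forall>v. Ck_on k S (\<lambda>x. frechet_derivative f (at x) v))"

text \<open>Only meant for open \<open>S\<close>.\<close>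

definition smooth_on :: "'a::real_normed_vector set \<Rightarrow> ('a \<Rightarrow> 'b::real_normed_vector) \<Rightarrow> bool" where
  "smooth_on S f \<longleftrightarrow> (\<forall>k. Ck_on k S f)"

text \<open>
  A manifold is a whole (Hausdorff, second countable) type with an atlas. A chart is a
  pair of its domain and its coordinate map; values of the latter off the domain are junk.
\<close>

type_synonym ('m, 'e) chart = "'m set \<times> ('m \<Rightarrow> 'e)"

definition cinv :: "('m, 'e) chart \<Rightarrow> 'e \<Rightarrow> 'm" where
  "cinv c = inv_into (fst c) (snd c)"

definition charts_at :: "('m, 'e) chart set \<Rightarrow> 'm \<Rightarrow> ('m, 'e) chart set" where
  "charts_at A x = {c \<in> A. x \<in> fst c}"

definition smooth_atlas :: "('m::topological_space, 'e::real_normed_vector) chart set \<Rightarrow> bool" where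
  "smooth_atlas A \<longleftrightarrow> (\<Union>c\<in>A. fst c) = UNIV \<and>
     (\<forall>c\<in>A. open (fst c) \<and> open (snd c ` fst c) \<and> inj_on (snd c) (fst c) \<and>
        continuous_on (fst c) (snd c) \<and> continuous_on (snd c ` fst c) (cinv c)) \<and>
     (\<forall>c\<in>A. \<forall>d\<in>A. smooth_on (snd c ` (fst c \<inter> fst d)) (snd d \<circ> cinv c))"

definition vs_atlas :: "('w::real_normed_vector, 'w) chart set" where
  "vs_atlas = {(UNIV, \<lambda>x. x)}"

definition prod_atlas ::
    "('m, 'e) chart set \<Rightarrow> ('n, 'f) chart set \<Rightarrow> ('m \<times> 'n, 'e \<times> 'f) chart set" where
  "prod_atlas A B = {(fst c \<times> fst d, map_prod (snd c) (snd d)) | c d. c \<in> A \<and> d \<in> B}"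

definition smooth_map_open :: "('m::topological_space, 'e::real_normed_vector) chart set \<Rightarrow> 'm set \<Rightarrow>
    ('n::topological_space, 'f::real_normed_vector) chart set \<Rightarrow> ('m \<Rightarrow> 'n) \<Rightarrow> bool" where
  "smooth_map_open A V B f \<longleftrightarrow> continuous_on V f \<and>
     (\<forall>c\<in>A. \<forall>d\<in>B. smooth_on (snd c ` (fst c \<inter> V \<inter> f -` fst d)) (snd d \<circ> f \<circ> cinv c))"

text \<open>
  Smoothness on an arbitrary subset, via local smooth extensions. On an open subset this is
  smoothness in charts; on an embedded submanifold (such as a closed subgroup of a Lie group) it
  is smoothness for the submanifold structure.
\<close>

definition smooth_map_on :: "('m::topological_space, 'e::real_normed_vector) chart set \<Rightarrow> 'm set \<Rightarrow>
    ('n::topological_space, 'f::real_normed_vector) chart set \<Rightarrow> ('m \<Rightarrow> 'n) \<Rightarrow> bool" where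
  "smooth_map_on A S B f \<longleftrightarrow>
     (\<forall>x\<in>S. \<exists>V g. open V \<and> x \<in> V \<and> smooth_map_open A V B g \<and> (\<forall>y\<in>S \<inter> V. g y = f y))"

text \<open>
  A tangent vector at \<open>x\<close> is the family of its coordinate vectors in all charts around \<open>x\<close>,
  which transform by the derivatives of the chart changes; it is 0 on all other charts.
\<close>

type_synonym ('m, 'e) tvec = "('m, 'e) chart \<Rightarrow> 'e"

definition tangent_space ::
    "('m, 'e::real_normed_vector) chart set \<Rightarrow> 'm \<Rightarrow> ('m, 'e) tvec set" where
  "tangent_space A x = {v. (\<forall>c. c \<notin> charts_at A x \<longrightarrow> v c = 0) \<and>
     (\<forall>c\<in>charts_at A x. \<forall>d\<in>charts_at A x.
        v d = frechet_derivative (snd d \<circ> cinv c) (at (snd c x)) (v c))}"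

text \<open>The tangent vector at \<open>x\<close> whose coordinate vector in the chart \<open>c\<close> is \<open>e\<close>.\<close>

definition coord_vec ::
    "('m, 'e::real_normed_vector) chart set \<Rightarrow> ('m, 'e) chart \<Rightarrow> 'm \<Rightarrow> 'e \<Rightarrow> ('m, 'e) tvec" where
  "coord_vec A c x e = (\<lambda>d. if d \<in> charts_at A x
     then frechet_derivative (snd d \<circ> cinv c) (at (snd c x)) e else 0)"

text \<open>
  Derivative of a vector-valued function along a tangent vector; for differentiable functions and
  tangent vectors it does not depend on the chart.
\<close>

definition tderiv :: "('m, 'e::real_normed_vector) chart set \<Rightarrow>
    ('m \<Rightarrow> 'w::real_normed_vector) \<Rightarrow> 'm \<Rightarrow> ('m, 'e) tvec \<Rightarrow> 'w" where
  "tderiv A f x v = (let c = (SOME c. c \<in> charts_at A x)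
     in frechet_derivative (f \<circ> cinv c) (at (snd c x)) (v c))"

definition tmap :: "('m, 'e::real_normed_vector) chart set \<Rightarrow> ('n, 'f::real_normed_vector) chart set \<Rightarrow>
    ('m \<Rightarrow> 'n) \<Rightarrow> 'm \<Rightarrow> ('m, 'e) tvec \<Rightarrow> ('n, 'f) tvec" where
  "tmap A B f x v = (\<lambda>d. if d \<in> charts_at B (f x) then tderiv A (snd d \<circ> f) x v else 0)"

definition velocity ::
    "('m, 'e::real_normed_vector) chart set \<Rightarrow> (real \<Rightarrow> 'm) \<Rightarrow> real \<Rightarrow> ('m, 'e) tvec" where
  "velocity A \<gamma> t = (\<lambda>d. if d \<in> charts_at A (\<gamma> t)
     then vector_derivative (snd d \<circ> \<gamma>) (at t) else 0)"

section \<open>Lie algebras\<close>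

text \<open>All notions are relative to a bracket \<open>br\<close>; subalgebras and ideals are subsets.\<close>

definition lie_subalgebra :: "('a::real_vector \<Rightarrow> 'a \<Rightarrow> 'a) \<Rightarrow> 'a set \<Rightarrow> bool" where
  "lie_subalgebra br S \<longleftrightarrow> subspace S \<and> (\<forall>X\<in>S. \<forall>Y\<in>S. br X Y \<in> S)"

definition lie_ideal :: "('a::real_vector \<Rightarrow> 'a \<Rightarrow> 'a) \<Rightarrow> 'a set \<Rightarrow> 'a set \<Rightarrow> bool" where
  "lie_ideal br N S \<longleftrightarrow> subspace N \<and> N \<subseteq> S \<and> (\<forall>X\<in>S. \<forall>Y\<in>N. br X Y \<in> N \<and> br Y X \<in> N)"

primrec derived_series :: "('a::real_vector \<Rightarrow> 'a \<Rightarrow> 'a) \<Rightarrow> 'a set \<Rightarrow> nat \<Rightarrow> 'a set" where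
  "derived_series br S 0 = S"
| "derived_series br S (Suc k) =
     span {br X Y | X Y. X \<in> derived_series br S k \<and> Y \<in> derived_series br S k}"

primrec lower_central_series :: "('a::real_vector \<Rightarrow> 'a \<Rightarrow> 'a) \<Rightarrow> 'a set \<Rightarrow> nat \<Rightarrow> 'a set" where
  "lower_central_series br S 0 = S"
| "lower_central_series br S (Suc k) =
     span {br X Y | X Y. X \<in> S \<and> Y \<in> lower_central_series br S k}"

definition lie_solvable :: "('a::real_vector \<Rightarrow> 'a \<Rightarrow> 'a) \<Rightarrow> 'a set \<Rightarrow> bool" where
  "lie_solvable br S \<longleftrightarrow> (\<exists>k. derived_series br S k = {0})"

definition lie_nilpotent :: "('a::real_vector \<Rightarrow> 'a \<Rightarrow> 'a) \<Rightarrow> 'a set \<Rightarrow> bool" where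
  "lie_nilpotent br S \<longleftrightarrow> (\<exists>k. lower_central_series br S k = {0})"

definition lie_semisimple :: "('a::real_vector \<Rightarrow> 'a \<Rightarrow> 'a) \<Rightarrow> bool" where
  "lie_semisimple br \<longleftrightarrow> (\<forall>N. lie_ideal br N UNIV \<and> lie_solvable br N \<longrightarrow> N = {0})"

text \<open>The sum of all nilpotent ideals.\<close>

definition nilradical :: "('a::real_vector \<Rightarrow> 'a \<Rightarrow> 'a) \<Rightarrow> 'a set \<Rightarrow> 'a set" where
  "nilradical br S = span (\<Union>{N. lie_ideal br N S \<and> lie_nilpotent br N})"

text \<open>
  A complex Lie algebra is given by its underlying real Lie algebra together with the
  multiplication \<open>J\<close> by the imaginary unit. Borel subalgebras are maximal solvable
  complex subalgebras.
\<close>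

definition complex_solvable_subalgebra ::
    "('a::real_vector \<Rightarrow> 'a \<Rightarrow> 'a) \<Rightarrow> ('a \<Rightarrow> 'a) \<Rightarrow> 'a set \<Rightarrow> bool" where
  "complex_solvable_subalgebra br J S \<longleftrightarrow>
     lie_subalgebra br S \<and> (\<forall>X\<in>S. J X \<in> S) \<and> lie_solvable br S"

definition borel_subalgebra ::
    "('a::real_vector \<Rightarrow> 'a \<Rightarrow> 'a) \<Rightarrow> ('a \<Rightarrow> 'a) \<Rightarrow> 'a set \<Rightarrow> bool" where
  "borel_subalgebra br J b \<longleftrightarrow> complex_solvable_subalgebra br J b \<and>
     (\<forall>c. complex_solvable_subalgebra br J c \<and> b \<subseteq> c \<longrightarrow> c = b)"

definition complex_parabolic ::
    "('a::real_vector \<Rightarrow> 'a \<Rightarrow> 'a) \<Rightarrow> ('a \<Rightarrow> 'a) \<Rightarrow> 'a set \<Rightarrow> bool" where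
  "complex_parabolic br J S \<longleftrightarrow> lie_subalgebra br S \<and> (\<forall>X\<in>S. J X \<in> S) \<and>
     (\<exists>b. borel_subalgebra br J b \<and> b \<subseteq> S)"

text \<open>
  The complexification consists of pairs \<open>(X, Y)\<close> standing for \<open>X + iY\<close>. A subalgebra
  of a real Lie algebra is parabolic if its complexification is parabolic.
\<close>

definition complexified_bracket ::
    "('a::real_vector \<Rightarrow> 'a \<Rightarrow> 'a) \<Rightarrow> 'a \<times> 'a \<Rightarrow> 'a \<times> 'a \<Rightarrow> 'a \<times> 'a" where
  "complexified_bracket br X Y =
     (br (fst X) (fst Y) - br (snd X) (snd Y), br (fst X) (snd Y) + br (snd X) (fst Y))"

definition real_parabolic :: "('a::real_vector \<Rightarrow> 'a \<Rightarrow> 'a) \<Rightarrow> 'a set \<Rightarrow> bool" where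
  "real_parabolic br S \<longleftrightarrow>
     complex_parabolic (complexified_bracket br) (\<lambda>X. (- snd X, fst X)) (S \<times> S)"

section \<open>Lie groups\<close>

text \<open>
  The Lie algebra of \<open>G\<close> is the model space \<open>'v\<close>, identified with the tangent space at
  the unit element by means of the chart \<open>unit_chart G\<close> around it.
\<close>

record ('g, 'v) lie_grp = "'g monoid" +
  atlas :: "('g, 'v) chart set"
  unit_chart :: "('g, 'v) chart"

definition lie_group :: "('g::topological_space, 'v::real_normed_vector) lie_grp \<Rightarrow> bool" where
  "lie_group G \<longleftrightarrow> group G \<and> carrier G = UNIV \<and> smooth_atlas (atlas G) \<and>
     unit_chart G \<in> charts_at (atlas G) \<one>\<^bsub>G\<^esub> \<and>
     smooth_map_on (prod_atlas (atlas G) (atlas G)) UNIV (atlas G) (\<lambda>(g, h). g \<otimes>\<^bsub>G\<^esub> h) \<and>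
     smooth_map_on (atlas G) UNIV (atlas G) (\<lambda>g. inv\<^bsub>G\<^esub> g)"

text \<open>\<open>Ad g\<close> is the derivative of the conjugation by \<open>g\<close> at the unit element.\<close>

definition Ad :: "('g, 'v::real_normed_vector) lie_grp \<Rightarrow> 'g \<Rightarrow> 'v \<Rightarrow> 'v" where
  "Ad G g X = (let c = unit_chart G in
     frechet_derivative (\<lambda>y. snd c (g \<otimes>\<^bsub>G\<^esub> cinv c y \<otimes>\<^bsub>G\<^esub> inv\<^bsub>G\<^esub> g)) (at (snd c \<one>\<^bsub>G\<^esub>)) X)"

text \<open>\<open>[X, Y] = ad X Y\<close>, where \<open>ad\<close> is the derivative of \<open>Ad\<close> at the unit element.\<close>

definition lie_bracket :: "('g, 'v::real_normed_vector) lie_grp \<Rightarrow> 'v \<Rightarrow> 'v \<Rightarrow> 'v" where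
  "lie_bracket G X Y = (let c = unit_chart G in
     frechet_derivative (\<lambda>y. Ad G (cinv c y) Y) (at (snd c \<one>\<^bsub>G\<^esub>)) X)"

text \<open>The curves \<open>t \<mapsto> exp (t X)\<close> are the one-parameter subgroups with initial velocity \<open>X\<close>.\<close>

definition one_param_subgroup ::
    "('g::topological_space, 'v::real_normed_vector) lie_grp \<Rightarrow> 'v \<Rightarrow> (real \<Rightarrow> 'g) \<Rightarrow> bool" where
  "one_param_subgroup G X \<gamma> \<longleftrightarrow> smooth_map_on vs_atlas UNIV (atlas G) \<gamma> \<and>
     (\<forall>s t. \<gamma> (s + t) = \<gamma> s \<otimes>\<^bsub>G\<^esub> \<gamma> t) \<and> velocity (atlas G) \<gamma> 0 (unit_chart G) = X"

definition exp_image ::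
    "('g::topological_space, 'v::real_normed_vector) lie_grp \<Rightarrow> 'v set \<Rightarrow> 'g set" where
  "exp_image G S = {\<gamma> 1 | \<gamma> X. X \<in> S \<and> one_param_subgroup G X \<gamma>}"

text \<open>The Lie algebra of a closed subgroup.\<close>

definition lie_algebra_of ::
    "('g::topological_space, 'v::real_normed_vector) lie_grp \<Rightarrow> 'g set \<Rightarrow> 'v set" where
  "lie_algebra_of G H = {X. \<exists>\<gamma>. one_param_subgroup G X \<gamma> \<and> range \<gamma> \<subseteq> H}"

text \<open>
  \<open>J\<close> makes \<open>G\<close> a complex Lie group: it is a complex structure on the Lie algebra for
  which the bracket is complex bilinear and the adjoint action is complex linear.
\<close>

definition complex_lie_structure ::
    "('g, 'v::real_normed_vector) lie_grp \<Rightarrow> ('v \<Rightarrow> 'v) \<Rightarrow> bool" where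
  "complex_lie_structure G J \<longleftrightarrow> linear J \<and> (\<forall>X. J (J X) = - X) \<and>
     (\<forall>X Y. lie_bracket G (J X) Y = J (lie_bracket G X Y) \<and>
            lie_bracket G X (J Y) = J (lie_bracket G X Y)) \<and>
     (\<forall>g X. Ad G g (J X) = J (Ad G g X))"

text \<open>
  Nested parabolic subalgebras \<open>qq \<subseteq> pp\<close>; the two disjuncts are the cases of a real and
  of a complex group.
\<close>

definition nested_parabolics ::
    "('g, 'v::real_normed_vector) lie_grp \<Rightarrow> 'v set \<Rightarrow> 'v set \<Rightarrow> bool" where
  "nested_parabolics G qq pp \<longleftrightarrow> qq \<subseteq> pp \<and>
     (real_parabolic (lie_bracket G) qq \<and> real_parabolic (lie_bracket G) pp \<or>
      (\<exists>J. complex_lie_structure G J \<and>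
         complex_parabolic (lie_bracket G) J qq \<and> complex_parabolic (lie_bracket G) J pp))"

text \<open>
  A parabolic subgroup with Lie algebra \<open>pp\<close>. Subgroups with Lie algebra \<open>pp\<close>
  normalize \<open>pp\<close>, so the closed ones are those between the normalizer of \<open>pp\<close> and
  its identity component.
\<close>

definition parabolic_subgroup ::
    "('g::topological_space, 'v::real_normed_vector) lie_grp \<Rightarrow> 'v set \<Rightarrow> 'g set \<Rightarrow> bool" where
  "parabolic_subgroup G pp P \<longleftrightarrow> subgroup P G \<and> closed P \<and> lie_algebra_of G P = pp"

definition normalizer_in ::
    "('g, 'v::real_normed_vector) lie_grp \<Rightarrow> 'g set \<Rightarrow> 'v set \<Rightarrow> 'g set" where
  "normalizer_in G P qq = {g \<in> P. Ad G g ` qq = qq}"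

section \<open>Representations\<close>

definition representation :: "('g::topological_space, 'v::real_normed_vector) lie_grp \<Rightarrow> 'g set \<Rightarrow>
    ('g \<Rightarrow> 'w::real_normed_vector \<Rightarrow>\<^sub>L 'w) \<Rightarrow> bool" where
  "representation G Q \<rho> \<longleftrightarrow> smooth_map_on (atlas G) Q vs_atlas \<rho> \<and> \<rho> \<one>\<^bsub>G\<^esub> = id_blinfun \<and>
     (\<forall>g\<in>Q. \<forall>h\<in>Q. \<rho> (g \<otimes>\<^bsub>G\<^esub> h) = \<rho> g o\<^sub>L \<rho> h)"

text \<open>The representations of \<open>Q\<close> that induce relative natural bundles.\<close>

definition relative_rep :: "('g::topological_space, 'v::real_normed_vector) lie_grp \<Rightarrow> 'g set \<Rightarrow> 'v set \<Rightarrow>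
    ('g \<Rightarrow> 'w::real_normed_vector \<Rightarrow>\<^sub>L 'w) \<Rightarrow> bool" where
  "relative_rep G Q pp \<rho> \<longleftrightarrow> representation G Q \<rho> \<and>
     (\<forall>g\<in>exp_image G (nilradical (lie_bracket G) pp). \<rho> g = id_blinfun)"

definition inf_rep :: "('g::topological_space, 'v::real_normed_vector) lie_grp \<Rightarrow> 'g set \<Rightarrow>
    ('g \<Rightarrow> 'w::real_normed_vector \<Rightarrow>\<^sub>L 'w) \<Rightarrow> 'v \<Rightarrow> 'w \<Rightarrow>\<^sub>L 'w" where
  "inf_rep G Q \<rho> X = (THE D. \<forall>\<gamma>. one_param_subgroup G X \<gamma> \<and> range \<gamma> \<subseteq> Q \<longrightarrow>
     ((\<lambda>t. \<rho> (\<gamma> t)) has_vector_derivative D) (at 0))"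

definition trivial_rep :: "'g \<Rightarrow> real \<Rightarrow>\<^sub>L real" where
  "trivial_rep g = id_blinfun"

definition dual_rep :: "('g, 'v) lie_grp \<Rightarrow> ('g \<Rightarrow> 'w::real_normed_vector \<Rightarrow>\<^sub>L 'w) \<Rightarrow>
    'g \<Rightarrow> ('w \<Rightarrow>\<^sub>L real) \<Rightarrow>\<^sub>L ('w \<Rightarrow>\<^sub>L real)" where
  "dual_rep G \<rho> g = Blinfun (\<lambda>l. l o\<^sub>L \<rho> (inv\<^bsub>G\<^esub> g))"

text \<open>
  The tensor product of finite-dimensional spaces, as the space of bilinear forms on the product
  of their duals.
\<close>

type_synonym ('w, 'f) tensor = "('w \<Rightarrow>\<^sub>L real) \<Rightarrow>\<^sub>L ('f \<Rightarrow>\<^sub>L real) \<Rightarrow>\<^sub>L real"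

definition tensor :: "'w::real_normed_vector \<Rightarrow> 'f::real_normed_vector \<Rightarrow> ('w, 'f) tensor" where
  "tensor w z = Blinfun (\<lambda>a. Blinfun (\<lambda>b. blinfun_apply a w * blinfun_apply b z))"

definition tensor_map :: "('w::real_normed_vector \<Rightarrow>\<^sub>L 'w) \<Rightarrow> ('f::real_normed_vector \<Rightarrow>\<^sub>L 'f) \<Rightarrow>
    ('w, 'f) tensor \<Rightarrow>\<^sub>L ('w, 'f) tensor" where
  "tensor_map A B = Blinfun (\<lambda>T. Blinfun (\<lambda>a. Blinfun (\<lambda>b.
     blinfun_apply (blinfun_apply T (a o\<^sub>L A)) (b o\<^sub>L B))))"

definition tensor_rep :: "('g \<Rightarrow> 'w::real_normed_vector \<Rightarrow>\<^sub>L 'w) \<Rightarrow>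
    ('g \<Rightarrow> 'f::real_normed_vector \<Rightarrow>\<^sub>L 'f) \<Rightarrow> 'g \<Rightarrow> ('w, 'f) tensor \<Rightarrow>\<^sub>L ('w, 'f) tensor" where
  "tensor_rep \<rho> \<rho>' g = tensor_map (\<rho> g) (\<rho>' g)"

section \<open>Cartan geometries\<close>

text \<open>
  The data of a Cartan geometry: atlases of the total space \<open>'b\<close> and of the base \<open>'m\<close>, the
  projection, the principal right action and the Cartan connection.
\<close>

record ('b, 'h, 'm, 'e, 'g, 'v) cartan_geom =
  tot_atlas :: "('b, 'h) chart set"
  base_atlas :: "('m, 'e) chart set"
  proj :: "'b \<Rightarrow> 'm"
  act :: "'b \<Rightarrow> 'g \<Rightarrow> 'b"
  conn :: "'b \<Rightarrow> ('b, 'h) tvec \<Rightarrow> 'v"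

text \<open>
  In the last clause \<open>u \<mapsto> (proj C u, \<kappa> u)\<close> is an equivariant local trivialization over \<open>U\<close>
  with inverse \<open>\<tau>\<close>.
\<close>

definition principal_bundle :: "('g::topological_space, 'v::real_normed_vector) lie_grp \<Rightarrow> 'g set \<Rightarrow>
    ('b::topological_space, 'h::real_normed_vector, 'm::topological_space, 'e::real_normed_vector, 'g, 'v)
      cartan_geom \<Rightarrow> bool" where
  "principal_bundle G Q C \<longleftrightarrow>
     smooth_atlas (tot_atlas C) \<and> smooth_atlas (base_atlas C) \<and>
     smooth_map_on (tot_atlas C) UNIV (base_atlas C) (proj C) \<and>
     smooth_map_on (prod_atlas (tot_atlas C) (atlas G)) (UNIV \<times> Q) (tot_atlas C)
       (\<lambda>(u, g). act C u g) \<and>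
     (\<forall>u. act C u \<one>\<^bsub>G\<^esub> = u) \<and>
     (\<forall>u. \<forall>g\<in>Q. \<forall>h\<in>Q. act C u (g \<otimes>\<^bsub>G\<^esub> h) = act C (act C u g) h) \<and>
     (\<forall>u. \<forall>g\<in>Q. proj C (act C u g) = proj C u) \<and>
     (\<forall>x. \<exists>U \<kappa> \<tau>. open U \<and> x \<in> U \<and>
        smooth_map_on (tot_atlas C) (proj C -` U) (atlas G) \<kappa> \<and>
        smooth_map_on (prod_atlas (base_atlas C) (atlas G)) (U \<times> Q) (tot_atlas C) \<tau> \<and>
        (\<forall>u\<in>proj C -` U. \<kappa> u \<in> Q \<and> \<tau> (proj C u, \<kappa> u) = u \<and>
           (\<forall>g\<in>Q. \<kappa> (act C u g) = \<kappa> u \<otimes>\<^bsub>G\<^esub> g)) \<and>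
        (\<forall>y\<in>U. \<forall>g\<in>Q. proj C (\<tau> (y, g)) = y \<and> \<kappa> (\<tau> (y, g)) = g))"

text \<open>
  The first two clauses say that \<open>conn C\<close> is a smooth one-form, the last one that it reproduces the
  generators of fundamental vector fields.
\<close>

definition cartan_connection :: "('g::topological_space, 'v::real_normed_vector) lie_grp \<Rightarrow> 'g set \<Rightarrow>
    ('b::topological_space, 'h::real_normed_vector, 'm, 'e, 'g, 'v) cartan_geom \<Rightarrow> bool" where
  "cartan_connection G Q C \<longleftrightarrow>
     (\<forall>c\<in>tot_atlas C. \<forall>u\<in>fst c. linear (\<lambda>e. conn C u (coord_vec (tot_atlas C) c u e))) \<and>
     (\<forall>c\<in>tot_atlas C. \<forall>e. smooth_on (snd c ` fst c)
        (\<lambda>y. conn C (cinv c y) (coord_vec (tot_atlas C) c (cinv c y) e))) \<and>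
     (\<forall>u. bij_betw (conn C u) (tangent_space (tot_atlas C) u) UNIV) \<and>
     (\<forall>g\<in>Q. \<forall>u. \<forall>v\<in>tangent_space (tot_atlas C) u.
        conn C (act C u g) (tmap (tot_atlas C) (tot_atlas C) (\<lambda>u. act C u g) u v)
          = Ad G (inv\<^bsub>G\<^esub> g) (conn C u v)) \<and>
     (\<forall>u X \<gamma>. one_param_subgroup G X \<gamma> \<and> range \<gamma> \<subseteq> Q \<longrightarrow>
        conn C u (velocity (tot_atlas C) (\<lambda>t. act C u (\<gamma> t)) 0) = X)"

definition cartan_geometry :: "('g::topological_space, 'v::real_normed_vector) lie_grp \<Rightarrow> 'g set \<Rightarrow>
    ('b::topological_space, 'h::real_normed_vector, 'm::topological_space, 'e::real_normed_vector, 'g, 'v)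
      cartan_geom \<Rightarrow> bool" where
  "cartan_geometry G Q C \<longleftrightarrow> principal_bundle G Q C \<and> cartan_connection G Q C"

section \<open>Natural bundles and their sections\<close>

text \<open>
  Sections of the bundle associated to an action \<open>a\<close> of \<open>Q\<close> on a vector space are
  represented by the corresponding smooth equivariant functions on the total space of the principal
  bundle.
\<close>

definition sections :: "('g, 'v) lie_grp \<Rightarrow> 'g set \<Rightarrow>
    ('b::topological_space, 'h::real_normed_vector, 'm, 'e, 'g, 'v) cartan_geom \<Rightarrow>
    ('g \<Rightarrow> 'w::real_normed_vector \<Rightarrow> 'w) \<Rightarrow> ('b \<Rightarrow> 'w) set" where
  "sections G Q C a = {\<sigma>. smooth_map_on (tot_atlas C) UNIV vs_atlas \<sigma> \<and>
     (\<forall>u. \<forall>g\<in>Q. \<sigma> (act C u g) = a (inv\<^bsub>G\<^esub> g) (\<sigma> u))}"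

definition coset :: "'w::real_normed_vector set \<Rightarrow> 'w \<Rightarrow> 'w set" where
  "coset T X = {X + Y | Y. Y \<in> T}"

text \<open>
  Sections of the bundle with fibre \<open>S/T\<close>, for invariant subspaces \<open>T \<subseteq> S\<close>, with values
  regarded as cosets. As \<open>S \<rightarrow> S/T\<close> is a surjective submersion, a map to \<open>S/T\<close> is
  smooth iff it has local smooth lifts. The lifts here need not be equivariant.
\<close>

definition quotient_sections :: "('g, 'v) lie_grp \<Rightarrow> 'g set \<Rightarrow>
    ('b::topological_space, 'h::real_normed_vector, 'm, 'e, 'g, 'v) cartan_geom \<Rightarrow>
    ('g \<Rightarrow> 'w::real_normed_vector \<Rightarrow> 'w) \<Rightarrow> 'w set \<Rightarrow> 'w set \<Rightarrow> ('b \<Rightarrow> 'w set) set" where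
  "quotient_sections G Q C a S T = {s. (\<forall>u. s u \<in> coset T ` S) \<and>
     (\<forall>u. \<exists>V f. open V \<and> u \<in> V \<and> smooth_map_on (tot_atlas C) V vs_atlas f \<and> (\<forall>y\<in>V. f y \<in> s y)) \<and>
     (\<forall>u. \<forall>g\<in>Q. s (act C u g) = a (inv\<^bsub>G\<^esub> g) ` s u)}"

definition bundle_sections where
  "bundle_sections G Q C \<rho> = sections G Q C (\<lambda>g. blinfun_apply (\<rho> g))"

text \<open>
  Sections of the adjoint tractor bundle, of its subbundle with fibre \<open>pp\<close>, of the relative
  adjoint tractor bundle, and of the subbundle \<open>\<A>\<^sup>0\<^sub>\<rho>M\<close> of the latter.
\<close>

definition "adjoint_sections G Q C = sections G Q C (Ad G)"

definition "p_sections G Q C pp = {s \<in> adjoint_sections G Q C. \<forall>u. s u \<in> pp}"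

definition "rel_adjoint_sections G Q C pp =
  quotient_sections G Q C (Ad G) pp (nilradical (lie_bracket G) pp)"

definition "rel_adjoint0_sections G Q C qq pp =
  quotient_sections G Q C (Ad G) qq (nilradical (lie_bracket G) pp)"

text \<open>The sections of the subbundle with fibre \<open>pp\<close> that project to \<open>s\<close>.\<close>

definition "lifts G Q C pp s =
  {s' \<in> p_sections G Q C pp. \<forall>u. coset (nilradical (lie_bracket G) pp) (s' u) = s u}"

text \<open>A function constant on the fibres, viewed as a function on the base.\<close>

definition descend :: "('b, 'h, 'm, 'e, 'g, 'v) cartan_geom \<Rightarrow> ('b \<Rightarrow> real) \<Rightarrow> 'm \<Rightarrow> real" where
  "descend C F x = (THE r. \<forall>u. proj C u = x \<longrightarrow> F u = r)"

text \<open>The value at \<open>u\<close> of the vector field on the total space that corresponds to \<open>s\<close>.\<close>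

definition inv_field :: "('b, 'h::real_normed_vector, 'm, 'e, 'g, 'v) cartan_geom \<Rightarrow>
    ('b \<Rightarrow> 'v) \<Rightarrow> 'b \<Rightarrow> ('b, 'h) tvec" where
  "inv_field C s u = the_inv_into (tangent_space (tot_atlas C) u) (conn C u) (s u)"

definition fund_deriv :: "('b, 'h::real_normed_vector, 'm, 'e, 'g, 'v) cartan_geom \<Rightarrow>
    ('b \<Rightarrow> 'v) \<Rightarrow> ('b \<Rightarrow> 'w::real_normed_vector) \<Rightarrow> 'b \<Rightarrow> 'w" where
  "fund_deriv C s \<sigma> u = tderiv (tot_atlas C) \<sigma> u (inv_field C s u)"

definition rel_fund_deriv :: "('g::topological_space, 'v::real_normed_vector) lie_grp \<Rightarrow> 'g set \<Rightarrow>
    ('b::topological_space, 'h::real_normed_vector, 'm, 'e, 'g, 'v) cartan_geom \<Rightarrow> 'v set \<Rightarrow>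
    ('g \<Rightarrow> 'w::real_normed_vector \<Rightarrow>\<^sub>L 'w) \<Rightarrow> ('b \<Rightarrow> 'v set) \<Rightarrow> ('b \<Rightarrow> 'w) \<Rightarrow> 'b \<Rightarrow> 'w" where
  "rel_fund_deriv G Q C pp \<rho> s \<sigma> = (THE \<sigma>'. \<sigma>' \<in> bundle_sections G Q C \<rho> \<and>
     (\<forall>s'\<in>lifts G Q C pp s. \<sigma>' = fund_deriv C s' \<sigma>))"

text \<open>The operation \<open>\<bullet>\<close> on sections, induced by the infinitesimal representation.\<close>

definition bullet :: "('g::topological_space, 'v::real_normed_vector) lie_grp \<Rightarrow> 'g set \<Rightarrow>
    ('g \<Rightarrow> 'w::real_normed_vector \<Rightarrow>\<^sub>L 'w) \<Rightarrow> ('b \<Rightarrow> 'v set) \<Rightarrow> ('b \<Rightarrow> 'w) \<Rightarrow> 'b \<Rightarrow> 'w" where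
  "bullet G Q \<rho> s \<sigma> u = (THE w. \<forall>X\<in>s u. inf_rep G Q \<rho> X (\<sigma> u) = w)"

text \<open>
  The vector field on the base given by a section of the bundle with fibre (a subspace of)
  \<open>\<gg>/\<qq>\<close>, under the identification of that bundle with the tangent bundle.
\<close>

definition tangent_field :: "('b, 'h::real_normed_vector, 'm, 'e::real_normed_vector, 'g, 'v) cartan_geom \<Rightarrow>
    ('b \<Rightarrow> 'v set) \<Rightarrow> 'm \<Rightarrow> ('m, 'e) tvec" where
  "tangent_field C t x = (THE v. \<forall>u. proj C u = x \<longrightarrow> (\<forall>X\<in>t u.
     v = tmap (tot_atlas C) (base_atlas C) (proj C) u
           (the_inv_into (tangent_space (tot_atlas C) u) (conn C u) X)))"

text \<open>\<open>\<Pi>\<^sub>\<rho>\<close>: on fibres, a coset of the nilradical is sent to the coset of \<open>qq\<close> containing it.\<close>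

definition Pi_rho :: "('b, 'h::real_normed_vector, 'm, 'e::real_normed_vector, 'g, 'v::real_normed_vector)
    cartan_geom \<Rightarrow> 'v set \<Rightarrow> ('b \<Rightarrow> 'v set) \<Rightarrow> 'm \<Rightarrow> ('m, 'e) tvec" where
  "Pi_rho C qq s = tangent_field C (\<lambda>u. \<Union>X\<in>s u. coset qq X)"

definition smooth_fun :: "('b, 'h, 'm::topological_space, 'e::real_normed_vector, 'g, 'v) cartan_geom \<Rightarrow>
    ('m \<Rightarrow> real) \<Rightarrow> bool" where
  "smooth_fun C f \<longleftrightarrow> smooth_map_on (base_atlas C) UNIV vs_atlas f"

definition field_deriv :: "('b, 'h, 'm, 'e::real_normed_vector, 'g, 'v) cartan_geom \<Rightarrow>
    ('m \<Rightarrow> ('m, 'e) tvec) \<Rightarrow> ('m \<Rightarrow> real) \<Rightarrow> 'm \<Rightarrow> real" where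
  "field_deriv C \<xi> f x = tderiv (base_atlas C) f x (\<xi> x)"

end

theory Submission
  imports Defs
begin

text \<open>
  A section of \<open>\<G> \<times>\<^sub>Q \<pp>/\<pp>\<^sub>+\<close> lifts locally, by means of a local trivialization of the principal
  bundle, and the local lifts can be averaged because the fibres of \<open>\<pp> \<rightarrow> \<pp>/\<pp>\<^sub>+\<close> are affine.

  The key to everything else is that \<open>\<pp>\<^sub>+ \<subseteq> \<qq>\<close>: a nilpotent ideal of \<open>\<pp>\<close>, added to a Borel subalgebra
  contained in \<open>\<qq>\<close>, gives a solvable subalgebra, so it lies in the Borel subalgebra already. Hence
  vectors in \<open>\<pp>\<^sub>+\<close>, and more generally in \<open>\<qq>\<close>, correspond to fundamental vector fields of the principal
  bundle, and along these an equivariant function is differentiated by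
  \<open>\<sigma>(u exp(tX)) = \<rho>(exp(-tX)) \<sigma>(u)\<close>. For \<open>X \<in> \<pp>\<^sub>+\<close> the right hand side is constant, so the
  derivative does not depend on the lift; for \<open>X \<in> \<qq>\<close> this is the formula \<open>D\<^sup>\<rho>\<^sub>s\<sigma> = -s \<bullet> \<sigma>\<close>. The remaining
  properties are the chain and product rules.
\<close>


section \<open>Calculus in finite-dimensional inner product spaces\<close>

text \<open>Several obstacles shape the proof. \<open>fund_deriv\<close> differentiates along the
  vector that the connection sends to \<open>s u\<close>, so its smoothness requires that this
  vector depend smoothly on \<open>u\<close>: a statement about linear equations with smooth
  invertible coefficients. \<open>Ck_on\<close> controls derivatives in fixed directions only, hence
  the recurring expansion along a finite orthonormal basis, which may be empty.
  \<open>rel_fund_deriv\<close> is a definite description quantifying over global lifts and need not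
  single out a section if there are none; so a global equivariant lift must be built even though the
  comparison of two lifts is pointwise. On \<open>Q\<close> smoothness means local extension to the
  group, and the infinitesimal representation is obtained by differentiating such an extension at
  the unit element. Finally, \<open>nilradical\<close> is spanned by real ideals while Borel
  subalgebras are complex: the complex case enlarges an ideal N by J N, and the real case passes to
  the complexification.\<close>

lemma finite_orthonormal:
  fixes B :: "'a::{real_inner,heine_borel} set"
  assumes B: "\<And>b. b \<in> B \<Longrightarrow> norm b = 1" "pairwise orthogonal B"
  shows "finite B"
proof (rule ccontr)
  assume "infinite B"
  then obtain f :: "nat \<Rightarrow> 'a" where f: "inj f" "range f \<subseteq> B"
    using infinite_countable_subset by blast
  \<comment> \<open>Distinct orthonormal vectors are at distance sqrt 2, so no subsequence of
    \<open>f\<close> is Cauchy, although the Heine-Borel property provides a convergent one.\<close>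
  have "bounded (range f)"
    unfolding bounded_iff using B(1) f(2) by (intro exI[of _ 1]) (metis order_refl subsetD)
  then obtain l r where lr: "strict_mono (r :: nat \<Rightarrow> nat)" "(f \<circ> r) \<longlonglongrightarrow> l"
    using bounded_imp_convergent_subsequence by blast
  then have "Cauchy (f \<circ> r)" by (simp add: LIMSEQ_imp_Cauchy)
  then obtain N where N: "\<And>m n. m \<ge> N \<Longrightarrow> n \<ge> N \<Longrightarrow> dist ((f \<circ> r) m) ((f \<circ> r) n) < 1"
    unfolding Cauchy_def by (metis zero_less_one)
  define x y where "x = f (r N)" and "y = f (r (Suc N))"
  have "x \<noteq> y" unfolding x_def y_def
    using f(1) lr(1) by (metis injD lessI less_irrefl strict_mono_less)
  moreover have "x \<in> B" "y \<in> B" using f by (auto simp: x_def y_def)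
  ultimately have "norm x = 1" "norm y = 1" "inner x y = 0"
    using B by (auto simp: pairwise_def orthogonal_def)
  then have "(norm (x - y))\<^sup>2 = 2"
    by (simp add: dot_norm_neg)
  moreover have "norm (x - y) < 1"
    using N[of N "Suc N"] by (simp add: x_def y_def dist_norm)
  then have "(norm (x - y))\<^sup>2 < 1" by (simp add: power_less_one_iff)
  ultimately show False by simp
qed

text \<open>Records what later sums over a basis use: finiteness and the expansion formula. In
  dimension 0 the empty set qualifies.\<close>

definition is_onb :: "'a::{real_inner,heine_borel} set \<Rightarrow> bool" where
  "is_onb B \<longleftrightarrow> finite B \<and> (\<forall>x. (\<Sum>b\<in>B. inner x b *\<^sub>R b) = x)"

definition onb :: "'a::{real_inner,heine_borel} set" where
  "onb = (SOME B. is_onb B)"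

text \<open>Zorn's lemma gives a maximal orthonormal set. If the expansion of some vector left a
  remainder, normalizing the remainder would enlarge the set.\<close>

lemma onb_exists:
  "\<exists>B :: 'a::{real_inner,heine_borel} set. is_onb B"
proof -
  define F where "F = {B :: 'a set. (\<forall>b\<in>B. norm b = 1) \<and> pairwise orthogonal B}"
  have "\<exists>M\<in>F. \<forall>X\<in>F. M \<subseteq> X \<longrightarrow> X = M"
  proof (rule subset_Zorn)
    fix C assume C: "subset.chain F C"
    have "\<Union>C \<in> F"
      unfolding F_def
    proof (intro CollectI conjI ballI)
      show "norm b = 1" if "b \<in> \<Union>C" for b
        using that C by (auto simp: subset.chain_def F_def)
      show "pairwise orthogonal (\<Union>C)"
      proof (rule pairwiseI)
        fix x y assume xy: "x \<in> \<Union>C" "y \<in> \<Union>C" "x \<noteq> y"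
        then obtain X Y where XY: "X \<in> C" "Y \<in> C" "x \<in> X" "y \<in> Y" by blast
        then have "X \<subseteq> Y \<or> Y \<subseteq> X" "X \<in> F" "Y \<in> F"
          using C by (auto simp: subset.chain_def)
        then show "orthogonal x y"
          using XY xy unfolding F_def pairwise_def by blast
      qed
    qed
    then show "\<exists>U\<in>F. \<forall>X\<in>C. X \<subseteq> U" by blast
  qed
  then obtain B where B: "B \<in> F" and max: "\<And>X. X \<in> F \<Longrightarrow> B \<subseteq> X \<Longrightarrow> X = B" by blast
  have fin: "finite B"
    using B by (intro finite_orthonormal) (auto simp: F_def)
  have "(\<Sum>b\<in>B. inner x b *\<^sub>R b) = x" for x
  proof (rule ccontr)
    define y where "y = x - (\<Sum>b\<in>B. inner x b *\<^sub>R b)"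
    assume "(\<Sum>b\<in>B. inner x b *\<^sub>R b) \<noteq> x"
    then have y0: "y \<noteq> 0" by (simp add: y_def)
    have orth: "inner y b = 0" if "b \<in> B" for b
    proof -
      have "inner (\<Sum>c\<in>B. inner x c *\<^sub>R c) b = (\<Sum>c\<in>B. inner x c * inner c b)"
        by (simp add: inner_sum_left)
      also have "\<dots> = (\<Sum>c\<in>B. if c = b then inner x b else 0)"
        using B that by (intro sum.cong) (auto simp: F_def pairwise_def orthogonal_def dot_square_norm)
      also have "\<dots> = inner x b" using fin that by simp
      finally show ?thesis by (simp add: y_def inner_diff_left)
    qed
    define z where "z = y /\<^sub>R norm y"
    have "insert z B \<in> F"
      using B orth y0 by (auto simp: F_def pairwise_insert orthogonal_def z_def inner_commute)
    then have "z \<in> B" using max by blast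
    then have "inner y z = 0" by (rule orth)
    then show False using y0 by (simp add: z_def)
  qed
  then show ?thesis using fin by (intro exI[of _ B]) (simp add: is_onb_def)
qed

lemma is_onb_onb: "is_onb onb"
  unfolding onb_def by (rule someI_ex[OF onb_exists])

lemma finite_onb: "finite (onb :: 'a::{real_inner,heine_borel} set)"
  using is_onb_onb[where 'a='a] by (simp add: is_onb_def)

lemma onb_expand: "(\<Sum>b\<in>onb. inner x b *\<^sub>R b) = (x :: 'a::{real_inner,heine_borel})"
  using is_onb_onb[where 'a='a] by (simp add: is_onb_def)

text \<open>Reduces regularity of a linear map depending on a parameter to that of its values on
  finitely many fixed vectors.\<close>

lemma linear_onb_expand:
  fixes f :: "'a::{real_inner,heine_borel} \<Rightarrow> 'b::real_vector"
  assumes "linear f"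
  shows "f x = (\<Sum>b\<in>onb. inner x b *\<^sub>R f b)"
proof -
  have "f x = f (\<Sum>b\<in>onb. inner x b *\<^sub>R b)" by (simp add: onb_expand)
  also have "\<dots> = (\<Sum>b\<in>onb. inner x b *\<^sub>R f b)"
    using assms by (simp add: linear_sum linear_cmul)
  finally show ?thesis .
qed

lemma linear_imp_bounded_linear:
  fixes f :: "'a::{real_inner,heine_borel} \<Rightarrow> 'b::real_normed_vector"
  assumes "linear f"
  shows "bounded_linear f"
proof -
  have "bounded_linear (\<lambda>x. \<Sum>b\<in>onb. inner x b *\<^sub>R f b)"
    by (intro bounded_linear_sum bounded_linear_scaleR_const bounded_linear_inner_left)
  moreover have "f = (\<lambda>x. \<Sum>b\<in>onb. inner x b *\<^sub>R f b)"
    using linear_onb_expand[OF assms] by (rule ext)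
  ultimately show ?thesis by (rule ssubst[rotated])
qed

section \<open>Calculus of k times continuously differentiable maps\<close>

lemma Ck_on_subset: "Ck_on k T f \<Longrightarrow> S \<subseteq> T \<Longrightarrow> Ck_on k S f"
  by (induction k arbitrary: f) (auto intro: continuous_on_subset)

lemma frechet_derivative_eqI: "(f has_derivative f') (at x) \<Longrightarrow> frechet_derivative f (at x) = f'"
  by (metis frechet_derivative_at)

text \<open>\<open>frechet_derivative\<close> chooses from the predicate
  \<open>has_derivative\<close>, which is the same for both functions. So the equality holds even
  where neither is differentiable.\<close>

lemma frechet_derivative_cong:
  assumes "open S" "x \<in> S" "\<And>y. y \<in> S \<Longrightarrow> f y = g y"
  shows "frechet_derivative f (at x) = frechet_derivative g (at x)"
proof -
  have "(f has_derivative D) (at x) \<longleftrightarrow> (g has_derivative D) (at x)" for D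
    using assms by (metis has_derivative_transform_within_open)
  then show ?thesis unfolding frechet_derivative_def by simp
qed

lemma differentiable_cong_open:
  assumes "open S" "x \<in> S" "\<And>y. y \<in> S \<Longrightarrow> f y = g y" "f differentiable (at x)"
  shows "g differentiable (at x)"
  using assms unfolding differentiable_def by (metis has_derivative_transform_within_open)

lemma Ck_on_cong:
  assumes "open S" "\<And>x. x \<in> S \<Longrightarrow> f x = g x" "Ck_on k S f"
  shows "Ck_on k S g"
  using assms(2,3)
proof (induction k arbitrary: f g)
  case 0
  then show ?case by (metis Ck_on.simps(1) continuous_on_cong)
next
  case (Suc k)
  have "g differentiable (at x)" if "x \<in> S" for x
    using Suc.prems differentiable_cong_open[OF assms(1) that, of f g] that by auto
  moreover have "Ck_on k S (\<lambda>x. frechet_derivative g (at x) v)" for v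
  proof (rule Suc.IH)
    show "Ck_on k S (\<lambda>x. frechet_derivative f (at x) v)" using Suc.prems by simp
    show "frechet_derivative f (at x) v = frechet_derivative g (at x) v" if "x \<in> S" for x
      using frechet_derivative_cong[OF assms(1) that, of f g] Suc.prems(1) by simp
  qed
  ultimately show ?case by simp
qed

lemma Ck_on_SucI:
  assumes "open S" "\<And>x. x \<in> S \<Longrightarrow> (f has_derivative f' x) (at x)" "\<And>v. Ck_on k S (\<lambda>x. f' x v)"
  shows "Ck_on (Suc k) S f"
proof -
  have "Ck_on k S (\<lambda>x. frechet_derivative f (at x) v)" for v
    by (rule Ck_on_cong[OF assms(1) _ assms(3)]) (simp add: frechet_derivative_eqI[OF assms(2)])
  moreover have "f differentiable (at x)" if "x \<in> S" for x
    using assms(2)[OF that] by (auto simp: differentiable_def)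
  ultimately show ?thesis by simp
qed

lemma Ck_on_Suc_has_derivative:
  "Ck_on (Suc k) S f \<Longrightarrow> x \<in> S \<Longrightarrow> (f has_derivative frechet_derivative f (at x)) (at x)"
  by (simp add: frechet_derivative_works)

lemma Ck_on_Suc_frechet: "Ck_on (Suc k) S f \<Longrightarrow> Ck_on k S (\<lambda>x. frechet_derivative f (at x) v)"
  by simp

lemma Ck_on_SucD: "Ck_on (Suc k) S f \<Longrightarrow> Ck_on k S f"
proof (induction k arbitrary: f)
  case 0
  then show ?case
    by (auto intro!: continuous_at_imp_continuous_on differentiable_imp_continuous_within)
next
  case (Suc k)
  then show ?case by auto
qed

lemma Ck_on_imp_continuous_on: "Ck_on k S f \<Longrightarrow> continuous_on S f"
  by (induction k) (simp, metis Ck_on_SucD)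

lemma Ck_on_local:
  assumes "\<And>x. x \<in> S \<Longrightarrow> \<exists>W. open W \<and> x \<in> W \<and> Ck_on k W f"
  shows "Ck_on k S f"
  using assms
proof (induction k arbitrary: f)
  case 0
  then show ?case
    by (intro Ck_on.simps(1)[THEN iffD2] continuous_at_imp_continuous_on)
      (metis Ck_on.simps(1) continuous_on_eq_continuous_at)
next
  case (Suc k)
  have "f differentiable (at x)" if "x \<in> S" for x
    using Suc.prems[OF that] by auto
  moreover have "Ck_on k S (\<lambda>x. frechet_derivative f (at x) v)" for v
  proof (rule Suc.IH)
    show "\<exists>W. open W \<and> x \<in> W \<and> Ck_on k W (\<lambda>x. frechet_derivative f (at x) v)" if "x \<in> S" for x
      using Suc.prems[OF that] unfolding Ck_on.simps(2) by blast
  qed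
  ultimately show ?case by simp
qed

lemma Ck_on_const: "Ck_on k S (\<lambda>x. c)"
proof (induction k arbitrary: c)
  case (Suc k)
  have "frechet_derivative (\<lambda>x. c) (at x) = (\<lambda>v. 0)" for x :: 'a
    by (rule frechet_derivative_eqI) simp
  then show ?case using Suc by simp
qed simp

declare Ck_on.simps(2) [simp del]

lemma Ck_on_bounded_linear:
  assumes "open S" "bounded_linear L" "Ck_on k S f"
  shows "Ck_on k S (\<lambda>x. L (f x))"
  using assms(3)
proof (induction k arbitrary: f)
  case 0
  then show ?case using assms(2) by (simp add: bounded_linear.continuous_on)
next
  case (Suc k)
  show ?case
    by (rule Ck_on_SucI[OF assms(1) bounded_linear.has_derivative[OF assms(2)]
          Suc.IH[OF Ck_on_Suc_frechet[OF Suc.prems]]])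
      (rule Ck_on_Suc_has_derivative[OF Suc.prems])
qed

lemma Ck_on_ident: "Ck_on k S (\<lambda>x. x)"
proof (cases k)
  case (Suc m)
  have "frechet_derivative (\<lambda>x. x) (at x) = (\<lambda>v. v)" for x :: 'a
    by (rule frechet_derivative_eqI) simp
  then show ?thesis using Suc by (simp add: Ck_on_const Ck_on.simps(2))
qed simp

lemma Ck_on_add:
  assumes "open S" "Ck_on k S f" "Ck_on k S g"
  shows "Ck_on k S (\<lambda>x. f x + g x)"
  using assms(2,3)
proof (induction k arbitrary: f g)
  case (Suc k)
  show ?case
    by (rule Ck_on_SucI[OF assms(1) has_derivative_add[OF
          Ck_on_Suc_has_derivative[OF Suc.prems(1)] Ck_on_Suc_has_derivative[OF Suc.prems(2)]]
          Suc.IH[OF Suc.prems[THEN Ck_on_Suc_frechet]]])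
qed (simp add: continuous_on_add)

lemma Ck_on_sum:
  assumes "open S" "\<And>i. i \<in> I \<Longrightarrow> Ck_on k S (f i)"
  shows "Ck_on k S (\<lambda>x. \<Sum>i\<in>I. f i x)"
  using assms(2)
  by (induction I rule: infinite_finite_induct) (auto intro: Ck_on_const Ck_on_add[OF assms(1)])

text \<open>The product rule produces two terms of the same bilinear shape, one order lower; this is
  why the induction leaves \<open>f\<close> and \<open>g\<close> arbitrary.\<close>

lemma Ck_on_bilinear:
  assumes "open S" "bounded_bilinear B" "Ck_on k S f" "Ck_on k S g"
  shows "Ck_on k S (\<lambda>x. B (f x) (g x))"
  using assms(3,4)
proof (induction k arbitrary: f g)
  case 0
  then show ?case using assms(2) by (simp add: bounded_bilinear.continuous_on)
next
  case (Suc k)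
  show ?case
  proof (rule Ck_on_SucI[OF assms(1) bounded_bilinear.FDERIV[OF assms(2)]])
    fix x assume "x \<in> S"
    then show "(f has_derivative frechet_derivative f (at x)) (at x)"
      "(g has_derivative frechet_derivative g (at x)) (at x)"
      using Suc.prems Ck_on_Suc_has_derivative by blast+
  next
    fix v
    show "Ck_on k S (\<lambda>x. B (f x) (frechet_derivative g (at x) v) + B (frechet_derivative f (at x) v) (g x))"
      using Suc.prems Ck_on_SucD[OF Suc.prems(1)] Ck_on_SucD[OF Suc.prems(2)]
      by (intro Ck_on_add[OF assms(1)] Suc.IH Ck_on_Suc_frechet)
  qed
qed

lemma Ck_on_Pair:
  assumes "open S" "Ck_on k S f" "Ck_on k S g"
  shows "Ck_on k S (\<lambda>x. (f x, g x))"
  using assms(2,3)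
proof (induction k arbitrary: f g)
  case (Suc k)
  show ?case
    by (rule Ck_on_SucI[OF assms(1) has_derivative_Pair[OF
          Ck_on_Suc_has_derivative[OF Suc.prems(1)] Ck_on_Suc_has_derivative[OF Suc.prems(2)]]
          Suc.IH[OF Suc.prems[THEN Ck_on_Suc_frechet]]])
qed (simp add: continuous_on_Pair)

text \<open>\<open>Ck_on\<close> speaks of one fixed direction at a time. Expanding the moving
  vector \<open>w x\<close> in the basis leaves a finite sum of products of such functions.\<close>

lemma Ck_on_linear_expand:
  fixes w :: "'a::real_normed_vector \<Rightarrow> 'b::{real_inner,heine_borel}"
  assumes "open S" "\<And>x. x \<in> S \<Longrightarrow> linear (L x)" "\<And>b. Ck_on k S (\<lambda>x. L x b)" "Ck_on k S w"
  shows "Ck_on k S (\<lambda>x. L x (w x))"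
proof (rule Ck_on_cong[OF assms(1)])
  show "(\<Sum>b\<in>onb. inner (w x) b *\<^sub>R L x b) = L x (w x)" if "x \<in> S" for x
    using linear_onb_expand[OF assms(2)[OF that], of "w x"] by simp
  show "Ck_on k S (\<lambda>x. \<Sum>b\<in>onb. inner (w x) b *\<^sub>R L x b)"
    by (intro Ck_on_sum[OF assms(1)] Ck_on_bilinear[OF assms(1) bounded_bilinear_scaleR] assms(3)
        Ck_on_bounded_linear[OF assms(1) bounded_linear_inner_left assms(4)])
qed

text \<open>By the chain rule the derivative of \<open>g\<close> is applied to a vector that moves
  with \<open>x\<close>. \<open>Ck_on_linear_expand\<close> treats this, which is why the middle
  space is finite dimensional.\<close>

lemma Ck_on_compose:
  fixes f :: "'a::real_normed_vector \<Rightarrow> 'b::{real_inner,heine_borel}"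
  assumes S: "open S" and T: "open T" and sub: "f ` S \<subseteq> T"
    and f: "Ck_on k S f" and g: "Ck_on k T g"
  shows "Ck_on k S (\<lambda>x. g (f x))"
  using f g
proof (induction k arbitrary: g)
  case 0
  then show ?case using sub continuous_on_compose2 by auto
next
  case (Suc k)
  have gd: "(g has_derivative frechet_derivative g (at (f x))) (at (f x))" if "x \<in> S" for x
    using Suc.prems(2) sub that Ck_on_Suc_has_derivative by blast
  show ?case
  proof (rule Ck_on_SucI[OF S])
    show "((\<lambda>x. g (f x)) has_derivative (\<lambda>v. frechet_derivative g (at (f x)) (frechet_derivative f (at x) v))) (at x)"
      if "x \<in> S" for x
      using has_derivative_compose[OF Ck_on_Suc_has_derivative[OF Suc.prems(1) that] gd[OF that]] .
    fix v
    show "Ck_on k S (\<lambda>x. frechet_derivative g (at (f x)) (frechet_derivative f (at x) v))"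
    proof (rule Ck_on_linear_expand[OF S])
      show "linear (frechet_derivative g (at (f x)))" if "x \<in> S" for x
        using gd[OF that] has_derivative_linear by blast
      show "Ck_on k S (\<lambda>x. frechet_derivative g (at (f x)) b)" for b
        using Suc.prems by (intro Suc.IH[OF Ck_on_SucD] Ck_on_Suc_frechet)
      show "Ck_on k S (\<lambda>x. frechet_derivative f (at x) v)"
        using Suc.prems by (intro Ck_on_Suc_frechet)
    qed
  qed
qed

lemma smooth_on_subset: "smooth_on T f \<Longrightarrow> S \<subseteq> T \<Longrightarrow> smooth_on S f"
  unfolding smooth_on_def by (metis Ck_on_subset)

lemma smooth_on_cong:
  "open S \<Longrightarrow> (\<And>x. x \<in> S \<Longrightarrow> f x = g x) \<Longrightarrow> smooth_on S f \<Longrightarrow> smooth_on S g"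
  unfolding smooth_on_def by (metis Ck_on_cong)

lemma smooth_on_local:
  assumes "\<And>x. x \<in> S \<Longrightarrow> \<exists>W. open W \<and> x \<in> W \<and> smooth_on W f"
  shows "smooth_on S f"
  unfolding smooth_on_def
proof
  fix k
  show "Ck_on k S f"
    by (rule Ck_on_local) (use assms in \<open>unfold smooth_on_def, blast\<close>)
qed

lemma smooth_on_const: "smooth_on S (\<lambda>x. c)"
  and smooth_on_ident: "smooth_on S (\<lambda>x. x)"
  by (simp_all add: smooth_on_def Ck_on_const Ck_on_ident)

lemma smooth_on_bounded_linear:
  assumes "open S" "bounded_linear L" "smooth_on S f"
  shows "smooth_on S (\<lambda>x. L (f x))"
  using assms unfolding smooth_on_def by (intro allI Ck_on_bounded_linear[OF assms(1,2)]) (erule spec)+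

lemma smooth_on_bilinear:
  assumes "open S" "bounded_bilinear B" "smooth_on S f" "smooth_on S g"
  shows "smooth_on S (\<lambda>x. B (f x) (g x))"
  using assms unfolding smooth_on_def by (intro allI Ck_on_bilinear[OF assms(1,2)]) (erule spec)+

lemma smooth_on_add:
  assumes "open S" "smooth_on S f" "smooth_on S g"
  shows "smooth_on S (\<lambda>x. f x + g x)"
  using assms unfolding smooth_on_def by (intro allI Ck_on_add[OF assms(1)]) (erule spec)+

lemma smooth_on_Pair:
  assumes "open S" "smooth_on S f" "smooth_on S g"
  shows "smooth_on S (\<lambda>x. (f x, g x))"
  using assms unfolding smooth_on_def by (intro allI Ck_on_Pair[OF assms(1)]) (erule spec)+

lemma smooth_on_linear_expand:
  fixes w :: "'a::real_normed_vector \<Rightarrow> 'b::{real_inner,heine_borel}"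
  assumes "open S" "\<And>x. x \<in> S \<Longrightarrow> linear (L x)" "\<And>b. smooth_on S (\<lambda>x. L x b)" "smooth_on S w"
  shows "smooth_on S (\<lambda>x. L x (w x))"
  unfolding smooth_on_def
proof
  fix k
  have "Ck_on k S (\<lambda>x. L x b)" "Ck_on k S w" for b
    using assms(3,4) unfolding smooth_on_def by auto
  with assms(1,2) show "Ck_on k S (\<lambda>x. L x (w x))"
    by (rule Ck_on_linear_expand[where L = L and w = w])
qed

lemma smooth_on_compose:
  fixes f :: "'a::real_normed_vector \<Rightarrow> 'b::{real_inner,heine_borel}"
  assumes "open S" "open T" "f ` S \<subseteq> T" "smooth_on S f" "smooth_on T g"
  shows "smooth_on S (\<lambda>x. g (f x))"
  using assms(4,5) unfolding smooth_on_def by (blast intro: Ck_on_compose[OF assms(1-3), where g = g])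

lemma smooth_on_imp_continuous_on: "smooth_on S f \<Longrightarrow> continuous_on S f"
  unfolding smooth_on_def by (rule Ck_on_imp_continuous_on) (erule spec)

lemma smooth_on_imp_differentiable:
  assumes "smooth_on S f" "x \<in> S"
  shows "f differentiable (at x)"
proof -
  have "Ck_on (Suc 0) S f" using assms(1) unfolding smooth_on_def by (rule spec)
  then show ?thesis using assms(2) by (simp add: Ck_on.simps(2))
qed

lemma smooth_on_frechet_derivative:
  assumes "smooth_on S f"
  shows "smooth_on S (\<lambda>x. frechet_derivative f (at x) v)"
  using assms unfolding smooth_on_def by (intro allI Ck_on_Suc_frechet) (erule spec)

lemma frechet_derivative_linear: "f differentiable (at x) \<Longrightarrow> linear (frechet_derivative f (at x))"
  unfolding frechet_derivative_works by (rule has_derivative_linear)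

lemma smooth_on_directional_derivative:
  fixes f :: "'a::{real_inner,heine_borel} \<Rightarrow> 'b::real_normed_vector"
  assumes "open S" "smooth_on S f" "smooth_on S w"
  shows "smooth_on S (\<lambda>x. frechet_derivative f (at x) (w x))"
proof (rule smooth_on_linear_expand[OF assms(1) _ _ assms(3)])
  show "linear (frechet_derivative f (at x))" if "x \<in> S" for x
    using that assms(2) by (intro frechet_derivative_linear smooth_on_imp_differentiable)
  show "smooth_on S (\<lambda>x. frechet_derivative f (at x) b)" for b
    using assms(2) by (rule smooth_on_frechet_derivative)
qed

section \<open>Linear equations with smooth invertible coefficients\<close>

lemma has_derivative_zero_mult:
  fixes u :: "'a::real_normed_vector \<Rightarrow> real" and q :: "'a \<Rightarrow> 'b::real_normed_vector"
  assumes u: "isCont u x" "u x = 0" and q: "(q has_derivative q') (at x)" "q x = 0"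
  shows "((\<lambda>y. u y *\<^sub>R q y) has_derivative (\<lambda>h. 0)) (at x)"
  unfolding has_derivative_at_alt
proof (intro conjI allI impI)
  show "bounded_linear (\<lambda>h::'a. 0 :: 'b)" by simp
  fix e :: real assume e: "e > 0"
  have bl: "bounded_linear q'" using q(1) by (rule has_derivative_bounded_linear)
  then obtain K where K: "K > 0" "\<And>h. norm (q' h) \<le> norm h * K"
    using bounded_linear.pos_bounded by blast
  obtain d1 where d1: "d1 > 0" "\<And>y. norm (y - x) < d1 \<Longrightarrow> norm (q y - q x - q' (y - x)) \<le> 1 * norm (y - x)"
    using q(1) unfolding has_derivative_at_alt by (metis zero_less_one)
  \<comment> \<open>Near \<open>x\<close> the norm of \<open>q y\<close> is at most K + 1 times the
    distance to \<open>x\<close>: K bounds the derivative and 1 the relative error of linearization.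
    The factor \<open>u y\<close> has to supply the rest.\<close>
  have "e / (K + 1) > 0" using e K by simp
  then obtain d2 where d2: "d2 > 0" "\<And>y. dist y x < d2 \<Longrightarrow> dist (u y) (u x) < e / (K + 1)"
    using u(1) unfolding continuous_at_eps_delta by meson
  show "\<exists>d>0. \<forall>y. norm (y - x) < d \<longrightarrow> norm (u y *\<^sub>R q y - u x *\<^sub>R q x - 0) \<le> e * norm (y - x)"
  proof (intro exI[of _ "min d1 d2"] conjI allI impI)
    show "min d1 d2 > 0" using d1 d2 by simp
    fix y assume y: "norm (y - x) < min d1 d2"
    have "norm (q y - q' (y - x)) \<le> norm (y - x)" using d1(2)[of y] y q(2) by simp
    moreover have "norm (q y) \<le> norm (q y - q' (y - x)) + norm (q' (y - x))"
      by (metis add.commute diff_add_cancel norm_triangle_ineq)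
    ultimately have "norm (q y) \<le> norm (y - x) * (K + 1)"
      using K(2)[of "y - x"] by (simp add: algebra_simps)
    moreover have "\<bar>u y\<bar> \<le> e / (K + 1)"
      using d2(2)[of y] y u(2) by (simp add: dist_norm)
    ultimately have "\<bar>u y\<bar> * norm (q y) \<le> (e / (K + 1)) * (norm (y - x) * (K + 1))"
      using K(1) e by (intro mult_mono) auto
    then show "norm (u y *\<^sub>R q y - u x *\<^sub>R q x - 0) \<le> e * norm (y - x)"
      using u(2) K(1) by simp
  qed
qed

lemma linear_inv_bij:
  assumes "linear f" "bij f"
  shows "linear (inv_into UNIV f)"
proof (rule linearI)
  have f: "f (inv_into UNIV f x) = x" "inv_into UNIV f (f y) = y" for x y
    using assms(2) by (simp_all add: bij_is_surj surj_f_inv_f bij_is_inj)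
  show "inv_into UNIV f (x + y) = inv_into UNIV f x + inv_into UNIV f y" for x y
    using f linear_add[OF assms(1)] by metis
  show "inv_into UNIV f (c *\<^sub>R x) = c *\<^sub>R inv_into UNIV f x" for c x
    using f linear_cmul[OF assms(1)] by metis
qed

text \<open>Invertibility of \<open>A x\<close> gives a lower bound for its values, and the bound
  survives with half the constant at nearby points. Applied to \<open>w y - w x\<close>, whose image
  under \<open>A y\<close> is \<open>t y - A y (w x)\<close> and tends to 0, it forces
  \<open>w y\<close> to tend to \<open>w x\<close>.\<close>

lemma linear_solution_continuous:
  fixes A :: "'a::real_normed_vector \<Rightarrow> 'h::{real_inner,heine_borel} \<Rightarrow> 'v::{real_inner,heine_borel}"
  assumes S: "open S" and lin: "\<And>y. y \<in> S \<Longrightarrow> linear (A y)" and inj: "\<And>y. y \<in> S \<Longrightarrow> bij (A y)"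
    and cont: "\<And>e. continuous_on S (\<lambda>y. A y e)" and t: "continuous_on S t"
    and w: "\<And>y. y \<in> S \<Longrightarrow> A y (w y) = t y"
  shows "continuous_on S w"
proof (rule continuous_at_imp_continuous_on, rule ballI)
  fix x assume x: "x \<in> S"
  have "linear (inv_into UNIV (A x))"
    by (rule linear_inv_bij[OF lin[OF x] inj[OF x]])
  then have "bounded_linear (inv_into UNIV (A x))" by (rule linear_imp_bounded_linear)
  then obtain K where K: "K > 0" "\<And>z. norm (inv_into UNIV (A x) z) \<le> norm z * K"
    using bounded_linear.pos_bounded by blast
  have lower: "norm e \<le> norm (A x e) * K" for e
    using K(2)[of "A x e"] inj[OF x] by (simp add: bij_is_inj)
  \<comment> \<open>A continuous bound for the operator norm of \<open>A y - A x\<close> that uses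
    only the values on the basis. Once it is below 1 / (2 K), it absorbs half of the norm of
    \<open>e\<close>.\<close>
  define g where "g y = (\<Sum>b\<in>onb. norm b * norm (A y b - A x b))" for y
  have diff: "norm (A y e - A x e) \<le> norm e * g y" if "y \<in> S" for y e
  proof -
    have "A y e - A x e = (\<Sum>b\<in>onb. inner e b *\<^sub>R (A y b - A x b))"
      using linear_onb_expand[OF lin[OF that], of e] linear_onb_expand[OF lin[OF x], of e]
      by (simp add: sum_subtractf scaleR_diff_right)
    also have "norm \<dots> \<le> (\<Sum>b\<in>onb. \<bar>inner e b\<bar> * norm (A y b - A x b))"
      by (rule norm_sum[THEN order_trans]) simp
    also have "\<dots> \<le> (\<Sum>b\<in>onb. (norm e * norm b) * norm (A y b - A x b))"
      by (intro sum_mono mult_right_mono Cauchy_Schwarz_ineq2) auto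
    finally show ?thesis by (simp add: g_def sum_distrib_left mult.assoc)
  qed
  have "continuous_on S g" unfolding g_def
    by (intro continuous_intros cont)
  then have "isCont g x" using x S by (simp add: continuous_on_eq_continuous_at)
  moreover have "g x = 0" by (simp add: g_def)
  ultimately have "(g \<longlongrightarrow> 0) (at x)" by (simp add: isCont_def)
  then have "eventually (\<lambda>y. g y < 1 / (2 * K)) (at x)"
    using K(1) by (intro order_tendstoD) auto
  moreover have "eventually (\<lambda>y. y \<in> S) (at x)"
    using S x by (metis eventually_at_topological)
  ultimately have ev: "eventually (\<lambda>y. norm (w y - w x) \<le> 2 * K * norm (t y - A y (w x))) (at x)"
  proof eventually_elim
    case (elim y)
    define e where "e = w y - w x"
    have "norm e \<le> norm (A x e) * K" by (rule lower)
    also have "norm (A x e) \<le> norm (A y e) + norm e * g y"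
    proof -
      have "norm (A x e) \<le> norm (A y e) + norm (A y e - A x e)"
        by (metis add_diff_cancel_left' diff_diff_eq2 norm_triangle_ineq4 add.commute norm_minus_commute norm_triangle_sub)
      then show ?thesis using diff[OF elim(2), of e] by linarith
    qed
    also have "norm e * g y \<le> norm e * (1 / (2 * K))"
      using elim(1) by (intro mult_left_mono) auto
    finally have "norm e \<le> (norm (A y e) + norm e * (1 / (2 * K))) * K"
      using K(1) by (simp add: mult_right_mono)
    then have "norm e \<le> 2 * K * norm (A y e)" using K(1) by (simp add: field_simps)
    moreover have "A y e = t y - A y (w x)"
      using lin[OF elim(2)] w[OF elim(2)] by (simp add: e_def linear_diff)
    ultimately show ?case by (simp add: e_def)
  qed
  have "isCont (\<lambda>y. 2 * K * norm (t y - A y (w x))) x"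
    using continuous_on_interior[of S _ x] S x cont t
    by (intro continuous_intros) (auto simp: continuous_on_eq_continuous_at interior_open)
  then have "((\<lambda>y. 2 * K * norm (t y - A y (w x))) \<longlongrightarrow> 0) (at x)"
    using w[OF x] by (simp add: isCont_def)
  then have "((\<lambda>y. w y - w x) \<longlongrightarrow> 0) (at x)"
    by (rule Lim_null_comparison[OF ev])
  then show "isCont w x" by (simp add: isCont_def LIM_zero_iff)
qed

text \<open>With \<open>M\<close> the inverse of \<open>A x\<close>, the equation reads w y = w x +
  M (t y - A y (w x)) - M ((A y - A x) (w y - w x)). In the last term a factor that is merely
  continuous meets a differentiable one, and both vanish at \<open>x\<close>; by
  \<open>has_derivative_zero_mult\<close> it has derivative 0. So differentiability of
  \<open>w\<close> need not be presupposed.\<close>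

lemma linear_solution_differentiable:
  fixes A :: "'a::real_normed_vector \<Rightarrow> 'h::{real_inner,heine_borel} \<Rightarrow> 'v::{real_inner,heine_borel}"
  assumes S: "open S" and lin: "\<And>y. y \<in> S \<Longrightarrow> linear (A y)" and inj: "\<And>y. y \<in> S \<Longrightarrow> bij (A y)"
    and dA: "\<And>e. (\<lambda>y. A y e) differentiable (at x)" and t: "t differentiable (at x)"
    and w: "\<And>y. y \<in> S \<Longrightarrow> A y (w y) = t y" and x: "x \<in> S" and contw: "isCont w x"
  shows "w differentiable (at x)"
proof -
  define M where "M = inv_into UNIV (A x)"
  have M: "linear M"
    unfolding M_def by (rule linear_inv_bij[OF lin[OF x] inj[OF x]])
  then have blM: "bounded_linear M" by (rule linear_imp_bounded_linear)
  have MA: "M (A x e) = e" for e unfolding M_def using inj[OF x] by (simp add: bij_is_inj)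
  define r where "r y = w x + M (t y - A y (w x)) - (\<Sum>b\<in>onb. inner (w y - w x) b *\<^sub>R M (A y b - A x b))" for y
  have eq: "r y = w y" if y: "y \<in> S" for y
  proof -
    have "(\<Sum>b\<in>onb. inner (w y - w x) b *\<^sub>R M (A y b - A x b))
       = M (\<Sum>b\<in>onb. inner (w y - w x) b *\<^sub>R A y b) - M (\<Sum>b\<in>onb. inner (w y - w x) b *\<^sub>R A x b)"
      using M by (simp add: linear_diff linear_sum linear_cmul sum_subtractf scaleR_diff_right)
    also have "\<dots> = M (A y (w y - w x)) - M (A x (w y - w x))"
      by (simp only: linear_onb_expand[OF lin[OF y], of "w y - w x", symmetric]
          linear_onb_expand[OF lin[OF x], of "w y - w x", symmetric])
    also have "\<dots> = M (t y - A y (w x)) - (w y - w x)"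
      using lin[OF y] w[OF y] MA by (simp add: linear_diff)
    finally show ?thesis by (simp add: r_def)
  qed
  have "(\<lambda>y. M (t y - A y (w x))) differentiable (at x)"
    using differentiable_diff[OF t dA[of "w x"]] bounded_linear.has_derivative[OF blM]
    unfolding differentiable_def by blast
  moreover have "(\<lambda>y. inner (w y - w x) b *\<^sub>R M (A y b - A x b)) differentiable (at x)" for b
  proof -
    obtain D where "((\<lambda>y. A y b - A x b) has_derivative D) (at x)"
      using differentiable_diff[OF dA[of b] differentiable_const[of "A x b"]]
      unfolding differentiable_def by blast
    then have "((\<lambda>y. M (A y b - A x b)) has_derivative (\<lambda>h. M (D h))) (at x)"
      by (rule bounded_linear.has_derivative[OF blM])
    moreover have "isCont (\<lambda>y. inner (w y - w x) b) x"
      by (intro continuous_intros contw)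
    ultimately have "((\<lambda>y. inner (w y - w x) b *\<^sub>R M (A y b - A x b)) has_derivative (\<lambda>h. 0)) (at x)"
      using linear_0[OF M] by (intro has_derivative_zero_mult) auto
    then show ?thesis unfolding differentiable_def by blast
  qed
  ultimately have "r differentiable (at x)"
    unfolding r_def by (intro differentiable_diff differentiable_add differentiable_const differentiable_sum finite_onb) auto
  then show ?thesis by (rule differentiable_cong_open[OF S x, rotated]) (rule eq)
qed

text \<open>Differentiating \<open>A w = t\<close> shows that the derivatives of \<open>w\<close> solve an equation of the same form.\<close>

lemma Ck_on_linear_solution:
  fixes A :: "'a::real_normed_vector \<Rightarrow> 'h::{real_inner,heine_borel} \<Rightarrow> 'v::{real_inner,heine_borel}"
  assumes S: "open S" and lin: "\<And>y. y \<in> S \<Longrightarrow> linear (A y)" and inj: "\<And>y. y \<in> S \<Longrightarrow> bij (A y)"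
    and A: "\<And>e. smooth_on S (\<lambda>y. A y e)"
    and t: "Ck_on k S t" and w: "\<And>y. y \<in> S \<Longrightarrow> A y (w y) = t y"
  shows "Ck_on k S w"
  using t w
proof (induction k arbitrary: t w)
  case 0
  then show ?case
    using linear_solution_continuous[OF S lin inj smooth_on_imp_continuous_on[OF A], of t w] by simp
next
  case (Suc k)
  have tk: "Ck_on k S t" using Suc.prems(1) by (rule Ck_on_SucD)
  \<comment> \<open>The induction hypothesis serves twice: here for \<open>w\<close> itself, whose
    values enter the new right-hand side \<open>T\<close>, and below for its derivatives.\<close>
  then have wk: "Ck_on k S w" using Suc.prems(2) by (rule Suc.IH)
  have contw: "isCont w y" if "y \<in> S" for y
    using Ck_on_imp_continuous_on[OF wk] that S by (simp add: continuous_on_eq_continuous_at)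
  have dA: "(\<lambda>y. A y e) differentiable (at y)" if "y \<in> S" for e y
    using smooth_on_imp_differentiable[OF A that] .
  have dt: "t differentiable (at y)" if "y \<in> S" for y
    using Suc.prems(1) that by (simp add: Ck_on.simps(2))
  have dw: "w differentiable (at y)" if y: "y \<in> S" for y
    using linear_solution_differentiable[OF S lin inj dA[OF y] dt[OF y] Suc.prems(2) y contw[OF y]] .
  have "Ck_on k S (\<lambda>y. frechet_derivative w (at y) v)" for v
  proof (rule Suc.IH)
    \<comment> \<open>The derivative of \<open>t\<close> minus the derivative of the coefficients
      applied to \<open>w\<close>, expanded in the basis because smoothness of \<open>A\<close> is
      given vector by vector.\<close>
    define T where "T y = frechet_derivative t (at y) v
      + (\<Sum>b\<in>onb. (- inner (w y) b) *\<^sub>R frechet_derivative (\<lambda>y. A y b) (at y) v)" for y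
    show "Ck_on k S T"
      unfolding T_def
    proof (intro Ck_on_add[OF S] Ck_on_sum[OF S] Ck_on_bilinear[OF S bounded_bilinear_scaleR])
      show "Ck_on k S (\<lambda>y. frechet_derivative t (at y) v)"
        using Suc.prems(1) by (rule Ck_on_Suc_frechet)
      show "Ck_on k S (\<lambda>y. frechet_derivative (\<lambda>y. A y b) (at y) v)" for b
        using smooth_on_frechet_derivative[OF A[of b], of v] by (simp add: smooth_on_def)
      show "Ck_on k S (\<lambda>y. - inner (w y) b)" for b
        by (rule Ck_on_bounded_linear[OF S _ wk, where L = "\<lambda>z. - inner z b"])
          (intro bounded_linear_minus bounded_linear_inner_left)
    qed
    fix y assume y: "y \<in> S"
    have "(t has_derivative (\<lambda>v. \<Sum>b\<in>onb. inner (w y) b *\<^sub>R frechet_derivative (\<lambda>y. A y b) (at y) v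
        + inner (frechet_derivative w (at y) v) b *\<^sub>R A y b)) (at y)"
    proof (rule has_derivative_transform_within_open[OF _ S y])
      show "((\<lambda>y. \<Sum>b\<in>onb. inner (w y) b *\<^sub>R A y b) has_derivative (\<lambda>v. \<Sum>b\<in>onb. inner (w y) b *\<^sub>R frechet_derivative (\<lambda>y. A y b) (at y) v
        + inner (frechet_derivative w (at y) v) b *\<^sub>R A y b)) (at y)"
        using dw[OF y] dA[OF y] unfolding frechet_derivative_works
        by (intro has_derivative_sum has_derivative_scaleR has_derivative_inner_left) auto
      show "(\<Sum>b\<in>onb. inner (w z) b *\<^sub>R A z b) = t z" if "z \<in> S" for z
        using linear_onb_expand[OF lin[OF that], of "w z"] Suc.prems(2)[OF that] by simp
    qed
    then have "frechet_derivative t (at y) v = (\<Sum>b\<in>onb. inner (w y) b *\<^sub>R frechet_derivative (\<lambda>y. A y b) (at y) v)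
        + (\<Sum>b\<in>onb. inner (frechet_derivative w (at y) v) b *\<^sub>R A y b)"
      by (simp add: frechet_derivative_eqI sum.distrib)
    then show "A y (frechet_derivative w (at y) v) = T y"
      using linear_onb_expand[OF lin[OF y], of "frechet_derivative w (at y) v"]
      by (simp add: T_def sum_negf)
  qed
  then show ?case using dw by (simp add: Ck_on.simps(2))
qed

lemma smooth_on_linear_solution:
  fixes A :: "'a::real_normed_vector \<Rightarrow> 'h::{real_inner,heine_borel} \<Rightarrow> 'v::{real_inner,heine_borel}"
  assumes "open S" "\<And>y. y \<in> S \<Longrightarrow> linear (A y)" "\<And>y. y \<in> S \<Longrightarrow> bij (A y)"
    "\<And>e. smooth_on S (\<lambda>y. A y e)"
    and t: "smooth_on S t" and w: "\<And>y. y \<in> S \<Longrightarrow> A y (w y) = t y"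
  shows "smooth_on S w"
  unfolding smooth_on_def
proof
  fix k
  have "Ck_on k S t" using t by (simp add: smooth_on_def)
  from assms(1-4) this w show "Ck_on k S w" by (rule Ck_on_linear_solution[where A = A and t = t])
qed

section \<open>Bump functions\<close>

text \<open>The powers of 1 / t make the family closed under differentiation up to linear
  combinations; \<open>flat_fun 0\<close> is the classical smooth function that is flat at
  0.\<close>

definition flat_fun :: "nat \<Rightarrow> real \<Rightarrow> real" where
  "flat_fun n t = (if t > 0 then (1 / t) ^ n * exp (- (1 / t)) else 0)"

lemma flat_fun_tendsto_0: "(flat_fun n \<longlongrightarrow> 0) (at 0)"
proof -
  have "((\<lambda>t::real. (1 / t) ^ n / exp (1 / t)) \<longlongrightarrow> 0) (at_right 0)"
    by (rule filterlim_compose[OF tendsto_power_div_exp_0])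
      (simp add: divide_inverse filterlim_inverse_at_top_right)
  then have "(flat_fun n \<longlongrightarrow> 0) (at_right 0)"
    by (rule Lim_transform_eventually)
      (auto simp: flat_fun_def eventually_at_filter exp_minus divide_inverse)
  moreover have "(flat_fun n \<longlongrightarrow> 0) (at_left 0)"
    by (rule Lim_transform_eventually[OF tendsto_const])
      (auto simp: flat_fun_def eventually_at_filter)
  ultimately show ?thesis by (simp add: filterlim_split_at)
qed

lemma flat_fun_DERIV:
  "(flat_fun n has_field_derivative (flat_fun (n + 2) t - real n * flat_fun (n + 1) t)) (at t)"
proof -
  consider "t > 0" | "t < 0" | "t = 0" by linarith
  then show ?thesis
  proof cases
    case 1
    have "((\<lambda>t. (1 / t) ^ n * exp (- (1 / t))) has_field_derivative
        (flat_fun (n + 2) t - real n * flat_fun (n + 1) t)) (at t)"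
    proof (rule DERIV_cong)
      have "((\<lambda>t. 1 / t) has_field_derivative - ((1 / t)\<^sup>2)) (at t)"
        using 1 by (auto intro!: derivative_eq_intros simp: power2_eq_square)
      then show "((\<lambda>t. (1 / t) ^ n * exp (- (1 / t))) has_field_derivative
          real n * (- ((1 / t)\<^sup>2) * (1 / t) ^ (n - Suc 0)) * exp (- (1 / t)) +
          exp (- (1 / t)) * - (- ((1 / t)\<^sup>2)) * (1 / t) ^ n) (at t)"
        by (intro DERIV_mult DERIV_power DERIV_fun_exp DERIV_minus)
      define x where "x = 1 / t"
      show "real n * (- ((1 / t)\<^sup>2) * (1 / t) ^ (n - Suc 0)) * exp (- (1 / t)) +
          exp (- (1 / t)) * - (- ((1 / t)\<^sup>2)) * (1 / t) ^ n
          = flat_fun (n + 2) t - real n * flat_fun (n + 1) t"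
        using 1 unfolding flat_fun_def x_def[symmetric]
        by (cases n) (simp_all add: algebra_simps power2_eq_square)
    qed
    then show ?thesis
      by (rule has_field_derivative_transform_within_open[of _ _ _ "{0<..}"])
        (use 1 in \<open>auto simp: flat_fun_def\<close>)
  next
    case 2
    have "((\<lambda>t. 0) has_field_derivative 0) (at t)" by simp
    then have "(flat_fun n has_field_derivative 0) (at t)"
      by (rule has_field_derivative_transform_within_open[of _ _ _ "{..<0}"])
        (use 2 in \<open>auto simp: flat_fun_def\<close>)
    then show ?thesis using 2 by (simp add: flat_fun_def)
  next
    case 3
    \<comment> \<open>The difference quotient of \<open>flat_fun n\<close> at 0 is
      \<open>flat_fun (n + 1)\<close>.\<close>
    have "((\<lambda>h. (flat_fun n (0 + h) - flat_fun n 0) / h) \<longlongrightarrow> 0) (at 0)"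
      by (rule Lim_transform_eventually[OF flat_fun_tendsto_0[of "n + 1"]])
        (auto simp: flat_fun_def eventually_at_filter field_simps)
    then show ?thesis using 3 by (simp add: DERIV_def flat_fun_def)
  qed
qed

lemma smooth_on_flat_fun: "smooth_on UNIV (flat_fun n)"
proof -
  have "Ck_on k UNIV (flat_fun n)" for k
  proof (induction k arbitrary: n)
    case 0
    have "isCont (flat_fun n) t" for t using flat_fun_DERIV by (rule DERIV_isCont)
    then show ?case by (simp add: continuous_at_imp_continuous_on)
  next
    case (Suc k)
    show ?case
    proof (rule Ck_on_SucI)
      show "(flat_fun n has_derivative (\<lambda>v. (flat_fun (n + 2) t + (- real n) * flat_fun (n + 1) t) * v)) (at t)" for t
        using flat_fun_DERIV[of n t] by (simp add: has_field_derivative_def)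
      show "Ck_on k UNIV (\<lambda>t. (flat_fun (n + 2) t + (- real n) * flat_fun (n + 1) t) * v)" for v
        by (intro Ck_on_bilinear[OF open_UNIV bounded_bilinear_mult] Ck_on_add Suc.IH Ck_on_const open_UNIV)
    qed simp
  qed
  then show ?thesis by (simp add: smooth_on_def)
qed

lemma smooth_on_inverse: "smooth_on {0<..} (inverse :: real \<Rightarrow> real)"
proof -
  have "Ck_on k {0<..} (inverse :: real \<Rightarrow> real)" for k
  proof (induction k)
    case 0
    show ?case by (auto intro!: continuous_intros)
  next
    case (Suc k)
    show ?case
    proof (rule Ck_on_SucI)
      show "(inverse has_derivative (\<lambda>v. (inverse t * inverse t) * (- v))) (at t)" if "t \<in> {0<..}" for t :: real
        using that by (auto intro!: derivative_eq_intros)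
      show "Ck_on k {0<..} (\<lambda>t::real. (inverse t * inverse t) * (- v))" for v
        by (intro Ck_on_bilinear[OF open_greaterThan bounded_bilinear_mult] Suc.IH Ck_on_const)
    qed simp
  qed
  then show ?thesis by (simp add: smooth_on_def)
qed

text \<open>For a < b the value is 1 for s \<le> a and 0 for s \<ge> b. The denominator is then
  positive, since its two summands cannot vanish together.\<close>

definition step_fun :: "real \<Rightarrow> real \<Rightarrow> real \<Rightarrow> real" where
  "step_fun a b s = flat_fun 0 (b - s) * inverse (flat_fun 0 (b - s) + flat_fun 0 (s - a))"

lemma smooth_on_step_fun:
  assumes "a < b" shows "smooth_on UNIV (step_fun a b)"
  unfolding step_fun_def
proof (rule smooth_on_bilinear[OF open_UNIV bounded_bilinear_mult])
  have aff: "smooth_on UNIV (\<lambda>s. flat_fun 0 (c * s + d))" for c d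
    by (rule smooth_on_compose[OF open_UNIV open_UNIV _ smooth_on_add[OF open_UNIV
            smooth_on_bounded_linear[OF open_UNIV bounded_linear_mult_right smooth_on_ident] smooth_on_const]
          smooth_on_flat_fun]) simp
  show f1: "smooth_on UNIV (\<lambda>s. flat_fun 0 (b - s))" using aff[of "-1" b] by simp
  have "smooth_on UNIV (\<lambda>s. flat_fun 0 (b - s) + flat_fun 0 (s - a))"
    using aff[of 1 "- a"] by (intro smooth_on_add[OF open_UNIV f1]) simp
  moreover have "(\<lambda>s. flat_fun 0 (b - s) + flat_fun 0 (s - a)) ` UNIV \<subseteq> {0<..}"
    using assms by (auto simp: flat_fun_def add_pos_pos)
  ultimately show "smooth_on UNIV (\<lambda>s. inverse (flat_fun 0 (b - s) + flat_fun 0 (s - a)))"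
    by (intro smooth_on_compose[OF open_UNIV open_greaterThan _ _ smooth_on_inverse])
qed

text \<open>The step function is composed with the squared distance, which unlike the distance is
  smooth at \<open>y0\<close>; hence the thresholds r^2 and R^2.\<close>

lemma bump_function:
  fixes y0 :: "'e::{real_inner,heine_borel}"
  assumes "0 < r" "r < R"
  obtains \<psi> :: "'e \<Rightarrow> real" where "smooth_on UNIV \<psi>" "\<And>y. dist y0 y \<le> r \<Longrightarrow> \<psi> y = 1"
    "\<And>y. R \<le> dist y0 y \<Longrightarrow> \<psi> y = 0"
proof
  let ?\<psi> = "\<lambda>y. step_fun (r\<^sup>2) (R\<^sup>2) (inner (y + - y0) (y + - y0))"
  have less: "r\<^sup>2 < R\<^sup>2" using assms by (simp add: power_strict_mono)
  have d: "inner (y + - y0) (y + - y0) = (dist y0 y)\<^sup>2" for y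
    by (simp add: dist_norm power2_norm_eq_inner inner_diff_left inner_diff_right inner_commute)
  have sm: "smooth_on UNIV (\<lambda>y. y + - y0)"
    by (intro smooth_on_add smooth_on_ident smooth_on_const open_UNIV)
  show "smooth_on UNIV ?\<psi>"
    by (rule smooth_on_compose[OF open_UNIV open_UNIV _
          smooth_on_bilinear[OF open_UNIV bounded_bilinear_inner sm sm] smooth_on_step_fun[OF less]]) simp
  show "?\<psi> y = 1" if "dist y0 y \<le> r" for y
  proof -
    have "(dist y0 y)\<^sup>2 \<le> r\<^sup>2" using that by (simp add: power_mono)
    then show ?thesis using less unfolding d step_fun_def by (simp add: flat_fun_def)
  qed
  show "?\<psi> y = 0" if "R \<le> dist y0 y" for y
  proof -
    have "R\<^sup>2 \<le> (dist y0 y)\<^sup>2" using that assms by (intro power_mono) auto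
    then show ?thesis unfolding d step_fun_def by (simp add: flat_fun_def)
  qed
qed

section \<open>Smooth maps between manifolds\<close>

lemma charts_atD: "c \<in> charts_at A x \<Longrightarrow> c \<in> A \<and> x \<in> fst c"
  and charts_atI: "c \<in> A \<Longrightarrow> x \<in> fst c \<Longrightarrow> c \<in> charts_at A x"
  by (auto simp: charts_at_def)

lemma smooth_atlasD:
  assumes "smooth_atlas A" "c \<in> A"
  shows "open (fst c)" "open (snd c ` fst c)" "inj_on (snd c) (fst c)" "continuous_on (fst c) (snd c)"
    "continuous_on (snd c ` fst c) (cinv c)"
  using assms unfolding smooth_atlas_def by auto

lemma smooth_atlas_transition:
  "smooth_atlas A \<Longrightarrow> c \<in> A \<Longrightarrow> d \<in> A \<Longrightarrow> smooth_on (snd c ` (fst c \<inter> fst d)) (snd d \<circ> cinv c)"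
  unfolding smooth_atlas_def by blast

lemma charts_at_nonempty: "smooth_atlas A \<Longrightarrow> \<exists>c. c \<in> charts_at A x"
  unfolding smooth_atlas_def charts_at_def by blast

lemma cinv_chart: "inj_on (snd c) (fst c) \<Longrightarrow> x \<in> fst c \<Longrightarrow> cinv c (snd c x) = x"
  by (simp add: cinv_def)

lemma cinv_atlas: "smooth_atlas A \<Longrightarrow> c \<in> A \<Longrightarrow> x \<in> fst c \<Longrightarrow> cinv c (snd c x) = x"
  by (simp add: cinv_chart smooth_atlasD(3))

lemma open_chart_image:
  assumes "smooth_atlas A" "c \<in> A" "open W"
  shows "open (snd c ` (fst c \<inter> W))"
proof -
  have "snd c ` (fst c \<inter> W) = snd c ` fst c \<inter> cinv c -` W"
    using cinv_atlas[OF assms(1,2)] by auto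
  then show ?thesis
    using continuous_open_preimage[OF smooth_atlasD(5,2)[OF assms(1,2)] assms(3)] by simp
qed

lemma charts_at_vs: "charts_at vs_atlas x = {(UNIV, \<lambda>x. x)}"
  by (auto simp: charts_at_def vs_atlas_def)

lemma cinv_vs: "cinv (UNIV, \<lambda>x. x) = (\<lambda>x. x)"
  by (rule ext) (simp add: cinv_def inv_into_f_f[of "\<lambda>x. x", unfolded inj_on_def])

lemma smooth_atlas_vs: "smooth_atlas vs_atlas"
  by (auto simp: smooth_atlas_def vs_atlas_def cinv_vs o_def smooth_on_ident)

lemma cinv_prod:
  assumes "inj_on (snd c) (fst c)" "inj_on (snd d) (fst d)" "y \<in> snd c ` fst c" "z \<in> snd d ` fst d"
  shows "cinv (fst c \<times> fst d, map_prod (snd c) (snd d)) (y, z) = (cinv c y, cinv d z)"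
proof -
  obtain a b where ab: "a \<in> fst c" "y = snd c a" "b \<in> fst d" "z = snd d b" using assms by auto
  have "cinv (fst c \<times> fst d, map_prod (snd c) (snd d)) (snd (fst c \<times> fst d, map_prod (snd c) (snd d)) (a, b)) = (a, b)"
    by (rule cinv_chart) (use assms ab in \<open>auto intro: map_prod_inj_on\<close>)
  then show ?thesis using ab assms by (simp add: cinv_chart)
qed

lemma smooth_on_map_prod:
  fixes f :: "'a::{real_inner,heine_borel} \<Rightarrow> 'c::real_normed_vector"
    and g :: "'b::{real_inner,heine_borel} \<Rightarrow> 'd::real_normed_vector"
  assumes "open S" "open T" "smooth_on S f" "smooth_on T g"
  shows "smooth_on (S \<times> T) (\<lambda>p. (f (fst p), g (snd p)))"
proof (rule smooth_on_Pair)
  show op: "open (S \<times> T)" using assms by (simp add: open_Times)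
  show "smooth_on (S \<times> T) (\<lambda>p. f (fst p))"
    by (rule smooth_on_compose[OF op assms(1) _ smooth_on_bounded_linear[OF op bounded_linear_fst smooth_on_ident] assms(3)]) auto
  show "smooth_on (S \<times> T) (\<lambda>p. g (snd p))"
    by (rule smooth_on_compose[OF op assms(2) _ smooth_on_bounded_linear[OF op bounded_linear_snd smooth_on_ident] assms(4)]) auto
qed

lemma prod_atlasI:
  "c \<in> A \<Longrightarrow> d \<in> B \<Longrightarrow> (fst c \<times> fst d, map_prod (snd c) (snd d)) \<in> prod_atlas A B"
  unfolding prod_atlas_def by blast

lemma smooth_atlas_prod:
  fixes A :: "('m::t2_space, 'e::{real_inner,heine_borel}) chart set"
    and B :: "('n::t2_space, 'f::{real_inner,heine_borel}) chart set"
  assumes A: "smooth_atlas A" and B: "smooth_atlas B"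
  shows "smooth_atlas (prod_atlas A B)"
  unfolding smooth_atlas_def
proof (intro conjI ballI)
  show "(\<Union>c\<in>prod_atlas A B. fst c) = UNIV"
  proof -
    have "\<exists>c\<in>prod_atlas A B. (x, y) \<in> fst c" for x y
    proof -
      obtain c d where "c \<in> charts_at A x" "d \<in> charts_at B y"
        using charts_at_nonempty[OF A, of x] charts_at_nonempty[OF B, of y] by blast
      then show ?thesis
        by (intro bexI[OF _ prod_atlasI[of c A d B]]) (auto dest: charts_atD)
    qed
    then show ?thesis by auto
  qed
next
  fix p assume "p \<in> prod_atlas A B"
  then obtain c d where c: "c \<in> A" and d: "d \<in> B"
    and p: "p = (fst c \<times> fst d, map_prod (snd c) (snd d))"
    by (auto simp: prod_atlas_def)
  have im: "snd p ` fst p = (snd c ` fst c) \<times> (snd d ` fst d)"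
    by (auto simp: p map_prod_def)
  note cc = smooth_atlasD[OF A c] and dd = smooth_atlasD[OF B d]
  show "open (fst p)" using cc dd by (simp add: p open_Times)
  show "open (snd p ` fst p)" unfolding im using cc dd by (simp add: open_Times)
  show "inj_on (snd p) (fst p)" using cc dd by (simp add: p map_prod_inj_on)
  show "continuous_on (fst p) (snd p)"
    unfolding p fst_conv snd_conv map_prod_def case_prod_beta
    by (intro continuous_on_Pair continuous_on_compose2[OF cc(4)] continuous_on_compose2[OF dd(4)]
        continuous_on_fst continuous_on_snd continuous_on_id) auto
  have "continuous_on (snd p ` fst p) (\<lambda>z. (cinv c (fst z), cinv d (snd z)))"
    unfolding im
    by (intro continuous_on_Pair continuous_on_compose2[OF cc(5)] continuous_on_compose2[OF dd(5)]
        continuous_on_fst continuous_on_snd continuous_on_id) auto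
  then show "continuous_on (snd p ` fst p) (cinv p)"
    by (rule continuous_on_eq) (use cinv_prod[OF cc(3) dd(3)] im in \<open>auto simp: p\<close>)
  fix q assume "q \<in> prod_atlas A B"
  then obtain c' d' where c': "c' \<in> A" and d': "d' \<in> B"
    and q: "q = (fst c' \<times> fst d', map_prod (snd c') (snd d'))"
    by (auto simp: prod_atlas_def)
  note cc' = smooth_atlasD[OF A c'] and dd' = smooth_atlasD[OF B d']
  have im': "snd p ` (fst p \<inter> fst q) = (snd c ` (fst c \<inter> fst c')) \<times> (snd d ` (fst d \<inter> fst d'))"
    unfolding p q fst_conv snd_conv Times_Int_Times map_prod_def by (rule image_paired_Times)
  have o1: "open (snd c ` (fst c \<inter> fst c'))" and o2: "open (snd d ` (fst d \<inter> fst d'))"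
    by (intro open_chart_image[OF A c cc'(1)] open_chart_image[OF B d dd'(1)])+
  have "smooth_on (snd p ` (fst p \<inter> fst q)) (\<lambda>z. ((snd c' \<circ> cinv c) (fst z), (snd d' \<circ> cinv d) (snd z)))"
    unfolding im' by (rule smooth_on_map_prod[OF o1 o2 smooth_atlas_transition[OF A c c'] smooth_atlas_transition[OF B d d']])
  then show "smooth_on (snd p ` (fst p \<inter> fst q)) (snd q \<circ> cinv p)"
    by (rule smooth_on_cong[rotated 2])
      (use o1 o2 im' cinv_prod[OF cc(3) dd(3)] in \<open>auto simp: open_Times p q\<close>)
qed

section \<open>Smooth maps on open sets\<close>

lemma smooth_map_open_continuous: "smooth_map_open A V B f \<Longrightarrow> continuous_on V f"
  by (simp add: smooth_map_open_def)

lemma smooth_map_openD: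
  "smooth_map_open A V B f \<Longrightarrow> c \<in> A \<Longrightarrow> d \<in> B \<Longrightarrow>
    smooth_on (snd c ` (fst c \<inter> V \<inter> f -` fst d)) (snd d \<circ> f \<circ> cinv c)"
  by (simp add: smooth_map_open_def)

lemma open_chart_preimage:
  assumes "smooth_atlas A" "c \<in> A" "open V" "continuous_on V f" "open W"
  shows "open (snd c ` (fst c \<inter> V \<inter> f -` W))"
  using open_chart_image[OF assms(1,2) continuous_open_preimage[OF assms(4,3,5)]] by (simp add: Int_assoc)

lemma smooth_map_open_subset:
  assumes "smooth_map_open A V B f" "W \<subseteq> V"
  shows "smooth_map_open A W B f"
  unfolding smooth_map_open_def
proof (intro conjI ballI)
  show "continuous_on W f" using assms by (meson continuous_on_subset smooth_map_open_continuous)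
  show "smooth_on (snd c ` (fst c \<inter> W \<inter> f -` fst d)) (snd d \<circ> f \<circ> cinv c)" if "c \<in> A" "d \<in> B" for c d
    using smooth_map_openD[OF assms(1) that] by (rule smooth_on_subset) (use assms(2) in auto)
qed

lemma smooth_map_open_cong:
  assumes A: "smooth_atlas A" and B: "smooth_atlas B" and V: "open V"
    and eq: "\<And>x. x \<in> V \<Longrightarrow> f x = g x" and f: "smooth_map_open A V B f"
  shows "smooth_map_open A V B g"
  unfolding smooth_map_open_def
proof (intro conjI ballI)
  show "continuous_on V g"
    using smooth_map_open_continuous[OF f] by (rule continuous_on_eq) (simp add: eq)
  fix c d assume c: "c \<in> A" and d: "d \<in> B"
  have "snd c ` (fst c \<inter> V \<inter> f -` fst d) = snd c ` (fst c \<inter> V \<inter> g -` fst d)"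
    using eq by (intro arg_cong[where f = "\<lambda>X. snd c ` X"]) auto
  moreover have "smooth_on (snd c ` (fst c \<inter> V \<inter> f -` fst d)) (snd d \<circ> g \<circ> cinv c)"
  proof (rule smooth_on_cong[OF _ _ smooth_map_openD[OF f c d]])
    show "open (snd c ` (fst c \<inter> V \<inter> f -` fst d))"
      by (rule open_chart_preimage[OF A c V smooth_map_open_continuous[OF f] smooth_atlasD(1)[OF B d]])
  qed (use eq cinv_atlas[OF A c] in auto)
  ultimately show "smooth_on (snd c ` (fst c \<inter> V \<inter> g -` fst d)) (snd d \<circ> g \<circ> cinv c)" by simp
qed

lemma smooth_map_open_local:
  fixes A :: "('m::t2_space, 'e::real_normed_vector) chart set"
  assumes A: "smooth_atlas A" and B: "smooth_atlas B" and V: "open V"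
    and loc: "\<And>x. x \<in> V \<Longrightarrow> \<exists>W. open W \<and> x \<in> W \<and> smooth_map_open A W B f"
  shows "smooth_map_open A V B f"
  unfolding smooth_map_open_def
proof (intro conjI ballI)
  have "isCont f x" if "x \<in> V" for x
    using loc[OF that] smooth_map_open_continuous[of A _ B f] continuous_on_eq_continuous_at[of _ f] by blast
  then show "continuous_on V f" by (simp add: continuous_at_imp_continuous_on)
  fix c d assume c: "c \<in> A" and d: "d \<in> B"
  show "smooth_on (snd c ` (fst c \<inter> V \<inter> f -` fst d)) (snd d \<circ> f \<circ> cinv c)"
  proof (rule smooth_on_local)
    fix y assume "y \<in> snd c ` (fst c \<inter> V \<inter> f -` fst d)"
    then obtain x where x: "x \<in> fst c" "x \<in> V" "f x \<in> fst d" "y = snd c x" by auto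
    obtain W where W: "open W" "x \<in> W" "smooth_map_open A W B f" using loc[OF x(2)] by blast
    show "\<exists>W. open W \<and> y \<in> W \<and> smooth_on W (snd d \<circ> f \<circ> cinv c)"
      using open_chart_preimage[OF A c W(1) smooth_map_open_continuous[OF W(3)] smooth_atlasD(1)[OF B d]]
        smooth_map_openD[OF W(3) c d] x W(2) by blast
  qed
qed

lemma smooth_map_open_compose:
  fixes A :: "('m::t2_space, 'e::real_normed_vector) chart set"
    and B :: "('n::t2_space, 'f::{real_inner,heine_borel}) chart set"
  assumes A: "smooth_atlas A" and B: "smooth_atlas B" and D: "smooth_atlas D"
    and V: "open V" and W: "open W" and sub: "f ` V \<subseteq> W"
    and f: "smooth_map_open A V B f" and g: "smooth_map_open B W D g"
  shows "smooth_map_open A V D (\<lambda>x. g (f x))"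
  unfolding smooth_map_open_def
proof (intro conjI ballI)
  show cont: "continuous_on V (\<lambda>x. g (f x))"
    using smooth_map_open_continuous[OF g] smooth_map_open_continuous[OF f] sub
    by (rule continuous_on_compose2)
  fix c d assume c: "c \<in> A" and d: "d \<in> D"
  show "smooth_on (snd c ` (fst c \<inter> V \<inter> (\<lambda>x. g (f x)) -` fst d)) (snd d \<circ> (\<lambda>x. g (f x)) \<circ> cinv c)"
  proof (rule smooth_on_local)
    fix y assume "y \<in> snd c ` (fst c \<inter> V \<inter> (\<lambda>x. g (f x)) -` fst d)"
    then obtain x where x: "x \<in> fst c" "x \<in> V" "g (f x) \<in> fst d" "y = snd c x" by auto
    obtain b where "b \<in> charts_at B (f x)" using charts_at_nonempty[OF B] by blast
    then have b: "b \<in> B" "f x \<in> fst b" by (auto dest: charts_atD)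
    \<comment> \<open>Shrinking the domain ensures that \<open>f\<close>, read in the charts
      \<open>c\<close> and \<open>b\<close>, takes its values in \<open>T\<close>, where
      \<open>g\<close> is read in the charts \<open>b\<close> and \<open>d\<close>.\<close>
    define V' where "V' = V \<inter> (\<lambda>x. g (f x)) -` fst d"
    have V': "open V'" unfolding V'_def
      by (rule continuous_open_preimage[OF cont V smooth_atlasD(1)[OF D d]])
    define S where "S = snd c ` (fst c \<inter> V' \<inter> f -` fst b)"
    define T where "T = snd b ` (fst b \<inter> W \<inter> g -` fst d)"
    have f': "smooth_map_open A V' B f" by (rule smooth_map_open_subset[OF f]) (simp add: V'_def)
    have S: "open S" unfolding S_def
      by (rule open_chart_preimage[OF A c V' smooth_map_open_continuous[OF f'] smooth_atlasD(1)[OF B b(1)]])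
    have T: "open T" unfolding T_def
      by (rule open_chart_preimage[OF B b(1) W smooth_map_open_continuous[OF g] smooth_atlasD(1)[OF D d]])
    have "smooth_on S (\<lambda>y. (snd d \<circ> g \<circ> cinv b) ((snd b \<circ> f \<circ> cinv c) y))"
    proof (rule smooth_on_compose[OF S T])
      show "(snd b \<circ> f \<circ> cinv c) ` S \<subseteq> T"
        using sub cinv_atlas[OF A c] by (fastforce simp: S_def T_def V'_def)
      show "smooth_on S (snd b \<circ> f \<circ> cinv c)" unfolding S_def by (rule smooth_map_openD[OF f' c b(1)])
      show "smooth_on T (snd d \<circ> g \<circ> cinv b)" unfolding T_def by (rule smooth_map_openD[OF g b(1) d])
    qed
    then have "smooth_on S (snd d \<circ> (\<lambda>x. g (f x)) \<circ> cinv c)"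
      by (rule smooth_on_cong[OF S, rotated])
        (use cinv_atlas[OF A c] cinv_atlas[OF B b(1)] in \<open>auto simp: S_def\<close>)
    moreover have "y \<in> S" using x b by (auto simp: S_def V'_def)
    ultimately show "\<exists>W. open W \<and> y \<in> W \<and> smooth_on W (snd d \<circ> (\<lambda>x. g (f x)) \<circ> cinv c)"
      using S by blast
  qed
qed

lemma smooth_map_open_Pair:
  fixes A :: "('m::t2_space, 'e::real_normed_vector) chart set"
    and B :: "('n::t2_space, 'f::{real_inner,heine_borel}) chart set"
    and D :: "('k::t2_space, 'd::{real_inner,heine_borel}) chart set"
  assumes A: "smooth_atlas A" and B: "smooth_atlas B" and D: "smooth_atlas D" and V: "open V"
    and f: "smooth_map_open A V B f" and g: "smooth_map_open A V D g"
  shows "smooth_map_open A V (prod_atlas B D) (\<lambda>x. (f x, g x))"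
  unfolding smooth_map_open_def
proof (intro conjI ballI)
  show cont: "continuous_on V (\<lambda>x. (f x, g x))"
    using f g by (intro continuous_on_Pair smooth_map_open_continuous)
  fix c p assume c: "c \<in> A" and p': "p \<in> prod_atlas B D"
  then obtain b d where b: "b \<in> B" and d: "d \<in> D"
    and p: "p = (fst b \<times> fst d, map_prod (snd b) (snd d))"
    by (auto simp: prod_atlas_def)
  define S where "S = snd c ` (fst c \<inter> V \<inter> (\<lambda>x. (f x, g x)) -` fst p)"
  have S: "open S" unfolding S_def
    by (rule open_chart_preimage[OF A c V cont smooth_atlasD(1)[OF smooth_atlas_prod[OF B D] p']])
  have "smooth_on S (\<lambda>y. ((snd b \<circ> f \<circ> cinv c) y, (snd d \<circ> g \<circ> cinv c) y))"
  proof (rule smooth_on_Pair[OF S])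
    show "smooth_on S (snd b \<circ> f \<circ> cinv c)"
      by (rule smooth_on_subset[OF smooth_map_openD[OF f c b]]) (auto simp: S_def p)
    show "smooth_on S (snd d \<circ> g \<circ> cinv c)"
      by (rule smooth_on_subset[OF smooth_map_openD[OF g c d]]) (auto simp: S_def p)
  qed
  then show "smooth_on S (snd p \<circ> (\<lambda>x. (f x, g x)) \<circ> cinv c)"
    by (rule smooth_on_cong[OF S, rotated]) (simp add: p)
qed

lemma smooth_map_open_const: "smooth_map_open A V B (\<lambda>x. k)"
  unfolding smooth_map_open_def by (simp add: o_def smooth_on_const)

lemma smooth_map_open_ident:
  assumes "smooth_atlas A"
  shows "smooth_map_open A V A (\<lambda>x. x)"
  unfolding smooth_map_open_def
proof (intro conjI ballI)
  fix c d assume "c \<in> A" "d \<in> A"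
  then show "smooth_on (snd c ` (fst c \<inter> V \<inter> (\<lambda>x. x) -` fst d)) (snd d \<circ> (\<lambda>x. x) \<circ> cinv c)"
    using smooth_on_subset[OF smooth_atlas_transition[OF assms, of c d], of "snd c ` (fst c \<inter> V \<inter> fst d)"]
    by (auto simp: o_def)
qed simp

text \<open>The target has one global chart, so smoothness in charts of the source already implies
  the continuity clause.\<close>

lemma smooth_map_open_vs_iff:
  fixes A :: "('m::t2_space, 'e::real_normed_vector) chart set"
  assumes A: "smooth_atlas A" and V: "open V"
  shows "smooth_map_open A V vs_atlas f \<longleftrightarrow> (\<forall>c\<in>A. smooth_on (snd c ` (fst c \<inter> V)) (f \<circ> cinv c))"
proof
  assume "smooth_map_open A V vs_atlas f"
  then show "\<forall>c\<in>A. smooth_on (snd c ` (fst c \<inter> V)) (f \<circ> cinv c)"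
    by (auto simp: smooth_map_open_def vs_atlas_def o_def)
next
  assume R: "\<forall>c\<in>A. smooth_on (snd c ` (fst c \<inter> V)) (f \<circ> cinv c)"
  have "isCont f x" if "x \<in> V" for x
  proof -
    obtain c where "c \<in> charts_at A x" using charts_at_nonempty[OF A] by blast
    then have c: "c \<in> A" "x \<in> fst c" by (auto dest: charts_atD)
    have "continuous_on (snd c ` (fst c \<inter> V)) (f \<circ> cinv c)"
      using R c by (intro smooth_on_imp_continuous_on) auto
    moreover have "continuous_on (fst c \<inter> V) (snd c)"
      using smooth_atlasD(4)[OF A c(1)] by (rule continuous_on_subset) auto
    ultimately have "continuous_on (fst c \<inter> V) (\<lambda>x. (f \<circ> cinv c) (snd c x))"
      by (rule continuous_on_compose2) auto
    then have "continuous_on (fst c \<inter> V) f"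
      by (rule continuous_on_eq) (simp add: cinv_atlas[OF A c(1)])
    then show ?thesis
      using that c V smooth_atlasD(1)[OF A c(1)] by (simp add: continuous_on_eq_continuous_at open_Int)
  qed
  then have "continuous_on V f" by (simp add: continuous_at_imp_continuous_on)
  then show "smooth_map_open A V vs_atlas f"
    using R by (auto simp: smooth_map_open_def vs_atlas_def o_def)
qed

lemma smooth_map_open_add:
  fixes A :: "('m::t2_space, 'e::real_normed_vector) chart set"
  assumes A: "smooth_atlas A" and V: "open V"
    and "smooth_map_open A V vs_atlas f" "smooth_map_open A V vs_atlas g"
  shows "smooth_map_open A V vs_atlas (\<lambda>x. f x + g x)"
  unfolding smooth_map_open_vs_iff[OF A V] o_def
proof
  fix c assume c: "c \<in> A"
  show "smooth_on (snd c ` (fst c \<inter> V)) (\<lambda>x. f (cinv c x) + g (cinv c x))"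
    using assms(3,4) c unfolding smooth_map_open_vs_iff[OF A V] o_def
    by (intro smooth_on_add[OF open_chart_image[OF A c V]]) auto
qed

lemma smooth_map_open_bilinear:
  fixes A :: "('m::t2_space, 'e::real_normed_vector) chart set"
  assumes A: "smooth_atlas A" and V: "open V" and B: "bounded_bilinear B"
    and "smooth_map_open A V vs_atlas f" "smooth_map_open A V vs_atlas g"
  shows "smooth_map_open A V vs_atlas (\<lambda>x. B (f x) (g x))"
  unfolding smooth_map_open_vs_iff[OF A V] o_def
proof
  fix c assume c: "c \<in> A"
  show "smooth_on (snd c ` (fst c \<inter> V)) (\<lambda>x. B (f (cinv c x)) (g (cinv c x)))"
    using assms(4,5) c unfolding smooth_map_open_vs_iff[OF A V] o_def
    by (intro smooth_on_bilinear[OF open_chart_image[OF A c V] B]) auto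
qed

lemma smooth_map_open_bounded_linear:
  fixes A :: "('m::t2_space, 'e::real_normed_vector) chart set"
  assumes A: "smooth_atlas A" and V: "open V" and L: "bounded_linear L"
    and "smooth_map_open A V vs_atlas f"
  shows "smooth_map_open A V vs_atlas (\<lambda>x. L (f x))"
  unfolding smooth_map_open_vs_iff[OF A V] o_def
proof
  fix c assume c: "c \<in> A"
  show "smooth_on (snd c ` (fst c \<inter> V)) (\<lambda>x. L (f (cinv c x)))"
    using assms(4) c unfolding smooth_map_open_vs_iff[OF A V] o_def
    by (intro smooth_on_bounded_linear[OF open_chart_image[OF A c V] L]) auto
qed

section \<open>Smooth maps on arbitrary subsets\<close>

lemma smooth_map_onE:
  assumes "smooth_map_on A S B f" "x \<in> S"
  obtains V g where "open V" "x \<in> V" "smooth_map_open A V B g" "\<forall>y\<in>S \<inter> V. g y = f y"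
  using bspec[OF assms(1)[unfolded smooth_map_on_def] assms(2)] by (elim exE conjE) (rule that)

lemma smooth_map_onI:
  assumes "\<And>x. x \<in> S \<Longrightarrow> \<exists>V g. open V \<and> x \<in> V \<and> smooth_map_open A V B g \<and> (\<forall>y\<in>S \<inter> V. g y = f y)"
  shows "smooth_map_on A S B f"
  unfolding smooth_map_on_def by (intro ballI assms)

text \<open>Lets proofs change notions: \<open>smooth_map_on\<close> composes through sets such as
  \<open>U \<times> Q\<close> that need not be open, whereas derivatives are taken with
  \<open>smooth_map_open\<close>.\<close>

lemma smooth_map_on_iff_open:
  fixes A :: "('m::t2_space, 'e::real_normed_vector) chart set"
  assumes A: "smooth_atlas A" and B: "smooth_atlas B" and S: "open S"
  shows "smooth_map_on A S B f \<longleftrightarrow> smooth_map_open A S B f"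
proof
  assume L: "smooth_map_on A S B f"
  show "smooth_map_open A S B f"
  proof (rule smooth_map_open_local[OF A B S])
    fix x assume x: "x \<in> S"
    obtain V g where V: "open V" "x \<in> V" "smooth_map_open A V B g" "\<forall>y\<in>S \<inter> V. g y = f y"
      by (rule smooth_map_onE[OF L x])
    have "smooth_map_open A (S \<inter> V) B f"
      by (rule smooth_map_open_cong[OF A B _ V(4)[rule_format] smooth_map_open_subset[OF V(3)]]) (use S V(1) in auto)
    then show "\<exists>W. open W \<and> x \<in> W \<and> smooth_map_open A W B f"
      using S V x by (intro exI[of _ "S \<inter> V"]) auto
  qed
next
  assume "smooth_map_open A S B f"
  then show "smooth_map_on A S B f" using S by (intro smooth_map_onI exI[of _ S] exI[of _ f]) auto
qed

lemma smooth_map_on_subset: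
  assumes f: "smooth_map_on A T B f" and sub: "S \<subseteq> T"
  shows "smooth_map_on A S B f"
proof (rule smooth_map_onI)
  fix x assume x: "x \<in> S"
  with sub have "x \<in> T" by blast
  from f this obtain V g where V: "open V" "x \<in> V" "smooth_map_open A V B g" "\<forall>y\<in>T \<inter> V. g y = f y"
    by (rule smooth_map_onE)
  then show "\<exists>V h. open V \<and> x \<in> V \<and> smooth_map_open A V B h \<and> (\<forall>y\<in>S \<inter> V. h y = f y)"
    using sub by (intro exI[of _ V] exI[of _ g]) auto
qed

lemma smooth_map_on_compose:
  fixes A :: "('m::t2_space, 'e::real_normed_vector) chart set"
    and B :: "('n::t2_space, 'f::{real_inner,heine_borel}) chart set"
  assumes A: "smooth_atlas A" and B: "smooth_atlas B" and D: "smooth_atlas D"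
    and sub: "f ` S \<subseteq> T"
    and f: "smooth_map_on A S B f" and g: "smooth_map_on B T D g"
  shows "smooth_map_on A S D (\<lambda>x. g (f x))"
  unfolding smooth_map_on_def
proof
  fix x assume x: "x \<in> S"
  obtain V f' where V: "open V" "x \<in> V" "smooth_map_open A V B f'" "\<forall>y\<in>S \<inter> V. f' y = f y"
    by (rule smooth_map_onE[OF f x])
  obtain W g' where W: "open W" "f x \<in> W" "smooth_map_open B W D g'" "\<forall>y\<in>T \<inter> W. g' y = g y"
    by (rule smooth_map_onE[OF g subsetD[OF sub imageI[OF x]]])
  \<comment> \<open>Off \<open>S\<close> the extension \<open>f'\<close> may leave the domain of the
    extension \<open>g'\<close>, so the points where this happens are cut away.\<close>
  define U where "U = V \<inter> f' -` W"
  have U: "open U" unfolding U_def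
    by (rule continuous_open_preimage[OF smooth_map_open_continuous[OF V(3)] V(1) W(1)])
  have "smooth_map_open A U D (\<lambda>x. g' (f' x))"
    by (rule smooth_map_open_compose[OF A B D U W(1) _ smooth_map_open_subset[OF V(3)] W(3)])
      (auto simp: U_def)
  moreover have "x \<in> U" using V x W by (simp add: U_def)
  moreover have "g' (f' y) = g (f y)" if "y \<in> S \<inter> U" for y
    using that V(4) W(4) sub by (auto simp: U_def)
  ultimately show "\<exists>V h. open V \<and> x \<in> V \<and> smooth_map_open A V D h \<and> (\<forall>y\<in>S \<inter> V. h y = g (f y))"
    using U by blast
qed

lemma smooth_map_on_Pair:
  fixes A :: "('m::t2_space, 'e::real_normed_vector) chart set"
    and B :: "('n::t2_space, 'f::{real_inner,heine_borel}) chart set"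
    and D :: "('k::t2_space, 'd::{real_inner,heine_borel}) chart set"
  assumes A: "smooth_atlas A" and B: "smooth_atlas B" and D: "smooth_atlas D"
    and f: "smooth_map_on A S B f" and g: "smooth_map_on A S D g"
  shows "smooth_map_on A S (prod_atlas B D) (\<lambda>x. (f x, g x))"
  unfolding smooth_map_on_def
proof
  fix x assume x: "x \<in> S"
  obtain V f' where V: "open V" "x \<in> V" "smooth_map_open A V B f'" "\<forall>y\<in>S \<inter> V. f' y = f y"
    by (rule smooth_map_onE[OF f x])
  obtain W g' where W: "open W" "x \<in> W" "smooth_map_open A W D g'" "\<forall>y\<in>S \<inter> W. g' y = g y"
    by (rule smooth_map_onE[OF g x])
  have "smooth_map_open A (V \<inter> W) (prod_atlas B D) (\<lambda>x. (f' x, g' x))"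
    by (rule smooth_map_open_Pair[OF A B D _ smooth_map_open_subset[OF V(3)] smooth_map_open_subset[OF W(3)]])
      (use V W in auto)
  then show "\<exists>V h. open V \<and> x \<in> V \<and> smooth_map_open A V (prod_atlas B D) h \<and> (\<forall>y\<in>S \<inter> V. h y = (f y, g y))"
    using V W by (intro exI[of _ "V \<inter> W"] exI[of _ "\<lambda>x. (f' x, g' x)"]) auto
qed

lemma smooth_map_on_const: "smooth_map_on A S B (\<lambda>x. k)"
  unfolding smooth_map_on_def
  by (intro ballI exI[of _ UNIV] exI[of _ "\<lambda>x. k"]) (simp add: smooth_map_open_const)

lemma smooth_map_on_ident: "smooth_atlas A \<Longrightarrow> smooth_map_on A S A (\<lambda>x. x)"
  unfolding smooth_map_on_def
  by (intro ballI exI[of _ UNIV] exI[of _ "\<lambda>x. x"]) (simp add: smooth_map_open_ident)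

section \<open>Tangent maps\<close>

text \<open>The pointwise condition under which \<open>tderiv\<close> and \<open>tmap\<close> do not
  depend on the chart and obey the chain rule. Continuity is included so that a neighbourhood is
  mapped into any given chart around the image point.\<close>

definition mdiff :: "('m::t2_space, 'e::real_normed_vector) chart set \<Rightarrow>
    ('n::t2_space, 'f::real_normed_vector) chart set \<Rightarrow> ('m \<Rightarrow> 'n) \<Rightarrow> 'm \<Rightarrow> bool" where
  "mdiff A B f x \<longleftrightarrow> isCont f x \<and>
     (\<forall>c\<in>charts_at A x. \<forall>d\<in>charts_at B (f x). (snd d \<circ> f \<circ> cinv c) differentiable (at (snd c x)))"

lemma smooth_map_open_imp_mdiff:
  assumes A: "smooth_atlas A" and B: "smooth_atlas B" and V: "open V" "x \<in> V"
    and f: "smooth_map_open A V B f"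
  shows "mdiff A B f x"
  unfolding mdiff_def
proof (intro conjI ballI)
  show "isCont f x"
    using smooth_map_open_continuous[OF f] V by (simp add: continuous_on_eq_continuous_at)
  fix c d assume "c \<in> charts_at A x" "d \<in> charts_at B (f x)"
  then have c: "c \<in> A" "x \<in> fst c" and d: "d \<in> B" "f x \<in> fst d" by (auto dest: charts_atD)
  show "(snd d \<circ> f \<circ> cinv c) differentiable (at (snd c x))"
    using smooth_map_openD[OF f c(1) d(1)] by (rule smooth_on_imp_differentiable) (use c d V in auto)
qed

lemma smooth_map_on_imp_mdiff:
  assumes "smooth_atlas A" "smooth_atlas B" "open V" "x \<in> V" "smooth_map_on A V B f"
  shows "mdiff A B f x"
  using assms smooth_map_on_iff_open[OF assms(1-3), of f] smooth_map_open_imp_mdiff[OF assms(1-4), of f]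
  by blast

lemma mdiff_vs_differentiable:
  "mdiff A vs_atlas f x \<Longrightarrow> c \<in> charts_at A x \<Longrightarrow> (f \<circ> cinv c) differentiable (at (snd c x))"
  by (auto simp: mdiff_def charts_at_vs o_def)

lemma transition_differentiable:
  assumes A: "smooth_atlas A" and c: "c \<in> charts_at A x" and d: "d \<in> charts_at A x"
  shows "(snd d \<circ> cinv c) differentiable (at (snd c x))"
  using smooth_atlas_transition[OF A, of c d]
  by (rule smooth_on_imp_differentiable) (use c d in \<open>auto dest: charts_atD\<close>)

lemma tangent_space_off: "v \<in> tangent_space A x \<Longrightarrow> c \<notin> charts_at A x \<Longrightarrow> v c = 0"
  unfolding tangent_space_def by blast

lemma tangent_spaceD:
  "v \<in> tangent_space A x \<Longrightarrow> c \<in> charts_at A x \<Longrightarrow> d \<in> charts_at A x \<Longrightarrow>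
    v d = frechet_derivative (snd d \<circ> cinv c) (at (snd c x)) (v c)"
  unfolding tangent_space_def by blast

lemma frechet_derivative_compose:
  assumes "f differentiable (at x)" "g differentiable (at (f x))"
  shows "(\<lambda>x. g (f x)) differentiable (at x)"
    "frechet_derivative (\<lambda>x. g (f x)) (at x) v = frechet_derivative g (at (f x)) (frechet_derivative f (at x) v)"
proof -
  have "((\<lambda>x. g (f x)) has_derivative (\<lambda>v. frechet_derivative g (at (f x)) (frechet_derivative f (at x) v))) (at x)"
    using has_derivative_compose[of f _ x UNIV g] assms unfolding frechet_derivative_works by blast
  then show "(\<lambda>x. g (f x)) differentiable (at x)"
    "frechet_derivative (\<lambda>x. g (f x)) (at x) v = frechet_derivative g (at (f x)) (frechet_derivative f (at x) v)"
    by (auto simp: differentiable_def frechet_derivative_eqI)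
qed

text \<open>Near \<open>x\<close> the two coordinate expressions of \<open>F\<close> differ by the
  transition map, so the chain rule applies. The agreement holds on an open set, which keeps the
  values of charts off their domains out of play.\<close>

lemma chart_change:
  assumes A: "smooth_atlas A" and c: "c \<in> charts_at A x" and c': "c' \<in> charts_at A x"
    and F: "(F \<circ> cinv c) differentiable (at (snd c x))"
  shows "(F \<circ> cinv c') differentiable (at (snd c' x))"
    and "frechet_derivative (F \<circ> cinv c') (at (snd c' x)) e
      = frechet_derivative (F \<circ> cinv c) (at (snd c x)) (frechet_derivative (snd c \<circ> cinv c') (at (snd c' x)) e)"
proof -
  have cc: "c \<in> A" "x \<in> fst c" "c' \<in> A" "x \<in> fst c'" using c c' by (auto dest: charts_atD)
  define S where "S = snd c' ` (fst c' \<inter> fst c)"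
  have S: "open S" unfolding S_def by (rule open_chart_image[OF A cc(3) smooth_atlasD(1)[OF A cc(1)]])
  have x: "snd c' x \<in> S" using cc by (simp add: S_def)
  have eq: "(F \<circ> cinv c) ((snd c \<circ> cinv c') y) = (F \<circ> cinv c') y" if "y \<in> S" for y
    using that cinv_atlas[OF A cc(1)] cinv_atlas[OF A cc(3)] by (auto simp: S_def)
  have x': "(snd c \<circ> cinv c') (snd c' x) = snd c x" by (simp add: cinv_atlas[OF A cc(3,4)])
  note D = frechet_derivative_compose[OF transition_differentiable[OF A c' c], unfolded x', OF F]
  have fc: "frechet_derivative (\<lambda>y. (F \<circ> cinv c) ((snd c \<circ> cinv c') y)) (at (snd c' x))
      = frechet_derivative (F \<circ> cinv c') (at (snd c' x))"
    by (rule frechet_derivative_cong[OF S x]) (rule eq)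
  show "(F \<circ> cinv c') differentiable (at (snd c' x))"
    by (rule differentiable_cong_open[OF S x eq D(1)])
  show "frechet_derivative (F \<circ> cinv c') (at (snd c' x)) e
      = frechet_derivative (F \<circ> cinv c) (at (snd c x)) (frechet_derivative (snd c \<circ> cinv c') (at (snd c' x)) e)"
    unfolding fc[symmetric] by (rule D(2))
qed

text \<open>The derivative in another chart changes by the transition map, and the transformation
  law of tangent vectors compensates. This frees \<open>tderiv\<close> from its choice of a
  chart.\<close>

lemma tderiv_chart:
  assumes A: "smooth_atlas A" and c: "c \<in> charts_at A x"
    and F: "(F \<circ> cinv c) differentiable (at (snd c x))" and v: "v \<in> tangent_space A x"
  shows "tderiv A F x v = frechet_derivative (F \<circ> cinv c) (at (snd c x)) (v c)"
proof -
  define c' where "c' = (SOME c. c \<in> charts_at A x)"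
  have c': "c' \<in> charts_at A x" unfolding c'_def using c by (rule someI)
  show ?thesis
    unfolding tderiv_def Let_def c'_def[symmetric]
    using chart_change(2)[OF A c c' F] tangent_spaceD[OF v c' c] by simp
qed

lemma tmap_chart:
  assumes A: "smooth_atlas A" and f: "mdiff A B f x" and v: "v \<in> tangent_space A x"
    and c: "c \<in> charts_at A x" and d: "d \<in> charts_at B (f x)"
  shows "tmap A B f x v d = frechet_derivative (snd d \<circ> f \<circ> cinv c) (at (snd c x)) (v c)"
  using tderiv_chart[OF A c _ v, of "snd d \<circ> f"] f c d by (simp add: tmap_def mdiff_def)

text \<open>\<open>F\<close> is required to be differentiable only in the one chart
  \<open>d\<close>, so that it may itself be a chart map, meaningful merely near
  \<open>f x\<close>.\<close>

lemma tderiv_comp: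
  assumes A: "smooth_atlas A" and B: "smooth_atlas B" and f: "mdiff A B f x"
    and v: "v \<in> tangent_space A x" and d: "d \<in> charts_at B (f x)"
    and F: "(F \<circ> cinv d) differentiable (at (snd d (f x)))" and c: "c \<in> charts_at A x"
  shows "((\<lambda>x. F (f x)) \<circ> cinv c) differentiable (at (snd c x))"
    and "frechet_derivative ((\<lambda>x. F (f x)) \<circ> cinv c) (at (snd c x)) (v c)
       = frechet_derivative (F \<circ> cinv d) (at (snd d (f x))) (tmap A B f x v d)"
proof -
  have cc: "c \<in> A" "x \<in> fst c" and dd: "d \<in> B" "f x \<in> fst d" using c d by (auto dest: charts_atD)
  obtain W where W: "open W" "x \<in> W" "f ` W \<subseteq> fst d"
    using f dd smooth_atlasD(1)[OF B dd(1)] unfolding mdiff_def continuous_at_open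
    by (metis image_subsetI)
  define S where "S = snd c ` (fst c \<inter> W)"
  have S: "open S" unfolding S_def by (rule open_chart_image[OF A cc(1) W(1)])
  have x: "snd c x \<in> S" using cc W by (simp add: S_def)
  have eq: "(F \<circ> cinv d) ((snd d \<circ> f \<circ> cinv c) y) = ((\<lambda>x. F (f x)) \<circ> cinv c) y" if "y \<in> S" for y
    using that W cinv_atlas[OF A cc(1)] cinv_atlas[OF B dd(1)] by (auto simp: S_def)
  have x': "(snd d \<circ> f \<circ> cinv c) (snd c x) = snd d (f x)" by (simp add: cinv_atlas[OF A cc])
  have df: "(snd d \<circ> f \<circ> cinv c) differentiable (at (snd c x))" using f c d by (simp add: mdiff_def)
  note D = frechet_derivative_compose[OF df, unfolded x', OF F]
  have fc: "frechet_derivative (\<lambda>y. (F \<circ> cinv d) ((snd d \<circ> f \<circ> cinv c) y)) (at (snd c x))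
      = frechet_derivative ((\<lambda>x. F (f x)) \<circ> cinv c) (at (snd c x))"
    by (rule frechet_derivative_cong[OF S x]) (rule eq)
  show "((\<lambda>x. F (f x)) \<circ> cinv c) differentiable (at (snd c x))"
    by (rule differentiable_cong_open[OF S x eq D(1)])
  show "frechet_derivative ((\<lambda>x. F (f x)) \<circ> cinv c) (at (snd c x)) (v c)
       = frechet_derivative (F \<circ> cinv d) (at (snd d (f x))) (tmap A B f x v d)"
    unfolding fc[symmetric] tmap_chart[OF A f v c d] by (rule D(2))
qed

lemma tmap_tangent_space:
  assumes A: "smooth_atlas A" and B: "smooth_atlas B" and f: "mdiff A B f x"
    and v: "v \<in> tangent_space A x"
  shows "tmap A B f x v \<in> tangent_space B (f x)"
  unfolding tangent_space_def
proof (intro CollectI conjI allI ballI impI)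
  show "tmap A B f x v d = 0" if "d \<notin> charts_at B (f x)" for d using that by (simp add: tmap_def)
  fix d d' assume d: "d \<in> charts_at B (f x)" and d': "d' \<in> charts_at B (f x)"
  obtain c where c: "c \<in> charts_at A x" using charts_at_nonempty[OF A] by blast
  have "((\<lambda>x. snd d' (f x)) \<circ> cinv c) = snd d' \<circ> f \<circ> cinv c" by (auto simp: o_def)
  then show "tmap A B f x v d' = frechet_derivative (snd d' \<circ> cinv d) (at (snd d (f x))) (tmap A B f x v d)"
    using tderiv_comp(2)[OF A B f v d transition_differentiable[OF B d d'] c] tmap_chart[OF A f v c d'] by simp
qed

lemma mdiff_compose:
  assumes A: "smooth_atlas A" and B: "smooth_atlas B" and f: "mdiff A B f x" and g: "mdiff B D g (f x)"
  shows "mdiff A D (\<lambda>x. g (f x)) x"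
  unfolding mdiff_def
proof (intro conjI ballI)
  show "isCont (\<lambda>x. g (f x)) x" using isCont_o2[of x f g] f g by (simp add: mdiff_def)
  fix c p assume c: "c \<in> charts_at A x" and p: "p \<in> charts_at D (g (f x))"
  obtain d where d: "d \<in> charts_at B (f x)" using charts_at_nonempty[OF B] by blast
  \<comment> \<open>The chain rule is stated for a tangent vector; any one serves to extract
    differentiability, and the zero vector is always available.\<close>
  have "(\<lambda>_. 0) \<in> tangent_space A x"
    using linear_0[OF frechet_derivative_linear[OF transition_differentiable[OF A]]]
    by (simp add: tangent_space_def)
  moreover have "(snd p \<circ> g \<circ> cinv d) differentiable (at (snd d (f x)))"
    using g d p by (simp add: mdiff_def)
  ultimately have "((\<lambda>x. (snd p \<circ> g) (f x)) \<circ> cinv c) differentiable (at (snd c x))"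
    using tderiv_comp(1)[OF A B f _ d _ c, of _ "snd p \<circ> g"] by blast
  moreover have "((\<lambda>x. (snd p \<circ> g) (f x)) \<circ> cinv c) = snd p \<circ> (\<lambda>x. g (f x)) \<circ> cinv c"
    by (auto simp: o_def)
  ultimately show "(snd p \<circ> (\<lambda>x. g (f x)) \<circ> cinv c) differentiable (at (snd c x))" by simp
qed

lemma tderiv_tmap:
  assumes A: "smooth_atlas A" and B: "smooth_atlas B" and f: "mdiff A B f x"
    and F: "mdiff B vs_atlas F (f x)" and v: "v \<in> tangent_space A x"
  shows "tderiv A (\<lambda>x. F (f x)) x v = tderiv B F (f x) (tmap A B f x v)"
proof -
  obtain c where c: "c \<in> charts_at A x" using charts_at_nonempty[OF A] by blast
  obtain d where d: "d \<in> charts_at B (f x)" using charts_at_nonempty[OF B] by blast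
  note Fd = mdiff_vs_differentiable[OF F d]
  show ?thesis
    using tderiv_chart[OF A c tderiv_comp(1)[OF A B f v d Fd c] v] tderiv_comp(2)[OF A B f v d Fd c]
      tderiv_chart[OF B d Fd tmap_tangent_space[OF A B f v]] by simp
qed

lemma tmap_compose:
  assumes A: "smooth_atlas A" and B: "smooth_atlas B" and f: "mdiff A B f x"
    and g: "mdiff B D g (f x)" and v: "v \<in> tangent_space A x"
  shows "tmap B D g (f x) (tmap A B f x v) = tmap A D (\<lambda>x. g (f x)) x v"
proof
  fix p
  show "tmap B D g (f x) (tmap A B f x v) p = tmap A D (\<lambda>x. g (f x)) x v p"
  proof (cases "p \<in> charts_at D (g (f x))")
    case True
    obtain c where c: "c \<in> charts_at A x" using charts_at_nonempty[OF A] by blast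
    obtain d where d: "d \<in> charts_at B (f x)" using charts_at_nonempty[OF B] by blast
    have gd: "(snd p \<circ> g \<circ> cinv d) differentiable (at (snd d (f x)))"
      using g d True by (simp add: mdiff_def)
    have eq: "((\<lambda>x. (snd p \<circ> g) (f x)) \<circ> cinv c) = snd p \<circ> (\<lambda>x. g (f x)) \<circ> cinv c"
      by (auto simp: o_def)
    show ?thesis
      unfolding tmap_chart[OF B g tmap_tangent_space[OF A B f v] d True]
        tmap_chart[OF A mdiff_compose[OF A B f g] v c True]
        tderiv_comp(2)[OF A B f v d gd c, unfolded eq] ..
  qed (simp add: tmap_def)
qed

lemma tangent_space_add_scale:
  assumes A: "smooth_atlas A" and v: "v \<in> tangent_space A x" and w: "w \<in> tangent_space A x"
  shows "(\<lambda>c. a *\<^sub>R v c + b *\<^sub>R w c) \<in> tangent_space A x"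
  unfolding tangent_space_def
proof (intro CollectI conjI allI ballI impI)
  show "a *\<^sub>R v c + b *\<^sub>R w c = 0" if "c \<notin> charts_at A x" for c
    using tangent_space_off[OF v that] tangent_space_off[OF w that] by simp
  fix c d assume c: "c \<in> charts_at A x" and d: "d \<in> charts_at A x"
  show "a *\<^sub>R v d + b *\<^sub>R w d = frechet_derivative (snd d \<circ> cinv c) (at (snd c x)) (a *\<^sub>R v c + b *\<^sub>R w c)"
    using frechet_derivative_linear[OF transition_differentiable[OF A c d]]
      tangent_spaceD[OF v c d] tangent_spaceD[OF w c d] by (simp add: linear_add linear_cmul)
qed

lemma coord_vec_self:
  assumes A: "smooth_atlas A" and c: "c \<in> charts_at A x"
  shows "coord_vec A c x e c = e"
proof -
  have cc: "c \<in> A" "x \<in> fst c" using c by (auto dest: charts_atD)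
  have "frechet_derivative (snd c \<circ> cinv c) (at (snd c x)) = frechet_derivative (\<lambda>y. y) (at (snd c x))"
    by (rule frechet_derivative_cong[OF smooth_atlasD(2)[OF A cc(1)]])
      (use cc cinv_atlas[OF A cc(1)] in auto)
  also have "\<dots> = (\<lambda>e. e)" by (rule frechet_derivative_eqI) simp
  finally show ?thesis using c by (simp add: coord_vec_def)
qed

lemma coord_vec_tangent_space:
  assumes A: "smooth_atlas A" and c: "c \<in> charts_at A x"
  shows "coord_vec A c x e \<in> tangent_space A x"
  unfolding tangent_space_def
proof (intro CollectI conjI allI ballI impI)
  show "coord_vec A c x e d = 0" if "d \<notin> charts_at A x" for d using that by (simp add: coord_vec_def)
  fix d d' assume d: "d \<in> charts_at A x" and d': "d' \<in> charts_at A x"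
  show "coord_vec A c x e d' = frechet_derivative (snd d' \<circ> cinv d) (at (snd d x)) (coord_vec A c x e d)"
    using chart_change(2)[OF A d c transition_differentiable[OF A d d']] d d' by (simp add: coord_vec_def)
qed

lemma coord_vec_eq:
  assumes A: "smooth_atlas A" and c: "c \<in> charts_at A x" and v: "v \<in> tangent_space A x"
  shows "coord_vec A c x (v c) = v"
proof
  fix d
  show "coord_vec A c x (v c) d = v d"
    using tangent_space_off[OF v, of d] tangent_spaceD[OF v c, of d] by (simp add: coord_vec_def)
qed

text \<open>The unit vector d/dt of the real line. As a tangent vector it has to vanish on all
  charts outside \<open>vs_atlas\<close>.\<close>

definition std_tvec :: "(real, real) tvec" where
  "std_tvec c = (if c = (UNIV, \<lambda>x. x) then 1 else 0)"

lemma std_tvec_tangent_space: "std_tvec \<in> tangent_space vs_atlas t"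
proof -
  have "frechet_derivative (\<lambda>x. x) (at t) = (\<lambda>v::real. v)" by (rule frechet_derivative_eqI) simp
  then show ?thesis
    by (simp add: tangent_space_def charts_at_vs std_tvec_def o_def cinv_vs)
qed

text \<open>Makes the chain rule for curves an instance of the one for tangent maps.\<close>

lemma velocity_eq_tmap:
  assumes \<gamma>: "mdiff vs_atlas A \<gamma> t"
  shows "velocity A \<gamma> t = tmap vs_atlas A \<gamma> t std_tvec"
proof
  fix d
  show "velocity A \<gamma> t d = tmap vs_atlas A \<gamma> t std_tvec d"
  proof (cases "d \<in> charts_at A (\<gamma> t)")
    case True
    have "(snd d \<circ> \<gamma>) differentiable (at t)"
      using \<gamma> True by (simp add: mdiff_def charts_at_vs cinv_vs o_def)
    then show ?thesis
      using True tmap_chart[OF smooth_atlas_vs \<gamma> std_tvec_tangent_space _ True, of "(UNIV, \<lambda>x. x)"]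
      by (simp add: velocity_def charts_at_vs cinv_vs o_def std_tvec_def frechet_derivative_eq_vector_derivative)
  qed (simp add: velocity_def tmap_def)
qed

lemma velocity_tangent_space:
  assumes "smooth_atlas A" "mdiff vs_atlas A \<gamma> t"
  shows "velocity A \<gamma> t \<in> tangent_space A (\<gamma> t)"
  unfolding velocity_eq_tmap[OF assms(2)]
  by (rule tmap_tangent_space[OF smooth_atlas_vs assms std_tvec_tangent_space])

lemma tmap_velocity:
  assumes A: "smooth_atlas A" and \<gamma>: "mdiff vs_atlas A \<gamma> t" and f: "mdiff A B f (\<gamma> t)"
  shows "tmap A B f (\<gamma> t) (velocity A \<gamma> t) = velocity B (\<lambda>t. f (\<gamma> t)) t"
  using tmap_compose[OF smooth_atlas_vs A \<gamma> f std_tvec_tangent_space]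
    velocity_eq_tmap[OF \<gamma>] velocity_eq_tmap[OF mdiff_compose[OF smooth_atlas_vs A \<gamma> f]] by simp

lemma has_vector_derivative_along_curve:
  assumes A: "smooth_atlas A" and \<gamma>: "mdiff vs_atlas A \<gamma> t" and F: "mdiff A vs_atlas F (\<gamma> t)"
  shows "((\<lambda>t. F (\<gamma> t)) has_vector_derivative tderiv A F (\<gamma> t) (velocity A \<gamma> t)) (at t)"
proof -
  let ?c = "(UNIV, \<lambda>x. x) :: (real, real) chart"
  have c: "?c \<in> charts_at vs_atlas t" by (simp add: charts_at_vs)
  have d: "(\<lambda>t. F (\<gamma> t)) differentiable (at t)"
    using mdiff_vs_differentiable[OF mdiff_compose[OF smooth_atlas_vs A \<gamma> F] c] by (simp add: cinv_vs o_def)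
  have "tderiv A F (\<gamma> t) (velocity A \<gamma> t) = tderiv vs_atlas (\<lambda>t. F (\<gamma> t)) t std_tvec"
    using tderiv_tmap[OF smooth_atlas_vs A \<gamma> F std_tvec_tangent_space] velocity_eq_tmap[OF \<gamma>] by simp
  also have "\<dots> = frechet_derivative (\<lambda>t. F (\<gamma> t)) (at t) 1"
    using tderiv_chart[OF smooth_atlas_vs c _ std_tvec_tangent_space, of "\<lambda>t. F (\<gamma> t)"] d
    by (simp add: cinv_vs o_def std_tvec_def)
  also have "\<dots> = vector_derivative (\<lambda>t. F (\<gamma> t)) (at t)"
    using d by (simp add: frechet_derivative_eq_vector_derivative)
  finally show ?thesis using d by (simp add: vector_derivative_works)
qed

section \<open>Lie groups\<close>

lemma smooth_map_open_cinv:
  fixes A :: "('m::t2_space, 'e::real_normed_vector) chart set"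
  assumes A: "smooth_atlas A" and c: "c \<in> A"
  shows "smooth_map_open vs_atlas (snd c ` fst c) A (cinv c)"
  unfolding smooth_map_open_def
proof (intro conjI ballI)
  show "continuous_on (snd c ` fst c) (cinv c)" by (rule smooth_atlasD(5)[OF A c])
  fix b :: "('e, 'e) chart" and d assume b: "b \<in> vs_atlas" and d: "d \<in> A"
  show "smooth_on (snd b ` (fst b \<inter> snd c ` fst c \<inter> cinv c -` fst d)) (snd d \<circ> cinv c \<circ> cinv b)"
    using b smooth_atlas_transition[OF A c d]
    by (auto simp: vs_atlas_def cinv_vs o_def cinv_atlas[OF A c] intro!: smooth_on_subset[of "snd c ` (fst c \<inter> fst d)"])
qed

locale Lie_group =
  fixes G :: "('g::t2_space, 'v::{real_inner,heine_borel}) lie_grp" (structure)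
  assumes lie: "lie_group G"
begin

lemma lie_group_group: "group G"
  and carrier_UNIV: "carrier G = UNIV"
  and smooth_atlas_G: "smooth_atlas (atlas G)"
  and unit_chart_G: "unit_chart G \<in> charts_at (atlas G) \<one>"
  using lie by (simp_all add: lie_group_def)

sublocale grp: group G by (rule lie_group_group)

abbreviation (input) "uchart \<equiv> unit_chart G"
abbreviation (input) "origin \<equiv> snd (unit_chart G) \<one>"

lemma in_carrier [simp]: "g \<in> carrier G" by (simp add: carrier_UNIV)

lemma smooth_map_on_mult:
  fixes A :: "('m::t2_space, 'e::real_normed_vector) chart set"
  assumes A: "smooth_atlas A" and f: "smooth_map_on A S (atlas G) f" and g: "smooth_map_on A S (atlas G) g"
  shows "smooth_map_on A S (atlas G) (\<lambda>x. f x \<otimes> g x)"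
proof -
  have "smooth_map_on (prod_atlas (atlas G) (atlas G)) UNIV (atlas G) (\<lambda>(g, h). g \<otimes> h)"
    using lie by (simp add: lie_group_def)
  from smooth_map_on_compose[OF A smooth_atlas_prod[OF smooth_atlas_G smooth_atlas_G] smooth_atlas_G _
      smooth_map_on_Pair[OF A smooth_atlas_G smooth_atlas_G f g] this]
  show ?thesis by simp
qed

lemma smooth_map_on_inverse:
  fixes A :: "('m::t2_space, 'e::real_normed_vector) chart set"
  assumes A: "smooth_atlas A" and f: "smooth_map_on A S (atlas G) f"
  shows "smooth_map_on A S (atlas G) (\<lambda>x. inv f x)"
proof -
  have "smooth_map_on (atlas G) UNIV (atlas G) (\<lambda>g. inv g)"
    using lie by (simp add: lie_group_def)
  from smooth_map_on_compose[OF A smooth_atlas_G smooth_atlas_G _ f this] show ?thesis by simp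
qed

abbreviation (input) conj_by :: "'g \<Rightarrow> 'g \<Rightarrow> 'g" where
  "conj_by g h \<equiv> g \<otimes> h \<otimes> inv g"

section \<open>The adjoint action and the bracket\<close>

lemma mdiff_conj: "mdiff (atlas G) (atlas G) (conj_by g) h"
  by (rule smooth_map_on_imp_mdiff[OF smooth_atlas_G smooth_atlas_G open_UNIV UNIV_I
        smooth_map_on_mult[OF smooth_atlas_G smooth_map_on_mult[OF smooth_atlas_G smooth_map_on_const
            smooth_map_on_ident[OF smooth_atlas_G]] smooth_map_on_const]])

lemma conj_one: "conj_by g \<one> = \<one>" by simp

lemma Ad_eq_frechet:
  "Ad G g = frechet_derivative (snd uchart \<circ> conj_by g \<circ> cinv uchart) (at (origin))"
  by (rule ext) (simp add: Ad_def Let_def o_def)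

lemma linear_Ad: "linear (Ad G g)"
  unfolding Ad_eq_frechet
  using mdiff_conj[of g "\<one>"] unit_chart_G conj_one[of g]
  by (intro frechet_derivative_linear) (simp add: mdiff_def)

text \<open>Passes from the coordinate formula for \<open>Ad\<close> to tangent maps, where the
  chain rule turns composition of conjugations into multiplicativity of \<open>Ad\<close>.\<close>

lemma coord_vec_Ad:
  "coord_vec (atlas G) uchart \<one> (Ad G g X)
    = tmap (atlas G) (atlas G) (conj_by g) \<one> (coord_vec (atlas G) uchart \<one> X)"
proof -
  let ?v = "coord_vec (atlas G) uchart \<one> X"
  have v: "?v \<in> tangent_space (atlas G) \<one>"
    by (rule coord_vec_tangent_space[OF smooth_atlas_G unit_chart_G])
  have u: "unit_chart G \<in> charts_at (atlas G) (conj_by g \<one>)"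
    unfolding conj_one by (rule unit_chart_G)
  have "Ad G g X = tmap (atlas G) (atlas G) (conj_by g) \<one> ?v uchart"
    unfolding Ad_eq_frechet tmap_chart[OF smooth_atlas_G mdiff_conj v unit_chart_G u]
      coord_vec_self[OF smooth_atlas_G unit_chart_G] ..
  then show ?thesis
    using coord_vec_eq[OF smooth_atlas_G u tmap_tangent_space[OF smooth_atlas_G smooth_atlas_G mdiff_conj v]]
    by simp
qed

lemma Ad_mult: "Ad G (g \<otimes> h) X = Ad G g (Ad G h X)"
proof -
  let ?cv = "coord_vec (atlas G) uchart \<one>"
  have v: "?cv X \<in> tangent_space (atlas G) \<one>"
    by (rule coord_vec_tangent_space[OF smooth_atlas_G unit_chart_G])
  have "?cv (Ad G g (Ad G h X)) = tmap (atlas G) (atlas G) (conj_by g) (conj_by h \<one>)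
      (tmap (atlas G) (atlas G) (conj_by h) \<one> (?cv X))"
    unfolding coord_vec_Ad conj_one ..
  also have "\<dots> = tmap (atlas G) (atlas G) (\<lambda>x. conj_by g (conj_by h x)) \<one> (?cv X)"
    by (rule tmap_compose[OF smooth_atlas_G smooth_atlas_G mdiff_conj mdiff_conj v])
  also have "(\<lambda>x. conj_by g (conj_by h x)) = conj_by (g \<otimes> h)"
    by (rule ext) (simp add: grp.inv_mult_group grp.m_assoc)
  finally have "?cv (Ad G g (Ad G h X)) = ?cv (Ad G (g \<otimes> h) X)" by (simp only: coord_vec_Ad)
  then show ?thesis
    using coord_vec_self[OF smooth_atlas_G unit_chart_G] by metis
qed

lemma Ad_one: "Ad G \<one> X = X"
proof -
  have u: "unit_chart G \<in> atlas G" "\<one> \<in> fst uchart"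
    using unit_chart_G by (auto dest: charts_atD)
  have "Ad G \<one> = frechet_derivative (\<lambda>y. y) (at (origin))"
    unfolding Ad_eq_frechet
    by (rule frechet_derivative_cong[OF smooth_atlasD(2)[OF smooth_atlas_G u(1)]])
      (use u cinv_atlas[OF smooth_atlas_G u(1)] in auto)
  also have "\<dots> = (\<lambda>e. e)" by (rule frechet_derivative_eqI) simp
  finally show ?thesis by simp
qed

lemma Ad_inv: "Ad G (inv g) (Ad G g X) = X" "Ad G g (Ad G (inv g) X) = X"
  using Ad_mult[of "inv g" g X] Ad_mult[of g "inv g" X] Ad_one by simp_all

text \<open>In charts, \<open>Ad G g X\<close> is the partial derivative in \<open>h\<close>, at the
  unit element, of the smooth map (g, h) -> g h g^(-1), and partial derivatives of smooth maps are
  smooth.\<close>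

lemma smooth_Ad: "smooth_map_on (atlas G) UNIV vs_atlas (\<lambda>g. Ad G g X)"
  unfolding smooth_map_on_iff_open[OF smooth_atlas_G smooth_atlas_vs open_UNIV]
    smooth_map_open_vs_iff[OF smooth_atlas_G open_UNIV]
proof
  fix c assume c: "c \<in> atlas G"
  let ?e = "unit_chart G"
  have e: "?e \<in> atlas G" "\<one> \<in> fst ?e" using unit_chart_G by (auto dest: charts_atD)
  define e1 where "e1 = origin"
  define S where "S = (snd c ` fst c) \<times> (snd ?e ` fst ?e)"
  have S: "open S"
    unfolding S_def by (intro open_Times smooth_atlasD(2)[OF smooth_atlas_G] c e)
  define K where "K p = cinv c (fst p) \<otimes> cinv ?e (snd p) \<otimes> inv (cinv c (fst p))" for p
  define F where "F p = snd ?e (K p)" for p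
  \<comment> \<open>The points at which the conjugate stays in the domain of the unit chart. Since
    conjugation fixes the unit element, the whole slice over \<open>e1\<close> lies in this open
    set.\<close>
  define W where "W = S \<inter> K -` fst ?e"
  have vsfst: "smooth_map_on vs_atlas S vs_atlas (fst :: 'v \<times> 'v \<Rightarrow> 'v)"
    and vssnd: "smooth_map_on vs_atlas S vs_atlas (snd :: 'v \<times> 'v \<Rightarrow> 'v)"
    unfolding smooth_map_on_iff_open[OF smooth_atlas_vs smooth_atlas_vs S]
    by (intro smooth_map_open_bounded_linear[OF smooth_atlas_vs S _ smooth_map_open_ident[OF smooth_atlas_vs]]
        bounded_linear_fst bounded_linear_snd)+
  have cc: "smooth_map_on vs_atlas (snd d ` fst d) (atlas G) (cinv d)" if "d \<in> atlas G" for d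
    unfolding smooth_map_on_iff_open[OF smooth_atlas_vs smooth_atlas_G smooth_atlasD(2)[OF smooth_atlas_G that]]
    by (rule smooth_map_open_cinv[OF smooth_atlas_G that])
  have k1: "smooth_map_on vs_atlas S (atlas G) (\<lambda>p. cinv c (fst p))"
    by (rule smooth_map_on_compose[OF smooth_atlas_vs smooth_atlas_vs smooth_atlas_G _ vsfst cc[OF c]])
      (auto simp: S_def)
  have k2: "smooth_map_on vs_atlas S (atlas G) (\<lambda>p. cinv ?e (snd p))"
    by (rule smooth_map_on_compose[OF smooth_atlas_vs smooth_atlas_vs smooth_atlas_G _ vssnd cc[OF e(1)]])
      (auto simp: S_def)
  have "smooth_map_on vs_atlas S (atlas G) K"
    unfolding K_def
    by (intro smooth_map_on_mult[OF smooth_atlas_vs] smooth_map_on_inverse[OF smooth_atlas_vs] k1 k2)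
  then have K: "smooth_map_open vs_atlas S (atlas G) K"
    by (simp add: smooth_map_on_iff_open[OF smooth_atlas_vs smooth_atlas_G S])
  have W: "open W" unfolding W_def
    by (rule continuous_open_preimage[OF smooth_map_open_continuous[OF K] S smooth_atlasD(1)[OF smooth_atlas_G e(1)]])
  have F: "smooth_on W F"
    using smooth_map_openD[OF K _ e(1), of "(UNIV, \<lambda>x. x)"]
    by (simp add: vs_atlas_def cinv_vs o_def W_def F_def[abs_def] Int_def vimage_def)
  have inW: "(z, e1) \<in> W" if z: "z \<in> snd c ` fst c" for z
    using z e cinv_atlas[OF smooth_atlas_G e]
    by (auto simp: W_def S_def K_def e1_def)
  have Ad_F: "Ad G (cinv c z) X = frechet_derivative F (at (z, e1)) (0, X)" if z: "z \<in> snd c ` fst c" for z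
  proof -
    have Fd: "F differentiable (at (z, e1))" using F inW[OF z] by (rule smooth_on_imp_differentiable)
    have "((\<lambda>y. (z, y)) has_derivative (\<lambda>h. (0, h))) (at e1)"
      by (auto intro!: derivative_eq_intros)
    from has_derivative_compose[OF this, of F] Fd
    have "((\<lambda>y. F (z, y)) has_derivative (\<lambda>h. frechet_derivative F (at (z, e1)) (0, h))) (at e1)"
      unfolding frechet_derivative_works by blast
    then show ?thesis
      by (simp add: Ad_def Let_def F_def K_def e1_def[symmetric] frechet_derivative_eqI)
  qed
  have o: "open (snd c ` fst c)" by (rule smooth_atlasD(2)[OF smooth_atlas_G c])
  have "smooth_on (snd c ` fst c) (\<lambda>z. frechet_derivative F (at (z, e1)) (0, X))"
    by (rule smooth_on_compose[OF o W _ smooth_on_Pair[OF o smooth_on_ident smooth_on_const]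
          smooth_on_frechet_derivative[OF F]]) (use inW in auto)
  then have "smooth_on (snd c ` fst c) ((\<lambda>g. Ad G g X) \<circ> cinv c)"
    by (rule smooth_on_cong[OF o, rotated]) (simp add: Ad_F)
  then show "smooth_on (snd c ` (fst c \<inter> UNIV)) ((\<lambda>g. Ad G g X) \<circ> cinv c)" by simp
qed

text \<open>\<open>smooth_Ad\<close> concerns a fixed vector; a moving one is expanded in the basis,
  using linearity of \<open>Ad\<close>.\<close>

lemma smooth_Ad_apply:
  fixes A :: "('m::t2_space, 'e::real_normed_vector) chart set"
  assumes A: "smooth_atlas A" and V: "open V" and a: "smooth_map_on A V (atlas G) a"
    and w: "smooth_map_open A V vs_atlas w"
  shows "smooth_map_open A V vs_atlas (\<lambda>x. Ad G (a x) (w x))"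
  unfolding smooth_map_open_vs_iff[OF A V]
proof
  fix c assume c: "c \<in> A"
  have o: "open (snd c ` (fst c \<inter> V))" by (rule open_chart_image[OF A c V])
  have Ada: "smooth_map_open A V vs_atlas (\<lambda>x. Ad G (a x) b)" for b
    using smooth_map_on_compose[OF A smooth_atlas_G smooth_atlas_vs _ a smooth_Ad]
    unfolding smooth_map_on_iff_open[OF A smooth_atlas_vs V] by simp
  have "smooth_on (snd c ` (fst c \<inter> V)) (\<lambda>y. Ad G (a (cinv c y)) (w (cinv c y)))"
  proof (rule smooth_on_linear_expand[OF o, where L = "\<lambda>y. Ad G (a (cinv c y))"])
    show "linear (Ad G (a (cinv c y)))" for y by (rule linear_Ad)
    show "smooth_on (snd c ` (fst c \<inter> V)) (\<lambda>y. Ad G (a (cinv c y)) b)" for b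
      using Ada[of b] c unfolding smooth_map_open_vs_iff[OF A V] by (simp add: o_def)
    show "smooth_on (snd c ` (fst c \<inter> V)) (\<lambda>y. w (cinv c y))"
      using w c unfolding smooth_map_open_vs_iff[OF A V] by (simp add: o_def)
  qed
  then show "smooth_on (snd c ` (fst c \<inter> V)) ((\<lambda>x. Ad G (a x) (w x)) \<circ> cinv c)" by (simp add: o_def)
qed

lemma Ad_chart_differentiable:
  "(\<lambda>y. Ad G (cinv uchart y) Y) differentiable (at (origin))"
  using mdiff_vs_differentiable[OF smooth_map_on_imp_mdiff[OF smooth_atlas_G smooth_atlas_vs open_UNIV UNIV_I smooth_Ad] unit_chart_G]
  by (simp add: o_def)

lemma lie_bracket_linear_left: "linear (\<lambda>X. lie_bracket G X Y)"
  unfolding lie_bracket_def Let_def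
  using frechet_derivative_linear[OF Ad_chart_differentiable] by (simp add: eta_contract_eq)

text \<open>Linearity here comes from linearity of each \<open>Ad\<close> and uniqueness of
  derivatives. Together with \<open>lie_bracket_linear_left\<close> it supplies the bilinearity
  assumed in the nilradical argument.\<close>

lemma lie_bracket_linear_right: "linear (lie_bracket G X)"
proof (rule linearI)
  have D: "((\<lambda>y. Ad G (cinv uchart y) Y) has_derivative (\<lambda>X. lie_bracket G X Y)) (at (origin))" for Y
    using Ad_chart_differentiable[of Y] unfolding frechet_derivative_works lie_bracket_def Let_def by simp
  show "lie_bracket G X (Y + Z) = lie_bracket G X Y + lie_bracket G X Z" for Y Z
    using has_derivative_unique[OF D[of "Y + Z"]] has_derivative_add[OF D[of Y] D[of Z]]
    by (simp add: linear_add[OF linear_Ad] fun_eq_iff)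
  show "lie_bracket G X (r *\<^sub>R Y) = r *\<^sub>R lie_bracket G X Y" for r Y
    using has_derivative_unique[OF D[of "r *\<^sub>R Y"]] has_derivative_scaleR_right[OF D[of Y], of r]
    by (simp add: linear_cmul[OF linear_Ad] fun_eq_iff)
qed

section \<open>One-parameter subgroups\<close>

lemma one_param_subgroup_zero: "one_param_subgroup G X \<gamma> \<Longrightarrow> \<gamma> 0 = \<one>"
  unfolding one_param_subgroup_def using grp.r_cancel_one'[of "\<gamma> 0" "\<gamma> 0"]
  by (metis add.right_neutral in_carrier)

lemma one_param_subgroup_minus: "one_param_subgroup G X \<gamma> \<Longrightarrow> \<gamma> (- t) = inv \<gamma> t"
  using one_param_subgroup_zero[of X \<gamma>] unfolding one_param_subgroup_def
  by (metis add.left_inverse grp.inv_equality in_carrier)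

lemma one_param_subgroup_mdiff: "one_param_subgroup G X \<gamma> \<Longrightarrow> mdiff vs_atlas (atlas G) \<gamma> t"
  unfolding one_param_subgroup_def
  using smooth_map_on_imp_mdiff[OF smooth_atlas_vs smooth_atlas_G open_UNIV UNIV_I, of \<gamma> t] by blast

lemma one_param_subgroup_scale:
  assumes \<gamma>: "one_param_subgroup G X \<gamma>"
  shows "one_param_subgroup G (r *\<^sub>R X) (\<lambda>t. \<gamma> (r * t))"
  unfolding one_param_subgroup_def
proof (intro conjI allI)
  have lin: "smooth_map_on vs_atlas UNIV vs_atlas (\<lambda>t. r * t)"
    unfolding smooth_map_on_iff_open[OF smooth_atlas_vs smooth_atlas_vs open_UNIV]
    by (intro smooth_map_open_bounded_linear[OF smooth_atlas_vs open_UNIV _ smooth_map_open_ident[OF smooth_atlas_vs]]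
        bounded_linear_mult_right)
  have "smooth_map_on vs_atlas UNIV (atlas G) \<gamma>" using \<gamma> by (simp add: one_param_subgroup_def)
  from smooth_map_on_compose[OF smooth_atlas_vs smooth_atlas_vs smooth_atlas_G _ lin this]
  show sm: "smooth_map_on vs_atlas UNIV (atlas G) (\<lambda>t. \<gamma> (r * t))" by simp
  show "\<gamma> (r * (s + t)) = \<gamma> (r * s) \<otimes> \<gamma> (r * t)" for s t
    using \<gamma> by (simp add: one_param_subgroup_def distrib_left)
  have u: "unit_chart G \<in> charts_at (atlas G) (\<gamma> 0)"
    using one_param_subgroup_zero[OF \<gamma>] unit_chart_G by simp
  have "(snd uchart \<circ> \<gamma>) differentiable (at 0)"
    using one_param_subgroup_mdiff[OF \<gamma>, of 0] u by (simp add: mdiff_def charts_at_vs cinv_vs o_def)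
  moreover have "vector_derivative (snd uchart \<circ> \<gamma>) (at 0) = X"
    using \<gamma> u by (simp add: one_param_subgroup_def velocity_def)
  ultimately have "((snd uchart \<circ> \<gamma>) has_vector_derivative X) (at (r * 0))"
    using vector_derivative_works by force
  moreover have "((\<lambda>t. r * t) has_vector_derivative r) (at 0)"
    by (auto intro!: derivative_eq_intros)
  ultimately have "((snd uchart \<circ> \<gamma>) \<circ> (\<lambda>t. r * t) has_vector_derivative r *\<^sub>R X) (at 0)"
    by (intro vector_diff_chain_at)
  then have "vector_derivative (snd uchart \<circ> (\<lambda>t. \<gamma> (r * t))) (at 0) = r *\<^sub>R X"
    by (intro vector_derivative_at) (simp add: o_def)
  then show "velocity (atlas G) (\<lambda>t. \<gamma> (r * t)) 0 uchart = r *\<^sub>R X"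
    using u by (simp add: velocity_def)
qed

text \<open>\<open>exp_image\<close> collects points at time 1 only; the point at time
  \<open>t\<close> is the time-1 point of the rescaled subgroup generated by t X.\<close>

lemma one_param_subgroup_exp_image:
  assumes \<gamma>: "one_param_subgroup G X \<gamma>" and "X \<in> S" "subspace S"
  shows "\<gamma> t \<in> exp_image G S"
  unfolding exp_image_def
  using one_param_subgroup_scale[OF \<gamma>, of t] subspace_scale[OF assms(3,2), of t]
  by (intro CollectI exI[of _ "\<lambda>s. \<gamma> (t * s)"] exI[of _ "t *\<^sub>R X"]) simp

text \<open>A representation is smooth on \<open>Q\<close> in the sense of local extensions, so
  \<open>L\<close> is the derivative at the unit element of such an extension \<open>r\<close>. This
  yields linearity in X at once, which is not visible from individual one-parameter
  subgroups.\<close>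

lemma inf_rep_exists:
  fixes \<rho> :: "'g \<Rightarrow> 'w::real_normed_vector \<Rightarrow>\<^sub>L 'w"
  assumes \<rho>: "representation G Q \<rho>" and one: "\<one> \<in> Q"
  obtains L where "linear L"
    "\<And>X \<gamma>. one_param_subgroup G X \<gamma> \<Longrightarrow> range \<gamma> \<subseteq> Q \<Longrightarrow> ((\<lambda>t. \<rho> (\<gamma> t)) has_vector_derivative L X) (at 0)"
proof -
  have "smooth_map_on (atlas G) Q vs_atlas \<rho>" using \<rho> by (simp add: Defs.representation_def)
  then obtain V r where V: "open V" "\<one> \<in> V" "smooth_map_open (atlas G) V vs_atlas r" "\<forall>y\<in>Q \<inter> V. r y = \<rho> y"
    by (rule smooth_map_onE[OF _ one])
  have r: "mdiff (atlas G) vs_atlas r \<one>"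
    by (rule smooth_map_open_imp_mdiff[OF smooth_atlas_G smooth_atlas_vs V(1,2,3)])
  note rd = mdiff_vs_differentiable[OF r unit_chart_G]
  define L where "L = frechet_derivative (r \<circ> cinv uchart) (at (origin))"
  show thesis
  proof
    show "linear L" unfolding L_def using rd by (rule frechet_derivative_linear)
    fix X \<gamma> assume \<gamma>: "one_param_subgroup G X \<gamma>" "range \<gamma> \<subseteq> Q"
    have \<gamma>d: "mdiff vs_atlas (atlas G) \<gamma> 0" by (rule one_param_subgroup_mdiff[OF \<gamma>(1)])
    note z = one_param_subgroup_zero[OF \<gamma>(1)]
    have "((\<lambda>t. r (\<gamma> t)) has_vector_derivative tderiv (atlas G) r (\<gamma> 0) (velocity (atlas G) \<gamma> 0)) (at 0)"
      by (rule has_vector_derivative_along_curve[OF smooth_atlas_G \<gamma>d]) (simp add: z r)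
    also have "tderiv (atlas G) r (\<gamma> 0) (velocity (atlas G) \<gamma> 0) = L X"
      unfolding z L_def using \<gamma>(1) velocity_tangent_space[OF smooth_atlas_G \<gamma>d]
      by (subst tderiv_chart[OF smooth_atlas_G unit_chart_G rd]) (auto simp: z one_param_subgroup_def)
    finally have *: "((\<lambda>t. r (\<gamma> t)) has_vector_derivative L X) (at 0)" .
    \<comment> \<open>Continuity keeps the curve near time 0 in the open set where the extension
      agrees with \<open>\<rho>\<close> on \<open>Q\<close>.\<close>
    have "isCont \<gamma> 0" using \<gamma>d by (simp add: mdiff_def)
    then obtain T where T: "open T" "0 \<in> T" "\<forall>t\<in>T. \<gamma> t \<in> V"
      using V(1,2) z unfolding continuous_at_open by metis
    show "((\<lambda>t. \<rho> (\<gamma> t)) has_vector_derivative L X) (at 0)"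
      by (rule has_vector_derivative_transform_within_open[OF * T(1,2)]) (use T V \<gamma> in \<open>auto simp: image_subset_iff\<close>)
  qed
qed

end

section \<open>Nilradicals of nested parabolic subalgebras\<close>

lemma derived_series_mono: "A \<subseteq> B \<Longrightarrow> derived_series br A k \<subseteq> derived_series br B k"
proof (induction k)
  case (Suc k)
  then have "{br X Y | X Y. X \<in> derived_series br A k \<and> Y \<in> derived_series br A k}
      \<subseteq> {br X Y | X Y. X \<in> derived_series br B k \<and> Y \<in> derived_series br B k}" by blast
  then show ?case by (simp add: span_mono)
qed simp

lemma derived_series_add: "derived_series br A (k + m) = derived_series br (derived_series br A k) m"
  by (induction m) simp_all

lemma subspace_derived_series: "subspace A \<Longrightarrow> subspace (derived_series br A k)"
  by (cases k) (simp_all add: subspace_span)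

lemma derived_series_subset:
  assumes "lie_subalgebra br A"
  shows "derived_series br A k \<subseteq> A"
proof (induction k)
  case (Suc k)
  have "{br X Y | X Y. X \<in> derived_series br A k \<and> Y \<in> derived_series br A k} \<subseteq> A"
    using Suc assms unfolding lie_subalgebra_def by blast
  then show ?case using assms by (simp add: span_minimal lie_subalgebra_def)
qed simp

lemma lie_ideal_subalgebra: "lie_ideal br N S \<Longrightarrow> lie_subalgebra br N"
  unfolding lie_ideal_def lie_subalgebra_def by blast

lemma lie_nilpotent_imp_solvable:
  assumes N: "lie_subalgebra br N" and nil: "lie_nilpotent br N"
  shows "lie_solvable br N"
proof -
  have sub: "derived_series br N k \<subseteq> lower_central_series br N k" for k
  proof (induction k)
    case (Suc k)
    then have "{br X Y | X Y. X \<in> derived_series br N k \<and> Y \<in> derived_series br N k}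
      \<subseteq> {br X Y | X Y. X \<in> N \<and> Y \<in> lower_central_series br N k}"
      using derived_series_subset[OF N, of k] by blast
    then show ?case by (simp add: span_mono)
  qed simp
  obtain k where "lower_central_series br N k = {0}" using nil unfolding lie_nilpotent_def by blast
  moreover have "0 \<in> derived_series br N k"
    using N by (intro subspace_0 subspace_derived_series) (simp add: lie_subalgebra_def)
  ultimately have "derived_series br N k = {0}" using sub[of k] by blast
  then show ?thesis unfolding lie_solvable_def by blast
qed

context
  fixes br :: "'a::real_vector \<Rightarrow> 'a \<Rightarrow> 'a"
  assumes bil: "\<And>Y. linear (\<lambda>X. br X Y)" "\<And>X. linear (br X)"
begin

text \<open>Modulo \<open>N\<close> the derived series of N + b is that of \<open>b\<close>. It
  therefore reaches \<open>N\<close> after as many steps as \<open>b\<close> needs to vanish, and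
  from there dies with the derived series of \<open>N\<close>.\<close>

lemma solvable_ideal_add:
  assumes b: "lie_subalgebra br b" "b \<subseteq> S" "lie_solvable br b"
    and N: "lie_ideal br N S" "lie_solvable br N"
  shows "lie_subalgebra br {x + y | x y. x \<in> N \<and> y \<in> b} \<and> lie_solvable br {x + y | x y. x \<in> N \<and> y \<in> b}"
proof
  let ?M = "{x + y | x y. x \<in> N \<and> y \<in> b}"
  have exp: "br (x + y) (x' + y') = (br x x' + br x y' + br y x') + br y y'" for x y x' y'
    using linear_add[OF bil(1)] linear_add[OF bil(2)] by (simp add: algebra_simps)
  have NS: "subspace N" "N \<subseteq> S" "\<And>X Y. X \<in> S \<Longrightarrow> Y \<in> N \<Longrightarrow> br X Y \<in> N" "\<And>X Y. X \<in> S \<Longrightarrow> Y \<in> N \<Longrightarrow> br Y X \<in> N"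
    using N(1) unfolding lie_ideal_def by auto
  have sb: "subspace b" using b(1) by (simp add: lie_subalgebra_def)
  have first: "br x x' + br x y' + br y x' \<in> N" if "x \<in> N" "x' \<in> N" "y \<in> b" "y' \<in> b" for x x' y y'
    using that NS b(2) by (intro subspace_add) auto
  have sM: "subspace ?M" using subspace_sums[OF NS(1) sb] by simp
  show M: "lie_subalgebra br ?M"
    unfolding lie_subalgebra_def
  proof (intro conjI ballI sM)
    fix X Y assume "X \<in> ?M" "Y \<in> ?M"
    then obtain x y x' y' where *: "X = x + y" "Y = x' + y'" "x \<in> N" "x' \<in> N" "y \<in> b" "y' \<in> b" by blast
    then have "br y y' \<in> b" using b(1) unfolding lie_subalgebra_def by blast
    then show "br X Y \<in> ?M" using first[OF *(3-6)] exp[of x y x' y'] * by blast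
  qed
  have step: "derived_series br ?M k \<subseteq> {x + y | x y. x \<in> N \<and> y \<in> derived_series br b k}" for k
  proof (induction k)
    case (Suc k)
    let ?R = "{x + y | x y. x \<in> N \<and> y \<in> derived_series br b (Suc k)}"
    have "{br X Y | X Y. X \<in> derived_series br ?M k \<and> Y \<in> derived_series br ?M k} \<subseteq> ?R"
    proof
      fix Z assume "Z \<in> {br X Y | X Y. X \<in> derived_series br ?M k \<and> Y \<in> derived_series br ?M k}"
      then obtain X Y where XY: "Z = br X Y" "X \<in> derived_series br ?M k" "Y \<in> derived_series br ?M k" by blast
      then obtain x y x' y' where *: "X = x + y" "Y = x' + y'" "x \<in> N" "x' \<in> N"
        "y \<in> derived_series br b k" "y' \<in> derived_series br b k"
        using Suc by blast
      then have "br y y' \<in> derived_series br b (Suc k)" by (auto intro: span_base)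
      moreover have "br x x' + br x y' + br y x' \<in> N"
        using * derived_series_subset[OF b(1)] by (intro first) blast+
      ultimately show "Z \<in> ?R" using exp[of x y x' y'] * XY(1) by blast
    qed
    moreover have "subspace ?R" using subspace_sums[OF NS(1) subspace_derived_series[OF sb]] by blast
    ultimately show ?case unfolding derived_series.simps(2)[of br ?M k] by (rule span_minimal)
  qed simp
  obtain k where k: "derived_series br b k = {0}" using b(3) unfolding lie_solvable_def by blast
  obtain m where m: "derived_series br N m = {0}" using N(2) unfolding lie_solvable_def by blast
  have "derived_series br ?M k \<subseteq> N" using step[of k] k by auto
  then have "derived_series br ?M (k + m) \<subseteq> {0}"
    using derived_series_mono[of "derived_series br ?M k" N br m] m by (simp add: derived_series_add)
  moreover have "0 \<in> derived_series br ?M (k + m)" by (intro subspace_0 subspace_derived_series sM)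
  ultimately have "derived_series br ?M (k + m) = {0}" by blast
  then show "lie_solvable br ?M" unfolding lie_solvable_def by blast
qed

text \<open>Borel subalgebras are maximal among complex solvable subalgebras, whereas the ideals in
  \<open>nilradical\<close> need not be stable under \<open>J\<close>. Hence J N, again a solvable
  ideal, is added as well, so that J N + N + b is complex.\<close>

lemma nilradical_subset_complex_parabolic:
  assumes J: "linear J" "\<And>X. J (J X) = - X" "\<And>X Y. br (J X) Y = J (br X Y)" "\<And>X Y. br X (J Y) = J (br X Y)"
    and q: "complex_parabolic br J q" and p: "complex_parabolic br J p" and qp: "q \<subseteq> p"
  shows "nilradical br p \<subseteq> q"
proof -
  obtain b where b: "borel_subalgebra br J b" "b \<subseteq> q" using q unfolding complex_parabolic_def by blast
  have b': "lie_subalgebra br b" "\<forall>X\<in>b. J X \<in> b" "lie_solvable br b" and sb: "subspace b"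
    using b(1) unfolding borel_subalgebra_def complex_solvable_subalgebra_def lie_subalgebra_def by auto
  have sp: "subspace p" and sq: "subspace q" using p q by (simp_all add: complex_parabolic_def lie_subalgebra_def)
  have Jp: "J X \<in> p" if "X \<in> p" for X using p that by (simp add: complex_parabolic_def)
  have "N \<subseteq> q" if N: "lie_ideal br N p" "lie_nilpotent br N" for N
  proof -
    have sN: "lie_subalgebra br N" by (rule lie_ideal_subalgebra[OF N(1)])
    have solN: "lie_solvable br N" by (rule lie_nilpotent_imp_solvable[OF sN N(2)])
    have NN: "subspace N" "N \<subseteq> p" "\<And>X Y. X \<in> p \<Longrightarrow> Y \<in> N \<Longrightarrow> br X Y \<in> N" "\<And>X Y. X \<in> p \<Longrightarrow> Y \<in> N \<Longrightarrow> br Y X \<in> N"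
      using N(1) unfolding lie_ideal_def by auto
    have JN: "lie_ideal br (J ` N) p"
      unfolding lie_ideal_def using NN J Jp by (auto intro!: linear_subspace_image)
    \<comment> \<open>The comparison starts at the first derived algebra: J N need not lie in
      \<open>N\<close>, but [J X, J Y] = - [X, Y].\<close>
    have "derived_series br (J ` N) (Suc 0 + m) \<subseteq> derived_series br N (Suc 0 + m)" for m
    proof -
      have s1: "subspace (derived_series br N (Suc 0))" by (rule subspace_derived_series[OF NN(1)])
      have "br (J X) (J Y) \<in> derived_series br N (Suc 0)" if "X \<in> N" "Y \<in> N" for X Y
      proof -
        have "br X Y \<in> derived_series br N (Suc 0)" using that by (auto intro: span_base)
        then have "- br X Y \<in> derived_series br N (Suc 0)" by (rule subspace_neg[OF s1])
        then show ?thesis by (simp only: J(2,3,4))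
      qed
      then have gen: "{br X Y | X Y. X \<in> J ` N \<and> Y \<in> J ` N} \<subseteq> derived_series br N (Suc 0)" by blast
      have "derived_series br (J ` N) (Suc 0) \<subseteq> derived_series br N (Suc 0)"
        unfolding derived_series.simps(2)[of br "J ` N" 0] derived_series.simps(1)[of br "J ` N"]
        by (rule span_minimal[OF gen s1])
      then show ?thesis unfolding derived_series_add by (rule derived_series_mono)
    qed
    moreover obtain k where k: "derived_series br N k = {0}" using solN unfolding lie_solvable_def by blast
    \<comment> \<open>One step beyond \<open>k\<close>, to match the shift by \<open>Suc 0\<close>;
      the series stays at {0}.\<close>
    moreover have "derived_series br N (Suc 0 + k) \<subseteq> {0}"
      using k linear_0[OF bil(2)[of 0]] by simp
    moreover have "0 \<in> derived_series br (J ` N) (Suc 0 + k)"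
      using JN by (intro subspace_0 subspace_derived_series) (simp add: lie_ideal_def)
    ultimately have "derived_series br (J ` N) (Suc 0 + k) = {0}" by blast
    then have solJN: "lie_solvable br (J ` N)" unfolding lie_solvable_def by blast
    let ?M1 = "{x + y | x y. x \<in> N \<and> y \<in> b}"
    let ?M = "{x + y | x y. x \<in> J ` N \<and> y \<in> ?M1}"
    have bp: "b \<subseteq> p" using b(2) qp by blast
    note M1 = solvable_ideal_add[OF b'(1) bp b'(3) N(1) solN]
    have "?M1 \<subseteq> p" using NN(2) bp by (auto intro!: subspace_add[OF sp])
    note M = solvable_ideal_add[OF M1[THEN conjunct1] this M1[THEN conjunct2] JN solJN]
    have "\<forall>Z\<in>?M. J Z \<in> ?M"
    proof
      fix Z assume "Z \<in> ?M"
      then obtain n n' y where Z: "Z = J n + (n' + y)" "n \<in> N" "n' \<in> N" "y \<in> b" by blast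
      have "J Z = J n' + (- n + J y)" using J(2) by (simp add: Z(1) linear_add[OF J(1)])
      moreover have "- n \<in> N" using Z(2) by (rule subspace_neg[OF NN(1)])
      ultimately show "J Z \<in> ?M" using Z(3,4) b'(2) by blast
    qed
    with M have "complex_solvable_subalgebra br J ?M" by (simp add: complex_solvable_subalgebra_def)
    moreover have sum: "n + y \<in> ?M" if "n \<in> N" "y \<in> b" for n y
    proof -
      have "n + y = J 0 + (n + y)" by (simp add: linear_0[OF J(1)])
      then show ?thesis using that subspace_0[OF NN(1)] by blast
    qed
    have "b \<subseteq> ?M" using sum[OF subspace_0[OF NN(1)]] by auto
    \<comment> \<open>Maximality of the Borel subalgebra: the complex solvable subalgebra
      \<open>?M\<close> contains \<open>b\<close> and so equals it, which forces \<open>N\<close>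
      into \<open>b\<close>.\<close>
    ultimately have Mb: "?M = b" using b(1) unfolding borel_subalgebra_def by simp
    have "n \<in> ?M" if "n \<in> N" for n using sum[OF that subspace_0[OF sb]] by simp
    then show ?thesis unfolding Mb using b(2) by blast
  qed
  then show ?thesis unfolding nilradical_def using sq by (intro span_minimal) auto
qed

lemma complexified_bracket_linear:
  "linear (\<lambda>X. complexified_bracket br X Y)" "linear (complexified_bracket br X)"
  by (rule linearI; simp add: complexified_bracket_def linear_add[OF bil(1)] linear_add[OF bil(2)]
      linear_cmul[OF bil(1)] linear_cmul[OF bil(2)] scaleR_diff_right scaleR_add_right)+

end

text \<open>\<open>real_parabolic\<close> speaks of the complexification S \<times> S only; this
  recovers the corresponding property of \<open>S\<close> itself.\<close>

lemma subspace_Times_self: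
  assumes "subspace (S \<times> S)"
  shows "subspace S"
  unfolding subspace_def
proof (intro conjI ballI allI)
  have "(0, 0) \<in> S \<times> S" using subspace_0[OF assms] by (simp add: zero_prod_def)
  then show 0: "0 \<in> S" by simp
  show "x + y \<in> S" if "x \<in> S" "y \<in> S" for x y
    using subspace_add[OF assms, of "(x, 0)" "(y, 0)"] that 0 by simp
  show "c *\<^sub>R x \<in> S" if "x \<in> S" for c x
    using subspace_scale[OF assms, of "(x, 0)" c] that 0 by simp
qed

lemma complex_parabolic_subspace: "complex_parabolic br J S \<Longrightarrow> subspace S"
  by (simp add: complex_parabolic_def lie_subalgebra_def)

lemma real_parabolic_subspace: "real_parabolic br S \<Longrightarrow> subspace S"
  unfolding real_parabolic_def by (rule subspace_Times_self) (rule complex_parabolic_subspace)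

text \<open>The complexification N \<times> N of a nilpotent ideal of \<open>p\<close> is a
  nilpotent ideal of p \<times> p, so the complex case places it in q \<times> q.\<close>

lemma nilradical_subset_real_parabolic:
  fixes br :: "'a::real_vector \<Rightarrow> 'a \<Rightarrow> 'a"
  assumes bil: "\<And>Y. linear (\<lambda>X. br X Y)" "\<And>X. linear (br X)"
    and q: "real_parabolic br q" and p: "real_parabolic br p" and qp: "q \<subseteq> p"
  shows "nilradical br p \<subseteq> q"
proof -
  let ?cb = "complexified_bracket br" and ?J = "\<lambda>X :: 'a \<times> 'a. (- snd X, fst X)"
  have "nilradical ?cb (p \<times> p) \<subseteq> q \<times> q"
  proof (rule nilradical_subset_complex_parabolic[OF complexified_bracket_linear[OF bil], where J = ?J])
    show "linear ?J" by (auto intro!: linearI)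
    show "?cb (?J X) Y = ?J (?cb X Y)" "?cb X (?J Y) = ?J (?cb X Y)" for X Y
      using linear_neg[OF bil(1)] linear_neg[OF bil(2)] by (auto simp: complexified_bracket_def)
  qed (use q p qp in \<open>auto simp: real_parabolic_def\<close>)
  moreover have "N \<times> N \<subseteq> nilradical ?cb (p \<times> p)" if N: "lie_ideal br N p" "lie_nilpotent br N" for N
  proof -
    have NN: "subspace N" "N \<subseteq> p" "\<And>X Y. X \<in> p \<Longrightarrow> Y \<in> N \<Longrightarrow> br X Y \<in> N" "\<And>X Y. X \<in> p \<Longrightarrow> Y \<in> N \<Longrightarrow> br Y X \<in> N"
      using N(1) unfolding lie_ideal_def by auto
    have ideal: "lie_ideal ?cb (N \<times> N) (p \<times> p)"
      unfolding lie_ideal_def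
    proof (intro conjI ballI)
      show "subspace (N \<times> N)" using NN(1) by (simp add: subspace_Times)
      show "N \<times> N \<subseteq> p \<times> p" using NN(2) by blast
      fix X Y assume "X \<in> p \<times> p" "Y \<in> N \<times> N"
      then have XY: "fst X \<in> p" "snd X \<in> p" "fst Y \<in> N" "snd Y \<in> N" by auto
      show "?cb X Y \<in> N \<times> N" "?cb Y X \<in> N \<times> N"
        unfolding complexified_bracket_def
        by (intro SigmaI subspace_add[OF NN(1)] subspace_diff[OF NN(1)] NN(3,4) XY)+
    qed
    have sL: "subspace (lower_central_series br N k)" for k using NN(1) by (cases k) auto
    have sub: "lower_central_series ?cb (N \<times> N) k \<subseteq> lower_central_series br N k \<times> lower_central_series br N k" for k
    proof (induction k)
      case (Suc k)
      let ?D = "lower_central_series br N (Suc k)"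
      have br: "br X Y \<in> ?D" if "X \<in> N" "Y \<in> lower_central_series br N k" for X Y
        using that by (auto intro: span_base)
      have "?cb X Y \<in> ?D \<times> ?D" if "X \<in> N \<times> N" "Y \<in> lower_central_series ?cb (N \<times> N) k" for X Y
      proof -
        have "fst X \<in> N" "snd X \<in> N"
          "fst Y \<in> lower_central_series br N k" "snd Y \<in> lower_central_series br N k"
          using Suc that by auto
        then show ?thesis
          unfolding complexified_bracket_def
          by (intro SigmaI subspace_add[OF sL] subspace_diff[OF sL] br)
      qed
      then have "{?cb X Y | X Y. X \<in> N \<times> N \<and> Y \<in> lower_central_series ?cb (N \<times> N) k} \<subseteq> ?D \<times> ?D" by blast
      moreover have "subspace (?D \<times> ?D)" by (rule subspace_Times[OF sL sL])
      ultimately show ?case unfolding lower_central_series.simps(2)[of ?cb "N \<times> N" k] by (rule span_minimal)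
    qed simp
    obtain k where k: "lower_central_series br N k = {0}" using N(2) unfolding lie_nilpotent_def by blast
    have "0 \<in> lower_central_series ?cb (N \<times> N) k"
      using NN(1) by (cases k) (auto simp: subspace_Times subspace_0 span_zero)
    then have "lower_central_series ?cb (N \<times> N) k = {0}" using sub[of k] k by (auto simp: zero_prod_def)
    then have "lie_nilpotent ?cb (N \<times> N)" unfolding lie_nilpotent_def by blast
    with ideal have "N \<times> N \<subseteq> \<Union>{N. lie_ideal ?cb N (p \<times> p) \<and> lie_nilpotent ?cb N}" by blast
    then show ?thesis unfolding nilradical_def using span_superset by (rule subset_trans)
  qed
  ultimately have "N \<times> N \<subseteq> q \<times> q" if "lie_ideal br N p" "lie_nilpotent br N" for N
    using that by (meson subset_trans)
  then have "N \<subseteq> q" if "lie_ideal br N p" "lie_nilpotent br N" for N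
    using that by blast
  then show ?thesis
    unfolding nilradical_def using real_parabolic_subspace[OF q] by (intro span_minimal) auto
qed

lemma (in Lie_group) nested_parabolics_nilradical:
  assumes np: "nested_parabolics G qq pp"
  shows "nilradical (lie_bracket G) pp \<subseteq> qq"
proof -
  note bil = lie_bracket_linear_left lie_bracket_linear_right
  have qp: "qq \<subseteq> pp" using np by (simp add: nested_parabolics_def)
  consider "real_parabolic (lie_bracket G) qq" "real_parabolic (lie_bracket G) pp" |
    J where "complex_lie_structure G J" "complex_parabolic (lie_bracket G) J qq" "complex_parabolic (lie_bracket G) J pp"
    using np unfolding nested_parabolics_def by blast
  then show ?thesis
  proof cases
    case 1
    then show ?thesis by (rule nilradical_subset_real_parabolic[OF bil _ _ qp])
  next
    case 2
    then show ?thesis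
      by (intro nilradical_subset_complex_parabolic[OF bil, where J = J] qp)
        (auto simp: complex_lie_structure_def)
  qed
qed

lemma nested_parabolics_subspace:
  assumes "nested_parabolics G qq pp"
  shows "subspace qq" "subspace pp"
  using assms unfolding nested_parabolics_def
  by (auto intro: complex_parabolic_subspace real_parabolic_subspace)

section \<open>Lifting sections of quotient bundles\<close>

text \<open>Extension by zero from the chart is smooth because \<open>K\<close>, the image of a
  closed ball, is compact and hence closed in a Hausdorff space: the chart domain and the complement
  of \<open>K\<close> are open, cover everything, and carry smooth expressions for
  \<open>h\<close>.\<close>

lemma manifold_bump:
  fixes A :: "('m::t2_space, 'e::{real_inner,heine_borel}) chart set"
  assumes A: "smooth_atlas A" and U: "open U" "x \<in> U"
  obtains h :: "'m \<Rightarrow> real" and N K where "smooth_map_open A UNIV vs_atlas h" "open N" "x \<in> N"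
    "\<And>y. y \<in> N \<Longrightarrow> h y = 1" "closed K" "K \<subseteq> U" "\<And>y. y \<notin> K \<Longrightarrow> h y = 0"
proof -
  obtain c where c': "c \<in> charts_at A x" using charts_at_nonempty[OF A] by blast
  then have c: "c \<in> A" "x \<in> fst c" by (auto dest: charts_atD)
  note cc = smooth_atlasD[OF A c(1)]
  have "open (snd c ` (fst c \<inter> U))" by (rule open_chart_image[OF A c(1) U(1)])
  moreover have "snd c x \<in> snd c ` (fst c \<inter> U)" using c U by blast
  ultimately obtain R where R: "R > 0" "cball (snd c x) R \<subseteq> snd c ` (fst c \<inter> U)"
    using open_contains_cball by metis
  obtain \<psi> :: "'e \<Rightarrow> real" where \<psi>: "smooth_on UNIV \<psi>" "\<And>y. dist (snd c x) y \<le> R / 2 \<Longrightarrow> \<psi> y = 1"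
    "\<And>y. R \<le> dist (snd c x) y \<Longrightarrow> \<psi> y = 0"
    using bump_function[of "R / 2" R "snd c x"] R(1) by auto
  define h where "h y = (if y \<in> fst c then \<psi> (snd c y) else 0)" for y
  define K where "K = cinv c ` cball (snd c x) R"
  define N where "N = fst c \<inter> snd c -` ball (snd c x) (R / 2)"
  have KU: "K \<subseteq> fst c \<inter> U"
  proof
    fix y assume "y \<in> K"
    then obtain z where z: "z \<in> cball (snd c x) R" "y = cinv c z" by (auto simp: K_def)
    then obtain w where "w \<in> fst c \<inter> U" "z = snd c w" using R(2) by blast
    then show "y \<in> fst c \<inter> U" using z cinv_atlas[OF A c(1)] by auto
  qed
  have "cball (snd c x) R \<subseteq> snd c ` fst c" using R(2) by blast
  then have "compact K" unfolding K_def
    by (intro compact_continuous_image continuous_on_subset[OF cc(5)] compact_cball)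
  then have K: "closed K" by (rule compact_imp_closed)
  have h0: "h y = 0" if "y \<notin> K" for y
  proof (cases "y \<in> fst c")
    case True
    then have "snd c y \<notin> cball (snd c x) R"
      using that cinv_atlas[OF A c(1) True] unfolding K_def by (metis imageI)
    then show ?thesis using \<psi>(3)[of "snd c y"] by (simp add: h_def)
  qed (simp add: h_def)
  have chart: "smooth_map_open A (fst c) vs_atlas (snd c)"
    unfolding smooth_map_open_vs_iff[OF A cc(1)]
    using smooth_atlas_transition[OF A _ c(1)] by blast
  have "smooth_map_open vs_atlas UNIV vs_atlas \<psi>"
    unfolding smooth_map_open_vs_iff[OF smooth_atlas_vs open_UNIV]
    using \<psi>(1) by (simp add: vs_atlas_def cinv_vs o_def)
  from smooth_map_open_compose[OF A smooth_atlas_vs smooth_atlas_vs cc(1) open_UNIV subset_UNIV chart this]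
  have h1: "smooth_map_open A (fst c) vs_atlas h"
    by (rule smooth_map_open_cong[OF A smooth_atlas_vs cc(1), rotated]) (simp add: h_def)
  have h2: "smooth_map_open A (- K) vs_atlas h"
    by (rule smooth_map_open_cong[OF A smooth_atlas_vs _ _ smooth_map_open_const[of A "- K" vs_atlas 0]])
      (use K h0 in auto)
  have "smooth_map_open A UNIV vs_atlas h"
  proof (rule smooth_map_open_local[OF A smooth_atlas_vs open_UNIV])
    fix y
    show "\<exists>W. open W \<and> y \<in> W \<and> smooth_map_open A W vs_atlas h"
    proof (cases "y \<in> K")
      case True
      then show ?thesis using h1 cc(1) KU by blast
    next
      case False
      then show ?thesis using h2 K by (intro exI[of _ "- K"]) auto
    qed
  qed
  moreover have "open N" unfolding N_def by (rule continuous_open_preimage[OF cc(4,1) open_ball])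
  moreover have "x \<in> N" using c R(1) by (simp add: N_def)
  moreover have "h y = 1" if "y \<in> N" for y using that \<psi>(2)[of "snd c y"] by (simp add: N_def h_def)
  ultimately show thesis using K KU h0 by (intro that[of h N K]) auto
qed

section \<open>Local sections and fibres of a principal bundle\<close>

lemma principal_bundleD:
  assumes "principal_bundle G Q C"
  shows "smooth_atlas (tot_atlas C)" "smooth_atlas (base_atlas C)"
    "smooth_map_on (tot_atlas C) UNIV (base_atlas C) (proj C)"
    "smooth_map_on (prod_atlas (tot_atlas C) (atlas G)) (UNIV \<times> Q) (tot_atlas C) (\<lambda>(u, g). act C u g)"
    "\<And>u. act C u \<one>\<^bsub>G\<^esub> = u"
    "\<And>u g h. g \<in> Q \<Longrightarrow> h \<in> Q \<Longrightarrow> act C u (g \<otimes>\<^bsub>G\<^esub> h) = act C (act C u g) h"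
    "\<And>u g. g \<in> Q \<Longrightarrow> proj C (act C u g) = proj C u"
  using assms unfolding principal_bundle_def by auto

locale Principal_bundle = Lie_group G
  for G :: "('g::t2_space, 'v::{real_inner,heine_borel}) lie_grp" (structure) +
  fixes Q :: "'g set"
    and C :: "('b::t2_space, 'h::{real_inner,heine_borel}, 'm::{t2_space,second_countable_topology},
      'e::{real_inner,heine_borel}, 'g, 'v) cartan_geom"
  assumes Q: "subgroup Q G" and principal: "principal_bundle G Q C"
begin

abbreviation (input) "tot \<equiv> tot_atlas C"
abbreviation (input) "base \<equiv> base_atlas C"
abbreviation (input) "smooth_tot F \<equiv> smooth_map_on (tot_atlas C) UNIV vs_atlas F"

lemmas pbD = principal_bundleD[OF principal]
lemmas smooth_tot_iff = smooth_map_on_iff_open[OF pbD(1) smooth_atlas_vs open_UNIV]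

lemma smooth_act_right:
  assumes "g \<in> Q"
  shows "smooth_map_on tot UNIV tot (\<lambda>u. act C u g)"
  using smooth_map_on_compose[OF pbD(1) smooth_atlas_prod[OF pbD(1) smooth_atlas_G] pbD(1) _
      smooth_map_on_Pair[OF pbD(1) pbD(1) smooth_atlas_G smooth_map_on_ident[OF pbD(1)] smooth_map_on_const[of _ _ _ g]]
      pbD(4)] assms by auto

lemma smooth_act_curve:
  assumes "smooth_map_on vs_atlas UNIV (atlas G) \<gamma>" "range \<gamma> \<subseteq> Q"
  shows "smooth_map_on vs_atlas UNIV tot (\<lambda>t::real. act C u (\<gamma> t))"
  using smooth_map_on_compose[OF smooth_atlas_vs smooth_atlas_prod[OF pbD(1) smooth_atlas_G] pbD(1) _
      smooth_map_on_Pair[OF smooth_atlas_vs pbD(1) smooth_atlas_G smooth_map_on_const[of _ _ _ u] assms(1)]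
      pbD(4)] assms(2) by auto

text \<open>The section \<open>e\<close> is the slice of the trivialization over the unit
  element.\<close>

lemma local_section:
  obtains U \<kappa> e where "open U" "x \<in> U" "smooth_map_on tot (proj C -` U) (atlas G) \<kappa>"
    "smooth_map_on base U tot e"
    "\<And>y. y \<in> U \<Longrightarrow> proj C (e y) = y"
    "\<And>u. proj C u \<in> U \<Longrightarrow> \<kappa> u \<in> Q \<and> act C (e (proj C u)) (\<kappa> u) = u"
    "\<And>u g. proj C u \<in> U \<Longrightarrow> g \<in> Q \<Longrightarrow> \<kappa> (act C u g) = \<kappa> u \<otimes> g"
proof -
  have "\<exists>U \<kappa> \<tau>. open U \<and> x \<in> U \<and>
        smooth_map_on tot (proj C -` U) (atlas G) \<kappa> \<and>
        smooth_map_on (prod_atlas base (atlas G)) (U \<times> Q) tot \<tau> \<and>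
        (\<forall>u\<in>proj C -` U. \<kappa> u \<in> Q \<and> \<tau> (proj C u, \<kappa> u) = u \<and>
           (\<forall>g\<in>Q. \<kappa> (act C u g) = \<kappa> u \<otimes> g)) \<and>
        (\<forall>y\<in>U. \<forall>g\<in>Q. proj C (\<tau> (y, g)) = y \<and> \<kappa> (\<tau> (y, g)) = g)"
    using principal unfolding principal_bundle_def by (elim conjE) (rule spec)
  then obtain U \<kappa> \<tau> where U: "open U" "x \<in> U"
    and k: "smooth_map_on tot (proj C -` U) (atlas G) \<kappa>"
    and t: "smooth_map_on (prod_atlas base (atlas G)) (U \<times> Q) tot \<tau>"
    and 1: "\<forall>u\<in>proj C -` U. \<kappa> u \<in> Q \<and> \<tau> (proj C u, \<kappa> u) = u \<and>
           (\<forall>g\<in>Q. \<kappa> (act C u g) = \<kappa> u \<otimes> g)"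
    and 2: "\<forall>y\<in>U. \<forall>g\<in>Q. proj C (\<tau> (y, g)) = y \<and> \<kappa> (\<tau> (y, g)) = g"
    by (elim exE conjE)
  define e where "e y = \<tau> (y, \<one>)" for y
  have one: "\<one> \<in> Q" using Q by (rule subgroup.one_closed)
  have e: "smooth_map_on base U tot e"
    unfolding e_def
    by (rule smooth_map_on_compose[OF pbD(2) smooth_atlas_prod[OF pbD(2) smooth_atlas_G] pbD(1) _
      smooth_map_on_Pair[OF pbD(2) pbD(2) smooth_atlas_G smooth_map_on_ident[OF pbD(2)] smooth_map_on_const[of _ _ _ "\<one>"]] t])
      (use one in auto)
  have pe: "proj C (e y) = y" "\<kappa> (e y) = \<one>" if "y \<in> U" for y using 2 one that by (auto simp: e_def)
  have "act C (e (proj C u)) (\<kappa> u) = u" if u: "proj C u \<in> U" for u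
  proof -
    have ku: "\<kappa> u \<in> Q" "\<tau> (proj C u, \<kappa> u) = u" using 1 u by auto
    \<comment> \<open>Both points have the same image under the trivialization: the projection is
      invariant, and \<open>\<kappa>\<close> is equivariant with value \<one> along
      \<open>e\<close>.\<close>
    define u' where "u' = act C (e (proj C u)) (\<kappa> u)"
    have "proj C (e (proj C u)) \<in> U" using pe(1)[OF u] u by simp
    then have "\<kappa> u' = \<kappa> u" using 1 ku pe(2)[OF u] in_carrier[of "\<kappa> u"] by (simp add: u'_def)
    moreover have "proj C u' = proj C u" using pbD(7)[OF ku(1)] pe(1)[OF u] by (simp add: u'_def)
    ultimately have "\<tau> (proj C u, \<kappa> u) = u'" using 1 u by (metis vimageI)
    then show ?thesis using ku u'_def by simp
  qed
  then show thesis using 1 pe by (intro that[OF U k e]) auto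
qed

text \<open>Transitivity on fibres comes from a trivialization: both points are translates of the
  same point of a local section, by \<open>\<kappa> u\<close> and
  \<open>\<kappa> u'\<close>.\<close>

lemma fibre_transitive:
  assumes "proj C u = proj C u'"
  obtains g where "g \<in> Q" "u' = act C u g"
proof -
  obtain U \<kappa> e where U: "open U" "proj C u \<in> U"
    and k: "\<And>u. proj C u \<in> U \<Longrightarrow> \<kappa> u \<in> Q \<and> act C (e (proj C u)) (\<kappa> u) = u"
    using local_section[of "proj C u"] by metis
  have k1: "\<kappa> u \<in> Q" "act C (e (proj C u)) (\<kappa> u) = u" and k2: "\<kappa> u' \<in> Q" "act C (e (proj C u)) (\<kappa> u') = u'"
    using k[of u] k[of u'] U assms by auto
  have g: "inv \<kappa> u \<in> Q" using Q k1 by (simp add: subgroup.m_inv_closed)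
  then have g': "inv \<kappa> u \<otimes> \<kappa> u' \<in> Q" using Q k2 by (simp add: subgroup.m_closed)
  have "act C u (inv \<kappa> u \<otimes> \<kappa> u') = act C (act C (e (proj C u)) (\<kappa> u)) (inv \<kappa> u \<otimes> \<kappa> u')"
    using k1 by simp
  also have "\<dots> = act C (e (proj C u)) (\<kappa> u \<otimes> (inv \<kappa> u \<otimes> \<kappa> u'))"
    using pbD(6)[OF k1(1) g'] by simp
  also have "\<kappa> u \<otimes> (inv \<kappa> u \<otimes> \<kappa> u') = \<kappa> u'"
    using in_carrier by (simp add: grp.m_assoc[symmetric])
  finally show thesis using k2 g' that by simp
qed

lemma proj_open_preimage: "open U \<Longrightarrow> open (proj C -` U)"
  using smooth_map_open_continuous[of "tot_atlas C" UNIV "base_atlas C" "proj C"] pbD(3)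
  unfolding smooth_map_on_iff_open[OF pbD(1,2) open_UNIV]
  by (simp add: continuous_on_open_vimage)

text \<open>A smooth lift near one point of the fibre need not be equivariant. Its values along a
  local section \<open>e\<close> are kept and spread over the fibres by the only formula that
  equivariance permits; the values remain in \<open>s\<close> because \<open>s\<close> is
  equivariant.\<close>

lemma local_lift:
  assumes s: "s \<in> quotient_sections G Q C (Ad G) S T"
  obtains U t where "open U" "x \<in> U" "smooth_map_open tot (proj C -` U) vs_atlas t"
    "\<And>u. proj C u \<in> U \<Longrightarrow> t u \<in> s u"
    "\<And>u g. proj C u \<in> U \<Longrightarrow> g \<in> Q \<Longrightarrow> t (act C u g) = Ad G (inv g) (t u)"
proof -
  obtain U \<kappa> e where U: "open U" "x \<in> U" and ks: "smooth_map_on tot (proj C -` U) (atlas G) \<kappa>"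
    and es: "smooth_map_on base U tot e"
    and pe: "\<And>y. y \<in> U \<Longrightarrow> proj C (e y) = y"
    and k: "\<And>u. proj C u \<in> U \<Longrightarrow> \<kappa> u \<in> Q \<and> act C (e (proj C u)) (\<kappa> u) = u"
    and kg: "\<And>u g. proj C u \<in> U \<Longrightarrow> g \<in> Q \<Longrightarrow> \<kappa> (act C u g) = \<kappa> u \<otimes> g"
    by (rule local_section[of x]) blast
  have s1: "\<exists>V f. open V \<and> e x \<in> V \<and> smooth_map_on tot V vs_atlas f \<and> (\<forall>y\<in>V. f y \<in> s y)"
    and s2: "\<And>u g. g \<in> Q \<Longrightarrow> s (act C u g) = Ad G (inv g) ` s u"
    using s unfolding quotient_sections_def by auto
  obtain V f where V: "open V" "e x \<in> V" "smooth_map_on tot V vs_atlas f" "\<forall>y\<in>V. f y \<in> s y"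
    using s1 by blast
  \<comment> \<open>The smooth lift \<open>f\<close> lives on \<open>V\<close> only, so the base is
    restricted to where the local section stays in \<open>V\<close>.\<close>
  define U' where "U' = U \<inter> e -` V"
  have "continuous_on U e"
    using es unfolding smooth_map_on_iff_open[OF pbD(2,1) U(1)] by (rule smooth_map_open_continuous)
  then have U': "open U'" unfolding U'_def using U(1) V(1) by (rule continuous_open_preimage)
  define t where "t u = Ad G (inv \<kappa> u) (f (e (proj C u)))" for u
  have o: "open (proj C -` U')" using U' by (rule proj_open_preimage)
  have "smooth_map_on tot (proj C -` U') tot (\<lambda>u. e (proj C u))"
    by (rule smooth_map_on_compose[OF pbD(1,2,1) _ smooth_map_on_subset[OF pbD(3)] es]) (auto simp: U'_def)
  from smooth_map_on_compose[OF pbD(1,1) smooth_atlas_vs _ this V(3)]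
  have w: "smooth_map_open tot (proj C -` U') vs_atlas (\<lambda>u. f (e (proj C u)))"
    unfolding smooth_map_on_iff_open[OF pbD(1) smooth_atlas_vs o] by (auto simp: U'_def)
  have "smooth_map_on tot (proj C -` U') (atlas G) (\<lambda>u. inv \<kappa> u)"
    by (rule smooth_map_on_inverse[OF pbD(1) smooth_map_on_subset[OF ks]]) (auto simp: U'_def)
  from smooth_Ad_apply[OF pbD(1) o this w]
  have ts: "smooth_map_open tot (proj C -` U') vs_atlas t" by (simp add: t_def[abs_def])
  show thesis
  proof (rule that[OF U' _ ts])
    show "x \<in> U'" using U V by (simp add: U'_def)
    fix u assume u: "proj C u \<in> U'"
    then have uU: "proj C u \<in> U" and uV: "e (proj C u) \<in> V" by (auto simp: U'_def)
    have "s u = Ad G (inv \<kappa> u) ` s (e (proj C u))"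
      using s2[of "\<kappa> u" "e (proj C u)"] k[OF uU] by simp
    then show "t u \<in> s u" using V(4) uV by (simp add: t_def)
    fix g assume g: "g \<in> Q"
    have "inv (\<kappa> u \<otimes> g) = inv g \<otimes> inv \<kappa> u"
      using in_carrier by (simp add: grp.inv_mult_group)
    then show "t (act C u g) = Ad G (inv g) (t u)"
      by (simp add: t_def kg[OF uU g] pbD(7)[OF g] Ad_mult)
  qed
qed

text \<open>Where \<open>h\<close> vanishes, \<open>t\<close> carries no information; it is the
  product of both that is globally smooth. The conditions are gathered in one predicate so that all
  data can be chosen as functions of the base point.\<close>

definition is_cutoff_lift :: "('b \<Rightarrow> 'v set) \<Rightarrow> 'm \<Rightarrow> ('m \<Rightarrow> real) \<Rightarrow> 'm set \<Rightarrow> ('b \<Rightarrow> 'v) \<Rightarrow> bool" where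
  "is_cutoff_lift s x h N t \<longleftrightarrow> open N \<and> x \<in> N \<and> smooth_map_open base UNIV vs_atlas h \<and> (\<forall>y\<in>N. h y = 1) \<and>
    smooth_map_open tot UNIV vs_atlas (\<lambda>u. h (proj C u) *\<^sub>R t u) \<and>
    (\<forall>u. h (proj C u) \<noteq> 0 \<longrightarrow> t u \<in> s u \<and> (\<forall>g\<in>Q. t (act C u g) = Ad G (inv g) (t u)))"

lemma cutoff_lift:
  assumes s: "s \<in> quotient_sections G Q C (Ad G) S T"
  shows "\<exists>h N t. is_cutoff_lift s x h N t"
proof -
  obtain U t where U: "open U" "x \<in> U" and ts: "smooth_map_open tot (proj C -` U) vs_atlas t"
    and t: "\<And>u. proj C u \<in> U \<Longrightarrow> t u \<in> s u"
    "\<And>u g. proj C u \<in> U \<Longrightarrow> g \<in> Q \<Longrightarrow> t (act C u g) = Ad G (inv g) (t u)"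
    by (rule local_lift[OF s, of x]) blast
  obtain h :: "'m \<Rightarrow> real" and N K where h: "smooth_map_open base UNIV vs_atlas h"
    and N: "open N" "x \<in> N" "\<And>y. y \<in> N \<Longrightarrow> h y = 1"
    and K: "closed K" "K \<subseteq> U" "\<And>y. y \<notin> K \<Longrightarrow> h y = 0"
    by (rule manifold_bump[OF pbD(2) U]) blast
  let ?w = "\<lambda>u. h (proj C u) *\<^sub>R t u"
  have proj: "smooth_map_open tot UNIV base (proj C)"
    using pbD(3) unfolding smooth_map_on_iff_open[OF pbD(1,2) open_UNIV] .
  have hp: "smooth_map_open tot UNIV vs_atlas (\<lambda>u. h (proj C u))"
    by (rule smooth_map_open_compose[OF pbD(1,2) smooth_atlas_vs open_UNIV open_UNIV subset_UNIV proj h])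
  have o1: "open (proj C -` U)" using U(1) by (rule proj_open_preimage)
  have o2: "open (proj C -` (- K))" using K(1) by (intro proj_open_preimage) auto
  have w1: "smooth_map_open tot (proj C -` U) vs_atlas ?w"
    by (rule smooth_map_open_bilinear[OF pbD(1) o1 bounded_bilinear_scaleR smooth_map_open_subset[OF hp] ts]) simp
  have w2: "smooth_map_open tot (proj C -` (- K)) vs_atlas ?w"
    by (rule smooth_map_open_cong[OF pbD(1) smooth_atlas_vs o2 _ smooth_map_open_const[of _ _ _ 0]])
      (simp add: K(3))
  have "smooth_map_open tot UNIV vs_atlas ?w"
  proof (rule smooth_map_open_local[OF pbD(1) smooth_atlas_vs open_UNIV])
    fix u
    show "\<exists>W. open W \<and> u \<in> W \<and> smooth_map_open tot W vs_atlas ?w"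
    proof (cases "proj C u \<in> K")
      case True
      then show ?thesis using w1 o1 K(2) by (intro exI[of _ "proj C -` U"]) auto
    next
      case False
      then show ?thesis using w2 o2 by (intro exI[of _ "proj C -` (- K)"]) auto
    qed
  qed
  moreover have "proj C u \<in> U" if "h (proj C u) \<noteq> 0" for u using that K by blast
  ultimately show ?thesis
    unfolding is_cutoff_lift_def using h N t by (intro exI[of _ h] exI[of _ N] exI[of _ t]) blast
qed

text \<open>Cosets are affine subspaces, so the weight may be any real number and the cut-off
  functions may take arbitrary values.\<close>

lemma coset_combine:
  assumes T: "subspace T" and Z: "Z \<in> coset T ` S" and "X \<in> Z" "Y \<in> Z"
  shows "a *\<^sub>R X + (1 - a) *\<^sub>R Y \<in> Z"
proof -
  obtain X0 A B where *: "Z = coset T X0" "X = X0 + A" "Y = X0 + B" "A \<in> T" "B \<in> T"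
    using assms by (auto simp: coset_def)
  then have "a *\<^sub>R X + (1 - a) *\<^sub>R Y = X0 + (a *\<^sub>R A + (1 - a) *\<^sub>R B)"
    by (simp add: algebra_simps)
  moreover have "a *\<^sub>R A + (1 - a) *\<^sub>R B \<in> T"
    using T *(4,5) by (intro subspace_add subspace_scale)
  ultimately show ?thesis using *(1) by (auto simp: coset_def)
qed

text \<open>Multiplying the cut-off functions \<open>h\<^sub>k\<close> by \<open>\<Prod>j<k. (1 - h\<^sub>j)\<close> makes the family locally
  finite: where \<open>h\<^sub>k = 1\<close>, all later terms vanish.\<close>

lemma global_lift:
  assumes s: "s \<in> quotient_sections G Q C (Ad G) S T" and T: "subspace T"
  obtains t where "t \<in> adjoint_sections G Q C" "\<And>u. t u \<in> s u"
proof -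
  have "\<forall>x. \<exists>h N t. is_cutoff_lift s x h N t" by (intro allI cutoff_lift[OF s])
  from choice[OF this] obtain h0 where "\<forall>x. \<exists>N t. is_cutoff_lift s x (h0 x) N t" ..
  from choice[OF this] obtain N0 where "\<forall>x. \<exists>t. is_cutoff_lift s x (h0 x) (N0 x) t" ..
  from choice[OF this] obtain t0 where "\<forall>x. is_cutoff_lift s x (h0 x) (N0 x) (t0 x)" ..
  then have loc: "open (N0 x)" "x \<in> N0 x" "smooth_map_open base UNIV vs_atlas (h0 x)"
    "y \<in> N0 x \<Longrightarrow> h0 x y = 1"
    "smooth_map_open tot UNIV vs_atlas (\<lambda>u. h0 x (proj C u) *\<^sub>R t0 x u)"
    "h0 x (proj C u) \<noteq> 0 \<Longrightarrow> t0 x u \<in> s u \<and> (\<forall>g\<in>Q. t0 x (act C u g) = Ad G (inv g) (t0 x u))" for x y u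
    by (simp_all add: is_cutoff_lift_def)
  \<comment> \<open>Second countability of the base gives a countable subcover. Its enumeration by
    \<open>from_nat_into\<close> may repeat members, so a finite subcover is no special
    case.\<close>
  obtain F where F: "F \<subseteq> range N0" "countable F" "\<Union>F = \<Union>(range N0)"
    by (rule Lindelof[of "range N0"]) (use loc(1) in auto)
  have UN: "\<Union>(range N0) = UNIV" using loc(2) by blast
  then have "F \<noteq> {}" using F(3) by auto
  have "\<forall>n. \<exists>x. N0 x = from_nat_into F n"
    using from_nat_into[OF \<open>F \<noteq> {}\<close>] F(1) by (metis imageE subsetD)
  from choice[OF this] obtain p where p: "\<forall>n. N0 (p n) = from_nat_into F n" ..
  define h where "h n = h0 (p n)" for n
  define N where "N n = N0 (p n)" for n
  define t where "t n = t0 (p n)" for n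
  have cover: "\<exists>n. y \<in> N n" for y
  proof -
    have "y \<in> \<Union>F" using F(3) UN by simp
    then show ?thesis using p range_from_nat_into[OF \<open>F \<noteq> {}\<close> F(2)] unfolding N_def by (metis UnionE imageE)
  qed
  \<comment> \<open>The weight left over after the first \<open>n\<close> cut-off functions;
    \<open>W n\<close> below collects the first \<open>n\<close> weighted lifts.\<close>
  define r where "r n u = (\<Prod>k<n. 1 - h k (proj C u))" for n u
  define W where "W n u = (\<Sum>k<n. r k u *\<^sub>R (h k (proj C u) *\<^sub>R t k u))" for n u
  have proj: "smooth_map_open tot UNIV base (proj C)"
    using pbD(3) unfolding smooth_map_on_iff_open[OF pbD(1,2) open_UNIV] .
  have hp: "smooth_map_open tot UNIV vs_atlas (\<lambda>u. 1 - h n (proj C u))" for n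
  proof -
    have "smooth_map_open tot UNIV vs_atlas (\<lambda>u. - h n (proj C u))"
      by (rule smooth_map_open_bounded_linear[OF pbD(1) open_UNIV bounded_linear_minus[OF bounded_linear_ident]
            smooth_map_open_compose[OF pbD(1,2) smooth_atlas_vs open_UNIV open_UNIV subset_UNIV proj loc(3)[of "p n", folded h_def]]])
    from smooth_map_open_add[OF pbD(1) open_UNIV smooth_map_open_const[of _ _ _ 1] this] show ?thesis by simp
  qed
  have rs: "smooth_map_open tot UNIV vs_atlas (r n)" for n
  proof (induction n)
    case 0
    show ?case unfolding r_def by (simp add: smooth_map_open_const)
  next
    case (Suc n)
    show ?case
      using smooth_map_open_bilinear[OF pbD(1) open_UNIV bounded_bilinear_mult Suc hp[of n]]
      by (simp add: r_def[abs_def])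
  qed
  have Ws: "smooth_map_open tot UNIV vs_atlas (W n)" for n
  proof (induction n)
    case 0
    show ?case unfolding W_def by (simp add: smooth_map_open_const)
  next
    case (Suc n)
    show ?case
      using smooth_map_open_add[OF pbD(1) open_UNIV Suc
          smooth_map_open_bilinear[OF pbD(1) open_UNIV bounded_bilinear_scaleR rs[of n] loc(5)[of "p n", folded h_def t_def]]]
      by (simp add: W_def[abs_def])
  qed
  have r0: "r n u = 0" if "proj C u \<in> N k" "k < n" for n k u
    using that loc(4)[of "proj C u" "p k"] unfolding r_def by (auto simp: N_def h_def)
  have Weq: "W n u = W (Suc k) u" if "proj C u \<in> N k" "Suc k \<le> n" for n k u
    using that(2)
  proof (induction n rule: dec_induct)
    case (step n)
    then show ?case using r0[OF that(1), of n] by (simp add: W_def)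
  qed simp
  have su: "s u \<in> coset T ` S" for u using s unfolding quotient_sections_def by auto
  \<comment> \<open>Any \<open>X\<close> in the coset may receive the weight left over. In the
    induction step its place is taken by \<open>Y\<close>, which mixes the \<open>n\<close>-th lift
    with \<open>X\<close>; hence \<open>X\<close> is arbitrary.\<close>
  have inv: "W n u + r n u *\<^sub>R X \<in> s u" if "X \<in> s u" for n u X
    using that
  proof (induction n arbitrary: X)
    case (Suc n)
    define Y where "Y = h n (proj C u) *\<^sub>R t n u + (1 - h n (proj C u)) *\<^sub>R X"
    have "Y \<in> s u"
    proof (cases "h n (proj C u) = 0")
      case False
      then have "t n u \<in> s u" using loc(6)[of "p n" u] by (simp add: h_def t_def)
      then show ?thesis unfolding Y_def using Suc.prems by (intro coset_combine[OF T su])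
    qed (use Suc.prems in \<open>simp add: Y_def\<close>)
    then have "W n u + r n u *\<^sub>R Y \<in> s u" by (rule Suc.IH)
    moreover have "W (Suc n) u + r (Suc n) u *\<^sub>R X = W n u + r n u *\<^sub>R Y"
      by (simp add: W_def r_def Y_def scaleR_add_right add.assoc)
    ultimately show ?case by simp
  qed (simp add: W_def r_def)
  have Weq': "W n (act C u g) = Ad G (inv g) (W n u)" if g: "g \<in> Q" for n u g
  proof -
    have "h k (proj C u) *\<^sub>R t k (act C u g) = Ad G (inv g) (h k (proj C u) *\<^sub>R t k u)" for k
      using loc(6)[of "p k" u] g linear_cmul[OF linear_Ad] linear_0[OF linear_Ad]
      by (cases "h k (proj C u) = 0") (auto simp: h_def t_def)
    moreover have "r k (act C u g) = r k u" for k by (simp add: r_def pbD(7)[OF g])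
    ultimately have "r k (act C u g) *\<^sub>R (h k (proj C (act C u g)) *\<^sub>R t k (act C u g))
        = Ad G (inv g) (r k u *\<^sub>R (h k (proj C u) *\<^sub>R t k u))" for k
      by (simp only: pbD(7)[OF g] linear_cmul[OF linear_Ad, of _ "r k u"])
    then show ?thesis
      unfolding W_def linear_sum[OF linear_Ad] by (simp only: comp_def)
  qed
  \<comment> \<open>Over \<open>y\<close> the sums \<open>W\<close> are stationary from
    \<open>Suc (k y)\<close> on: the successor is what brings the factor 1 - h with index
    \<open>k y\<close>, equal to 0 there, into the remaining weight.\<close>
  define k where "k y = (LEAST n. y \<in> N n)" for y
  have k: "y \<in> N (k y)" for y unfolding k_def using cover[of y] by (rule LeastI_ex)
  have kle: "y \<in> N n \<Longrightarrow> k y \<le> n" for y n unfolding k_def by (rule Least_le)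
  define R where "R u = W (Suc (k (proj C u))) u" for u
  have Req: "R u = W (Suc n) u" if "proj C u \<in> N n" for n u
    unfolding R_def using Weq[OF k, of u "Suc n"] kle[OF that] by simp
  show thesis
  proof
    have "smooth_map_open tot UNIV vs_atlas R"
    proof (rule smooth_map_open_local[OF pbD(1) smooth_atlas_vs open_UNIV])
      fix u
      obtain n where n: "proj C u \<in> N n" using cover by blast
      have o: "open (proj C -` N n)" by (rule proj_open_preimage) (simp add: N_def loc(1))
      have "smooth_map_open tot (proj C -` N n) vs_atlas R"
        by (rule smooth_map_open_cong[OF pbD(1) smooth_atlas_vs o _ smooth_map_open_subset[OF Ws subset_UNIV]])
          (simp add: Req)
      then show "\<exists>V. open V \<and> u \<in> V \<and> smooth_map_open tot V vs_atlas R"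
        using n o by (intro exI[of _ "proj C -` N n"]) auto
    qed
    then show "R \<in> adjoint_sections G Q C"
      unfolding adjoint_sections_def sections_def smooth_tot_iff
      using Weq' by (auto simp: R_def pbD(7))
    show "R u \<in> s u" for u
    proof -
      obtain X where "X \<in> s u" using su[of u] subspace_0[OF T] by (auto simp: coset_def)
      then show ?thesis using inv[of X u "Suc (k (proj C u))"] r0[OF k lessI, of u] by (simp add: R_def)
    qed
  qed
qed

end

section \<open>The relative fundamental derivative\<close>

lemma tderiv_bounded_linear:
  assumes A: "smooth_atlas A" and F: "mdiff A vs_atlas F x" and v: "v \<in> tangent_space A x"
    and L: "bounded_linear L"
  shows "tderiv A (\<lambda>x. L (F x)) x v = L (tderiv A F x v)"
proof -
  obtain c where c: "c \<in> charts_at A x" using charts_at_nonempty[OF A] by blast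
  note Fd = mdiff_vs_differentiable[OF F c]
  then have D: "((\<lambda>y. L ((F \<circ> cinv c) y)) has_derivative
      (\<lambda>h. L (frechet_derivative (F \<circ> cinv c) (at (snd c x)) h))) (at (snd c x))"
    unfolding frechet_derivative_works by (rule bounded_linear.has_derivative[OF L])
  then have "((\<lambda>x. L (F x)) \<circ> cinv c) differentiable (at (snd c x))"
    by (auto simp: differentiable_def o_def)
  from tderiv_chart[OF A c this v] show ?thesis
    using frechet_derivative_eqI[OF D] tderiv_chart[OF A c Fd v] by (simp add: o_def)
qed

lemma tderiv_bilinear:
  assumes A: "smooth_atlas A" and F: "mdiff A vs_atlas F x" and K: "mdiff A vs_atlas K x"
    and v: "v \<in> tangent_space A x" and B: "bounded_bilinear B"
  shows "tderiv A (\<lambda>x. B (F x) (K x)) x v = B (F x) (tderiv A K x v) + B (tderiv A F x v) (K x)"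
proof -
  obtain c where c: "c \<in> charts_at A x" using charts_at_nonempty[OF A] by blast
  note Fd = mdiff_vs_differentiable[OF F c] and Kd = mdiff_vs_differentiable[OF K c]
  have x: "cinv c (snd c x) = x" using c by (auto intro: cinv_atlas[OF A] dest: charts_atD)
  have D: "((\<lambda>y. B ((F \<circ> cinv c) y) ((K \<circ> cinv c) y)) has_derivative
      (\<lambda>h. B ((F \<circ> cinv c) (snd c x)) (frechet_derivative (K \<circ> cinv c) (at (snd c x)) h)
        + B (frechet_derivative (F \<circ> cinv c) (at (snd c x)) h) ((K \<circ> cinv c) (snd c x)))) (at (snd c x))"
    by (rule bounded_bilinear.FDERIV[OF B Fd[unfolded frechet_derivative_works] Kd[unfolded frechet_derivative_works]])
  then have "((\<lambda>x. B (F x) (K x)) \<circ> cinv c) differentiable (at (snd c x))"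
    by (auto simp: differentiable_def o_def)
  from tderiv_chart[OF A c this v] show ?thesis
    using frechet_derivative_eqI[OF D] tderiv_chart[OF A c Fd v] tderiv_chart[OF A c Kd v]
    by (simp add: o_def x)
qed

lemma tderiv_lincomb:
  assumes A: "smooth_atlas A" and F: "mdiff A vs_atlas F x"
    and v: "v \<in> tangent_space A x" and w: "w \<in> tangent_space A x"
  shows "tderiv A F x (\<lambda>c. a *\<^sub>R v c + b *\<^sub>R w c) = a *\<^sub>R tderiv A F x v + b *\<^sub>R tderiv A F x w"
proof -
  obtain c where c: "c \<in> charts_at A x" using charts_at_nonempty[OF A] by blast
  note Fd = mdiff_vs_differentiable[OF F c]
  note lin = frechet_derivative_linear[OF Fd]
  show ?thesis
    unfolding tderiv_chart[OF A c Fd v] tderiv_chart[OF A c Fd w]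
      tderiv_chart[OF A c Fd tangent_space_add_scale[OF A v w]]
    by (simp add: linear_add[OF lin] linear_cmul[OF lin])
qed

lemma tmap_lincomb:
  assumes A: "smooth_atlas A" and f: "mdiff A B f x"
    and v: "v \<in> tangent_space A x" and w: "w \<in> tangent_space A x"
  shows "tmap A B f x (\<lambda>c. a *\<^sub>R v c + b *\<^sub>R w c) = (\<lambda>d. a *\<^sub>R tmap A B f x v d + b *\<^sub>R tmap A B f x w d)"
proof
  fix d
  show "tmap A B f x (\<lambda>c. a *\<^sub>R v c + b *\<^sub>R w c) d = a *\<^sub>R tmap A B f x v d + b *\<^sub>R tmap A B f x w d"
  proof (cases "d \<in> charts_at B (f x)")
    case True
    obtain c where c: "c \<in> charts_at A x" using charts_at_nonempty[OF A] by blast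
    have "(snd d \<circ> f \<circ> cinv c) differentiable (at (snd c x))" using f c True by (simp add: mdiff_def)
    note lin = frechet_derivative_linear[OF this]
    show ?thesis
      unfolding tmap_chart[OF A f v c True] tmap_chart[OF A f w c True]
        tmap_chart[OF A f tangent_space_add_scale[OF A v w] c True]
      by (simp add: linear_add[OF lin] linear_cmul[OF lin])
  qed (simp add: tmap_def)
qed

lemma (in Lie_group) subgroup_normalizer_in:
  assumes P: "subgroup P G"
  shows "subgroup (normalizer_in G P qq) G"
proof (rule subgroup.intro)
  show "normalizer_in G P qq \<subseteq> carrier G" by (simp add: carrier_UNIV)
  show "g \<otimes> h \<in> normalizer_in G P qq" if "g \<in> normalizer_in G P qq" "h \<in> normalizer_in G P qq" for g h
  proof -
    have "Ad G (g \<otimes> h) ` qq = Ad G g ` (Ad G h ` qq)"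
      by (simp add: image_image Ad_mult)
    then show ?thesis using that subgroup.m_closed[OF P, of g h] by (simp add: normalizer_in_def)
  qed
  show "\<one> \<in> normalizer_in G P qq"
    using subgroup.one_closed[OF P] by (simp add: normalizer_in_def Ad_one)
  show "inv g \<in> normalizer_in G P qq" if g: "g \<in> normalizer_in G P qq" for g
  proof -
    have "Ad G (inv g) ` qq = Ad G (inv g) ` (Ad G g ` qq)"
      using g by (simp add: normalizer_in_def)
    also have "\<dots> = qq" by (simp add: image_image Ad_inv)
    finally show ?thesis using g subgroup.m_inv_closed[OF P, of g] by (simp add: normalizer_in_def)
  qed
qed

text \<open>The value at \<open>u\<close> of the constant vector field determined by the Cartan
  connection and an element of the Lie algebra.\<close>

definition conn_inv :: "('b, 'h::real_normed_vector, 'm, 'e, 'g, 'v) cartan_geom \<Rightarrow> 'b \<Rightarrow> 'v \<Rightarrow> ('b, 'h) tvec" where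
  "conn_inv C u = the_inv_into (tangent_space (tot_atlas C) u) (conn C u)"

locale Cartan_geometry = Principal_bundle G Q C
  for G :: "('g::t2_space, 'v::{real_inner,heine_borel}) lie_grp" (structure) and Q :: "'g set"
    and C :: "('b::t2_space, 'h::{real_inner,heine_borel}, 'm::{t2_space,second_countable_topology},
      'e::{real_inner,heine_borel}, 'g, 'v) cartan_geom" +
  assumes connection: "cartan_connection G Q C"
begin

section \<open>The inverse of the Cartan connection\<close>

lemma cartan_connectionD:
  "c \<in> tot_atlas C \<Longrightarrow> u \<in> fst c \<Longrightarrow> linear (\<lambda>e. conn C u (coord_vec tot c u e))"
  "c \<in> tot_atlas C \<Longrightarrow> smooth_on (snd c ` fst c) (\<lambda>y. conn C (cinv c y) (coord_vec tot c (cinv c y) e))"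
  "bij_betw (conn C u) (tangent_space tot u) UNIV"
  "g \<in> Q \<Longrightarrow> v \<in> tangent_space tot u \<Longrightarrow>
     conn C (act C u g) (tmap tot tot (\<lambda>u. act C u g) u v) = Ad G (inv g) (conn C u v)"
  "one_param_subgroup G X \<gamma> \<Longrightarrow> range \<gamma> \<subseteq> Q \<Longrightarrow> conn C u (velocity tot (\<lambda>t. act C u (\<gamma> t)) 0) = X"
  using connection unfolding cartan_connection_def by simp_all

lemma conn_lincomb:
  assumes v: "v \<in> tangent_space tot u" and w: "w \<in> tangent_space tot u"
  shows "conn C u (\<lambda>c. a *\<^sub>R v c + b *\<^sub>R w c) = a *\<^sub>R conn C u v + b *\<^sub>R conn C u w"
proof -
  obtain c where c: "c \<in> charts_at tot u" using charts_at_nonempty[OF pbD(1)] by blast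
  have lin: "linear (\<lambda>e. conn C u (coord_vec tot c u e))"
    using c by (intro cartan_connectionD(1)) (auto dest: charts_atD)
  show ?thesis
    using linear_add[OF lin, of "a *\<^sub>R v c" "b *\<^sub>R w c"] linear_cmul[OF lin, of a "v c"] linear_cmul[OF lin, of b "w c"]
      coord_vec_eq[OF pbD(1) c v] coord_vec_eq[OF pbD(1) c w]
      coord_vec_eq[OF pbD(1) c tangent_space_add_scale[OF pbD(1) v w, of a b]]
    by simp
qed

lemma conn_inv_tangent_space: "conn_inv C u X \<in> tangent_space tot u"
  and conn_conn_inv: "conn C u (conn_inv C u X) = X"
  and conn_inv_conn: "v \<in> tangent_space tot u \<Longrightarrow> conn_inv C u (conn C u v) = v"
proof -
  have b: "inj_on (conn C u) (tangent_space tot u)" "conn C u ` tangent_space tot u = UNIV"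
    using cartan_connectionD(3)[of u] by (auto simp: bij_betw_def)
  show "conn_inv C u X \<in> tangent_space tot u"
    unfolding conn_inv_def using the_inv_into_into[OF b(1)] b(2) by blast
  show "conn C u (conn_inv C u X) = X" unfolding conn_inv_def using f_the_inv_into_f[OF b(1)] b(2) by blast
  show "v \<in> tangent_space tot u \<Longrightarrow> conn_inv C u (conn C u v) = v"
    unfolding conn_inv_def by (rule the_inv_into_f_f[OF b(1)])
qed

lemma conn_inv_lincomb: "conn_inv C u (a *\<^sub>R X + b *\<^sub>R Y) = (\<lambda>c. a *\<^sub>R conn_inv C u X c + b *\<^sub>R conn_inv C u Y c)"
proof -
  have "a *\<^sub>R X + b *\<^sub>R Y = conn C u (\<lambda>c. a *\<^sub>R conn_inv C u X c + b *\<^sub>R conn_inv C u Y c)"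
    using conn_lincomb[OF conn_inv_tangent_space conn_inv_tangent_space] by (simp add: conn_conn_inv)
  then show ?thesis
    using conn_inv_conn[OF tangent_space_add_scale[OF pbD(1) conn_inv_tangent_space conn_inv_tangent_space]] by simp
qed

lemma mdiff_act: "g \<in> Q \<Longrightarrow> mdiff tot tot (\<lambda>u. act C u g) u"
  by (rule smooth_map_on_imp_mdiff[OF pbD(1) pbD(1) open_UNIV UNIV_I smooth_act_right])

lemma mdiff_proj: "mdiff tot base (proj C) u"
  by (rule smooth_map_on_imp_mdiff[OF pbD(1) pbD(2) open_UNIV UNIV_I pbD(3)])

lemma mdiff_smooth: "smooth_tot F \<Longrightarrow> mdiff tot vs_atlas F u"
  by (rule smooth_map_on_imp_mdiff[OF pbD(1) smooth_atlas_vs open_UNIV UNIV_I])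

text \<open>Equivariance of the connection read backwards: the constant field of X is carried to
  that of Ad(g^(-1)) X. This makes the vector field of an equivariant \<open>s\<close>
  invariant.\<close>

lemma tmap_act_conn_inv:
  assumes g: "g \<in> Q"
  shows "tmap tot tot (\<lambda>u. act C u g) u (conn_inv C u X) = conn_inv C (act C u g) (Ad G (inv g) X)"
proof -
  let ?w = "tmap tot tot (\<lambda>u. act C u g) u (conn_inv C u X)"
  have "?w \<in> tangent_space tot (act C u g)"
    by (rule tmap_tangent_space[OF pbD(1) pbD(1) mdiff_act[OF g] conn_inv_tangent_space])
  from conn_inv_conn[OF this] show ?thesis
    using cartan_connectionD(4)[OF g conn_inv_tangent_space, of u X] by (simp add: conn_conn_inv)
qed

text \<open>The connection reproduces generators of fundamental fields and is injective on the
  tangent space, so the vector belonging to X is the velocity of the orbit curve.\<close>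

lemma conn_inv_vertical:
  assumes \<gamma>: "one_param_subgroup G X \<gamma>" "range \<gamma> \<subseteq> Q"
  shows "mdiff vs_atlas tot (\<lambda>t. act C u (\<gamma> t)) 0"
    and "act C u (\<gamma> 0) = u"
    and "conn_inv C u X = velocity tot (\<lambda>t. act C u (\<gamma> t)) 0"
proof -
  have "smooth_map_on vs_atlas UNIV (atlas G) \<gamma>" using \<gamma>(1) by (simp add: one_param_subgroup_def)
  then show m: "mdiff vs_atlas tot (\<lambda>t. act C u (\<gamma> t)) 0"
    by (intro smooth_map_on_imp_mdiff[OF smooth_atlas_vs pbD(1) open_UNIV UNIV_I]
        smooth_act_curve \<gamma>(2))
  show a: "act C u (\<gamma> 0) = u" using one_param_subgroup_zero[OF \<gamma>(1)] pbD(5) by simp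
  have "velocity tot (\<lambda>t. act C u (\<gamma> t)) 0 \<in> tangent_space tot u"
    using velocity_tangent_space[OF pbD(1) m] unfolding a .
  from conn_inv_conn[OF this] show "conn_inv C u X = velocity tot (\<lambda>t. act C u (\<gamma> t)) 0"
    using cartan_connectionD(5)[OF \<gamma>, of u] by simp
qed

lemma vertical_derivative:
  assumes \<gamma>: "one_param_subgroup G X \<gamma>" "range \<gamma> \<subseteq> Q" and F: "smooth_tot F"
  shows "((\<lambda>t. F (act C u (\<gamma> t))) has_vector_derivative tderiv tot F u (conn_inv C u X)) (at 0)"
  using has_vector_derivative_along_curve[OF pbD(1) conn_inv_vertical(1)[OF \<gamma>, of u] mdiff_smooth[OF F]]
  unfolding conn_inv_vertical(2)[OF \<gamma>] conn_inv_vertical(3)[OF \<gamma>] .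

text \<open>The orbit curve stays in one fibre, so its projection to the base is constant.\<close>

lemma vertical_proj:
  assumes \<gamma>: "one_param_subgroup G X \<gamma>" "range \<gamma> \<subseteq> Q"
  shows "tmap tot base (proj C) u (conn_inv C u X) = (\<lambda>d. 0)"
proof -
  have "tmap tot base (proj C) u (conn_inv C u X) = velocity base (\<lambda>t. proj C (act C u (\<gamma> t))) 0"
    using tmap_velocity[OF pbD(1) conn_inv_vertical(1)[OF \<gamma>, of u] mdiff_proj]
    unfolding conn_inv_vertical(2)[OF \<gamma>] conn_inv_vertical(3)[OF \<gamma>] .
  also have "(\<lambda>t. proj C (act C u (\<gamma> t))) = (\<lambda>t. proj C u)"
    using \<gamma>(2) pbD(7) by (auto simp: image_subset_iff)
  also have "velocity base (\<lambda>t::real. proj C u) 0 = (\<lambda>d. 0)"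
    by (auto simp: velocity_def o_def)
  finally show ?thesis .
qed

section \<open>The fundamental derivative of a section\<close>

lemma fund_deriv_eq: "fund_deriv C s \<sigma> u = tderiv tot \<sigma> u (conn_inv C u (s u))"
  by (simp add: fund_deriv_def inv_field_def conn_inv_def)

text \<open>In a chart the components \<open>w\<close> of the vector field of \<open>s\<close> solve
  the linear equation A y (w y) = s, where \<open>A\<close> is the coordinate expression of the
  connection, smooth and invertible. So \<open>w\<close> is smooth, and so is the directional
  derivative of \<sigma> along it.\<close>

lemma smooth_fund_deriv:
  assumes s: "smooth_tot s" and \<sigma>: "smooth_tot \<sigma>"
  shows "smooth_tot (fund_deriv C s \<sigma>)"
  unfolding smooth_tot_iff smooth_map_open_vs_iff[OF pbD(1) open_UNIV]
proof
  fix c assume c: "c \<in> tot_atlas C"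
  define S where "S = snd c ` fst c"
  have S: "open S" unfolding S_def by (rule smooth_atlasD(2)[OF pbD(1) c])
  have "\<And>F :: 'b \<Rightarrow> 'v. smooth_tot F \<Longrightarrow> smooth_on S (F \<circ> cinv c)"
    and "\<And>F :: 'b \<Rightarrow> 'a. smooth_tot F \<Longrightarrow> smooth_on S (F \<circ> cinv c)"
    unfolding smooth_tot_iff smooth_map_open_vs_iff[OF pbD(1) open_UNIV] S_def
    using c by auto
  then have ss: "smooth_on S (s \<circ> cinv c)" and \<sigma>s: "smooth_on S (\<sigma> \<circ> cinv c)" using s \<sigma> by auto
  define A where "A y e = conn C (cinv c y) (coord_vec tot c (cinv c y) e)" for y e
  define w where "w y = conn_inv C (cinv c y) (s (cinv c y)) c" for y
  have inS: "c \<in> charts_at tot (cinv c y)" "snd c (cinv c y) = y" if "y \<in> S" for y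
    using that cinv_atlas[OF pbD(1) c] by (auto simp: S_def intro!: charts_atI c)
  have ws: "smooth_on S w"
  proof (rule smooth_on_linear_solution[OF S, where A = A and t = "s \<circ> cinv c"])
    show "linear (A y)" if "y \<in> S" for y
      using cartan_connectionD(1)[OF c, of "cinv c y"] inS[OF that] by (auto simp: A_def[abs_def] dest: charts_atD)
    show "bij (A y)" if y: "y \<in> S" for y
    proof (rule bijI)
      note cv = coord_vec_tangent_space[OF pbD(1) inS(1)[OF y]] coord_vec_self[OF pbD(1) inS(1)[OF y]]
      show "inj (A y)"
        by (rule injI) (metis A_def cv conn_inv_conn)
      have "A y (conn_inv C (cinv c y) X c) = X" for X
        unfolding A_def coord_vec_eq[OF pbD(1) inS(1)[OF y] conn_inv_tangent_space] by (rule conn_conn_inv)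
      then show "surj (A y)" by (rule surjI[where f = "\<lambda>X. conn_inv C (cinv c y) X c"])
    qed
    show "smooth_on S (\<lambda>y. A y e)" for e unfolding A_def S_def by (rule cartan_connectionD(2)[OF c])
    show "smooth_on S (s \<circ> cinv c)" by (rule ss)
    show "A y (w y) = (s \<circ> cinv c) y" if y: "y \<in> S" for y
      unfolding A_def w_def coord_vec_eq[OF pbD(1) inS(1)[OF y] conn_inv_tangent_space] by (simp add: conn_conn_inv)
  qed
  have "smooth_on S (\<lambda>y. frechet_derivative (\<sigma> \<circ> cinv c) (at y) (w y))"
    by (rule smooth_on_directional_derivative[OF S \<sigma>s ws])
  then have "smooth_on S (fund_deriv C s \<sigma> \<circ> cinv c)"
  proof (rule smooth_on_cong[OF S, rotated])
    fix y assume y: "y \<in> S"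
    have "(\<sigma> \<circ> cinv c) differentiable (at (snd c (cinv c y)))"
      using smooth_on_imp_differentiable[OF \<sigma>s y] inS(2)[OF y] by simp
    from tderiv_chart[OF pbD(1) inS(1)[OF y] this conn_inv_tangent_space]
    show "frechet_derivative (\<sigma> \<circ> cinv c) (at y) (w y) = (fund_deriv C s \<sigma> \<circ> cinv c) y"
      using inS(2)[OF y] by (simp add: fund_deriv_eq w_def)
  qed
  then show "smooth_on (snd c ` (fst c \<inter> UNIV)) (fund_deriv C s \<sigma> \<circ> cinv c)" by (simp add: S_def)
qed

text \<open>Differentiating the equivariance of \<sigma> along the field of \<open>s\<close> gives
  the result, because right translation by \<open>g\<close> preserves that field and the
  representing map of g^(-1) is linear.\<close>

lemma fund_deriv_section:
  assumes s: "s \<in> adjoint_sections G Q C" and \<sigma>: "\<sigma> \<in> bundle_sections G Q C \<rho>"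
  shows "fund_deriv C s \<sigma> \<in> bundle_sections G Q C \<rho>"
proof -
  have s': "smooth_tot s"
    "\<And>u g. g \<in> Q \<Longrightarrow> s (act C u g) = Ad G (inv g) (s u)"
    using s by (auto simp: adjoint_sections_def sections_def)
  have \<sigma>': "smooth_tot \<sigma>"
    "\<And>u g. g \<in> Q \<Longrightarrow> \<sigma> (act C u g) = \<rho> (inv g) (\<sigma> u)"
    using \<sigma> by (auto simp: bundle_sections_def sections_def)
  have "fund_deriv C s \<sigma> (act C u g) = \<rho> (inv g) (fund_deriv C s \<sigma> u)" if g: "g \<in> Q" for u g
  proof -
    have "fund_deriv C s \<sigma> (act C u g)
        = tderiv tot \<sigma> (act C u g) (tmap tot tot (\<lambda>u. act C u g) u (conn_inv C u (s u)))"
      by (simp add: fund_deriv_eq s'(2)[OF g] tmap_act_conn_inv[OF g])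
    also have "\<dots> = tderiv tot (\<lambda>u. \<sigma> (act C u g)) u (conn_inv C u (s u))"
      by (rule tderiv_tmap[OF pbD(1) pbD(1) mdiff_act[OF g] mdiff_smooth[OF \<sigma>'(1)] conn_inv_tangent_space, symmetric])
    also have "\<dots> = \<rho> (inv g) (fund_deriv C s \<sigma> u)"
      unfolding \<sigma>'(2)[OF g] fund_deriv_eq
      by (rule tderiv_bounded_linear[OF pbD(1) mdiff_smooth[OF \<sigma>'(1)] conn_inv_tangent_space blinfun.bounded_linear_right])
    finally show ?thesis .
  qed
  then show ?thesis
    using smooth_fund_deriv[OF s'(1) \<sigma>'(1)] by (simp add: bundle_sections_def sections_def)
qed

end

section \<open>Tensor products and duals\<close>

lemma bounded_linear_compose_right: "bounded_linear (\<lambda>b. b o\<^sub>L B)"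
  by (rule bounded_bilinear.bounded_linear_left[OF bounded_bilinear_blinfun_compose])

lemma tensor_inner_bounded_linear: "bounded_linear (\<lambda>b :: 'f::real_normed_vector \<Rightarrow>\<^sub>L real. r * blinfun_apply b z)"
  by (intro bounded_linear_const_mult blinfun.bounded_linear_left)

lemma tensor_inner_apply:
  "blinfun_apply (Blinfun (\<lambda>b :: 'f::real_normed_vector \<Rightarrow>\<^sub>L real. r * blinfun_apply b z)) b = r * blinfun_apply b z"
  using bounded_linear_Blinfun_apply[OF tensor_inner_bounded_linear[of r z]] by (rule fun_cong)

lemma tensor_outer_bounded_linear:
  fixes w :: "'w::real_normed_vector" and z :: "'f::real_normed_vector"
  shows "bounded_linear (\<lambda>a :: 'w \<Rightarrow>\<^sub>L real. Blinfun (\<lambda>b :: 'f \<Rightarrow>\<^sub>L real. blinfun_apply a w * blinfun_apply b z))"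
proof (rule bounded_linear_intro)
  show "Blinfun (\<lambda>b. blinfun_apply (x + y) w * blinfun_apply b z)
      = Blinfun (\<lambda>b. blinfun_apply x w * blinfun_apply b z) + Blinfun (\<lambda>b. blinfun_apply y w * blinfun_apply b z)" for x y :: "'w \<Rightarrow>\<^sub>L real"
    by (rule blinfun_eqI) (simp only: tensor_inner_apply blinfun.add_left, simp only: distrib_right)
  show "Blinfun (\<lambda>b. blinfun_apply (r *\<^sub>R x) w * blinfun_apply b z)
      = r *\<^sub>R Blinfun (\<lambda>b. blinfun_apply x w * blinfun_apply b z)" for r and x :: "'w \<Rightarrow>\<^sub>L real"
    by (rule blinfun_eqI) (simp add: tensor_inner_apply blinfun.scaleR_left)
  show "norm (Blinfun (\<lambda>b. blinfun_apply x w * blinfun_apply b z)) \<le> norm x * (norm w * norm z)" for x :: "'w \<Rightarrow>\<^sub>L real"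
  proof (rule norm_blinfun_bound)
    show "norm (blinfun_apply (Blinfun (\<lambda>b. blinfun_apply x w * blinfun_apply b z)) b)
        \<le> norm x * (norm w * norm z) * norm b" for b :: "'f \<Rightarrow>\<^sub>L real"
    proof -
      have "norm (blinfun_apply x w) * norm (blinfun_apply b z) \<le> (norm x * norm w) * (norm b * norm z)"
        by (intro mult_mono norm_blinfun) auto
      then show ?thesis unfolding tensor_inner_apply norm_mult by (simp add: algebra_simps)
    qed
  qed simp
qed

lemma tensor_apply: "blinfun_apply (blinfun_apply (tensor w z) a) b = blinfun_apply a w * blinfun_apply b z"
  unfolding tensor_def bounded_linear_Blinfun_apply[OF tensor_outer_bounded_linear] tensor_inner_apply ..

text \<open>Makes the Leibniz rule for tensor products an instance of the product rule.\<close>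

lemma bounded_bilinear_tensor:
  "bounded_bilinear (tensor :: 'w::real_normed_vector \<Rightarrow> 'f::real_normed_vector \<Rightarrow> ('w, 'f) tensor)"
proof
  show "tensor (w + w') z = tensor w z + tensor w' z" for w w' :: 'w and z :: 'f
    by (intro blinfun_eqI) (simp add: tensor_apply blinfun.add_left blinfun.add_right algebra_simps)
  show "tensor w (z + z') = tensor w z + tensor w z'" for w :: 'w and z z' :: 'f
    by (intro blinfun_eqI) (simp add: tensor_apply blinfun.add_left blinfun.add_right algebra_simps)
  show "tensor (r *\<^sub>R w) z = r *\<^sub>R tensor w z" for r and w :: 'w and z :: 'f
    by (intro blinfun_eqI) (simp add: tensor_apply blinfun.scaleR_left blinfun.scaleR_right)
  show "tensor w (r *\<^sub>R z) = r *\<^sub>R tensor w z" for r and w :: 'w and z :: 'f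
    by (intro blinfun_eqI) (simp add: tensor_apply blinfun.scaleR_left blinfun.scaleR_right)
  show "\<exists>K. \<forall>(w :: 'w) (z :: 'f). norm (tensor w z) \<le> norm w * norm z * K"
  proof (intro exI[of _ 1] allI)
    fix w :: 'w and z :: 'f
    show "norm (tensor w z) \<le> norm w * norm z * 1"
    proof (intro norm_blinfun_bound)
      fix a :: "'w \<Rightarrow>\<^sub>L real" and b :: "'f \<Rightarrow>\<^sub>L real"
      have "norm (blinfun_apply a w) * norm (blinfun_apply b z) \<le> (norm a * norm w) * (norm b * norm z)"
        by (intro mult_mono norm_blinfun) auto
      then show "norm (blinfun_apply (blinfun_apply (tensor w z) a) b) \<le> norm w * norm z * 1 * norm a * norm b"
        by (simp add: tensor_apply abs_mult algebra_simps)
    qed auto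
  qed
qed

text \<open>The nested \<open>Blinfun\<close> terms compute as intended once each layer is known to
  be bounded linear. Writing the map as T -> Po T PA, with \<open>PA\<close>, \<open>PB\<close> and
  \<open>Po\<close> precompositions, exhibits it as a composition of bounded linear maps.\<close>

lemma tensor_map_apply:
  fixes A :: "'w::real_normed_vector \<Rightarrow>\<^sub>L 'w" and B :: "'f::real_normed_vector \<Rightarrow>\<^sub>L 'f"
  shows "blinfun_apply (blinfun_apply (blinfun_apply (tensor_map A B) T) a) b
    = blinfun_apply (blinfun_apply T (a o\<^sub>L A)) (b o\<^sub>L B)"
proof -
  define PA :: "('w \<Rightarrow>\<^sub>L real) \<Rightarrow>\<^sub>L ('w \<Rightarrow>\<^sub>L real)" where "PA = Blinfun (\<lambda>a. a o\<^sub>L A)"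
  define PB :: "('f \<Rightarrow>\<^sub>L real) \<Rightarrow>\<^sub>L ('f \<Rightarrow>\<^sub>L real)" where "PB = Blinfun (\<lambda>b. b o\<^sub>L B)"
  define Po :: "(('f \<Rightarrow>\<^sub>L real) \<Rightarrow>\<^sub>L real) \<Rightarrow>\<^sub>L (('f \<Rightarrow>\<^sub>L real) \<Rightarrow>\<^sub>L real)" where "Po = Blinfun (\<lambda>X. X o\<^sub>L PB)"
  have PA: "blinfun_apply PA a = a o\<^sub>L A" for a
    unfolding PA_def by (rule bounded_linear_Blinfun_apply[OF bounded_linear_compose_right, THEN fun_cong])
  have PB: "blinfun_apply PB b = b o\<^sub>L B" for b
    unfolding PB_def by (rule bounded_linear_Blinfun_apply[OF bounded_linear_compose_right, THEN fun_cong])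
  have Po: "blinfun_apply Po X = X o\<^sub>L PB" for X
    unfolding Po_def by (rule bounded_linear_Blinfun_apply[OF bounded_linear_compose_right, THEN fun_cong])
  have inner: "(\<lambda>b. blinfun_apply (blinfun_apply T (a o\<^sub>L A)) (b o\<^sub>L B)) = blinfun_apply (blinfun_apply (Po o\<^sub>L (T o\<^sub>L PA)) a)"
    for T :: "('w, 'f) tensor" and a
    by (rule ext) (simp add: PA PB Po)
  have "tensor_map A B = Blinfun (\<lambda>T. Po o\<^sub>L (T o\<^sub>L PA))"
    unfolding tensor_map_def inner blinfun_apply_inverse ..
  moreover have "bounded_linear (\<lambda>T :: ('w, 'f) tensor. Po o\<^sub>L (T o\<^sub>L PA))"
    by (rule bounded_linear_compose[OF bounded_bilinear.bounded_linear_right[OF bounded_bilinear_blinfun_compose]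
          bounded_linear_compose_right])
  ultimately have "blinfun_apply (tensor_map A B) T = Po o\<^sub>L (T o\<^sub>L PA)"
    by (simp add: bounded_linear_Blinfun_apply)
  then show ?thesis by (simp add: PA PB Po)
qed

lemma tensor_map_tensor: "blinfun_apply (tensor_map A B) (tensor w z) = tensor (blinfun_apply A w) (blinfun_apply B z)"
  by (intro blinfun_eqI) (simp add: tensor_map_apply tensor_apply)

lemma compose_id_blinfun: "a o\<^sub>L id_blinfun = a"
  by (rule blinfun_eqI) simp

lemma tensor_map_id: "tensor_map id_blinfun id_blinfun = id_blinfun"
  by (intro blinfun_eqI) (simp add: tensor_map_apply compose_id_blinfun)

lemma dual_rep_apply: "blinfun_apply (dual_rep G \<rho> g) l = l o\<^sub>L \<rho> (inv\<^bsub>G\<^esub> g)"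
  unfolding dual_rep_def by (simp add: bounded_linear_Blinfun_apply[OF bounded_linear_compose_right])

section \<open>Properties of the relative fundamental derivative\<close>

locale Relative_geometry = Cartan_geometry G Q C
  for G :: "('g::t2_space, 'v::{real_inner,heine_borel}) lie_grp" (structure) and Q :: "'g set"
    and C :: "('b::t2_space, 'h::{real_inner,heine_borel}, 'm::{t2_space,second_countable_topology},
      'e::{real_inner,heine_borel}, 'g, 'v) cartan_geom" +
  fixes qq pp :: "'v set"
  assumes np: "nested_parabolics G qq pp" and qq: "lie_algebra_of G Q = qq"
begin

abbreviation (input) nn :: "'v set" where "nn \<equiv> nilradical (lie_bracket G) pp"


lemma nn_subspace: "subspace nn" by (simp add: nilradical_def)
lemma nn_qq: "nn \<subseteq> qq" by (rule nested_parabolics_nilradical[OF np])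
lemma qq_pp: "qq \<subseteq> pp" using np by (simp add: nested_parabolics_def)
lemmas subspace_qq = nested_parabolics_subspace(1)[OF np] and subspace_pp = nested_parabolics_subspace(2)[OF np]

lemma qq_curve:
  assumes "X \<in> qq" obtains \<gamma> where "one_param_subgroup G X \<gamma>" "range \<gamma> \<subseteq> Q"
  using assms qq unfolding lie_algebra_of_def by auto

lemma liftsD:
  assumes s': "s' \<in> lifts G Q C pp s"
  shows "s' \<in> adjoint_sections G Q C" "smooth_tot s'"
    "\<And>u g. g \<in> Q \<Longrightarrow> s' (act C u g) = Ad G (inv g) (s' u)"
    "s' u \<in> s u" "\<And>X. X \<in> s u \<Longrightarrow> X - s' u \<in> nn"
proof -
  have s: "s' \<in> adjoint_sections G Q C" "\<And>u. coset nn (s' u) = s u"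
    using s' by (auto simp: lifts_def p_sections_def)
  show "s' \<in> adjoint_sections G Q C" by (rule s)
  show "smooth_tot s'"
    "\<And>u g. g \<in> Q \<Longrightarrow> s' (act C u g) = Ad G (inv g) (s' u)"
    using s(1) by (auto simp: adjoint_sections_def sections_def)
  show "s' u \<in> s u" unfolding s(2)[symmetric] coset_def
    using subspace_0[OF nn_subspace] by (intro CollectI exI[of _ 0]) simp
  show "\<And>X. X \<in> s u \<Longrightarrow> X - s' u \<in> nn" unfolding s(2)[symmetric] coset_def by auto
qed

text \<open>\<open>global_lift\<close> yields values in \<open>s u\<close>. Membership in a coset
  determines the coset, and the values stay in \<open>pp\<close> since the nilradical lies in
  \<open>qq\<close> and hence in \<open>pp\<close>.\<close>

lemma lifts_nonempty:
  assumes s: "s \<in> rel_adjoint_sections G Q C pp"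
  shows "lifts G Q C pp s \<noteq> {}"
proof -
  have s': "s \<in> quotient_sections G Q C (Ad G) pp nn" using s by (simp add: rel_adjoint_sections_def)
  obtain t where t: "t \<in> adjoint_sections G Q C" "\<And>u. t u \<in> s u"
    by (rule global_lift[OF s' nn_subspace]) blast
  have "t u \<in> pp \<and> coset nn (t u) = s u" for u
  proof -
    have "s u \<in> coset nn ` pp" using s' by (simp add: quotient_sections_def)
    then obtain Y where Y: "Y \<in> pp" "s u = coset nn Y" by blast
    then obtain Z where Z: "Z \<in> nn" "t u = Y + Z" using t(2)[of u] by (auto simp: coset_def)
    have "coset nn (Y + Z) = coset nn Y"
    proof (intro equalityI subsetI)
      fix X assume "X \<in> coset nn (Y + Z)"
      then obtain W where W: "W \<in> nn" "X = Y + (Z + W)" by (auto simp: coset_def add.assoc)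
      then show "X \<in> coset nn Y"
        using subspace_add[OF nn_subspace Z(1) W(1)] unfolding coset_def by blast
    next
      fix X assume "X \<in> coset nn Y"
      then obtain W where "W \<in> nn" "X = Y + W" by (auto simp: coset_def)
      then show "X \<in> coset nn (Y + Z)"
        using subspace_diff[OF nn_subspace _ Z(1), of W] unfolding coset_def
        by (intro CollectI exI[of _ "W - Z"]) auto
    qed
    moreover have "Y + Z \<in> pp" using Y Z nn_qq qq_pp by (intro subspace_add[OF subspace_pp]) auto
    ultimately show ?thesis using Y Z by simp
  qed
  then have "t \<in> lifts G Q C pp s" using t(1) by (simp add: lifts_def p_sections_def)
  then show ?thesis by blast
qed

section \<open>Vertical derivatives and independence of the lift\<close>

lemma sectionD:
  assumes "\<sigma> \<in> bundle_sections G Q C \<rho>"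
  shows "smooth_tot \<sigma>"
    "\<And>u g. g \<in> Q \<Longrightarrow> \<sigma> (act C u g) = \<rho> (inv g) (\<sigma> u)"
  using assms by (auto simp: bundle_sections_def sections_def)

lemma vertical_section_derivative:
  assumes \<sigma>: "\<sigma> \<in> bundle_sections G Q C \<rho>" and \<gamma>: "one_param_subgroup G X \<gamma>" "range \<gamma> \<subseteq> Q"
  shows "((\<lambda>t. \<rho> (\<gamma> (- t)) (\<sigma> u)) has_vector_derivative tderiv tot \<sigma> u (conn_inv C u X)) (at 0)"
proof -
  have "\<gamma> t \<in> Q" for t using \<gamma>(2) by blast
  then have "(\<lambda>t. \<sigma> (act C u (\<gamma> t))) = (\<lambda>t. \<rho> (\<gamma> (- t)) (\<sigma> u))"
    using sectionD(2)[OF \<sigma>] one_param_subgroup_minus[OF \<gamma>(1)] by simp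
  then show ?thesis
    using vertical_derivative[OF \<gamma> sectionD(1)[OF \<sigma>], of u] by simp
qed

lemma nilradical_derivative_zero:
  assumes \<rho>: "\<forall>g\<in>exp_image G nn. \<rho> g = id_blinfun" and \<sigma>: "\<sigma> \<in> bundle_sections G Q C \<rho>" and X: "X \<in> nn"
  shows "tderiv tot \<sigma> u (conn_inv C u X) = 0"
proof -
  obtain \<gamma> where \<gamma>: "one_param_subgroup G X \<gamma>" "range \<gamma> \<subseteq> Q"
    using X nn_qq by (auto intro: qq_curve)
  have "(\<lambda>t. \<rho> (\<gamma> (- t)) (\<sigma> u)) = (\<lambda>t. \<sigma> u)"
    using \<rho> one_param_subgroup_exp_image[OF \<gamma>(1) X nn_subspace] by simp
  with vertical_section_derivative[OF \<sigma> \<gamma>, of u]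
  have "((\<lambda>t. \<sigma> u) has_vector_derivative tderiv tot \<sigma> u (conn_inv C u X)) (at 0)" by simp
  then show ?thesis using vector_derivative_unique_at[OF _ has_vector_derivative_const] by blast
qed

lemma fund_deriv_lifts:
  assumes \<rho>: "\<forall>g\<in>exp_image G nn. \<rho> g = id_blinfun" and \<sigma>: "\<sigma> \<in> bundle_sections G Q C \<rho>"
    and s': "s' \<in> lifts G Q C pp s" and s'': "s'' \<in> lifts G Q C pp s"
  shows "fund_deriv C s' \<sigma> = fund_deriv C s'' \<sigma>"
proof
  fix u
  define X where "X = s'' u - s' u"
  have X: "X \<in> nn" unfolding X_def by (rule liftsD(5)[OF s' liftsD(4)[OF s'']])
  have eq: "s'' u = 1 *\<^sub>R s' u + 1 *\<^sub>R X" by (simp add: X_def)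
  have "fund_deriv C s'' \<sigma> u = 1 *\<^sub>R tderiv tot \<sigma> u (conn_inv C u (s' u)) + 1 *\<^sub>R tderiv tot \<sigma> u (conn_inv C u X)"
    unfolding fund_deriv_eq eq conn_inv_lincomb
    by (rule tderiv_lincomb[OF pbD(1) mdiff_smooth[OF sectionD(1)[OF \<sigma>]]
          conn_inv_tangent_space conn_inv_tangent_space])
  then show "fund_deriv C s' \<sigma> u = fund_deriv C s'' \<sigma> u"
    using nilradical_derivative_zero[OF \<rho> \<sigma> X] by (simp add: fund_deriv_eq)
qed

text \<open>The given lift also makes the definite description unique: any candidate must equal the
  derivative along it.\<close>

lemma rel_fund_deriv_eq:
  assumes \<rho>: "\<forall>g\<in>exp_image G nn. \<rho> g = id_blinfun" and \<sigma>: "\<sigma> \<in> bundle_sections G Q C \<rho>"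
    and s': "s' \<in> lifts G Q C pp s"
  shows "rel_fund_deriv G Q C pp \<rho> s \<sigma> = fund_deriv C s' \<sigma>"
  unfolding rel_fund_deriv_def
proof (rule the_equality)
  show "fund_deriv C s' \<sigma> \<in> bundle_sections G Q C \<rho> \<and> (\<forall>s''\<in>lifts G Q C pp s. fund_deriv C s' \<sigma> = fund_deriv C s'' \<sigma>)"
    using fund_deriv_section[OF liftsD(1)[OF s'] \<sigma>] fund_deriv_lifts[OF \<rho> \<sigma> s'] by blast
qed (use s' in blast)

text \<open>Both \<open>inf_rep\<close> and \<open>bullet\<close> are definite descriptions. A
  single linear map \<open>L\<close> evaluates the first on \<open>qq\<close>, and since
  \<open>L\<close> kills the nilradical it is constant on each coset, which evaluates the
  second.\<close>

lemma inf_rep_derivative: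
  assumes rep: "representation G Q \<rho>" and \<rho>: "\<forall>g\<in>exp_image G nn. \<rho> g = id_blinfun"
    and \<sigma>: "\<sigma> \<in> bundle_sections G Q C \<rho>" and s0: "s \<in> rel_adjoint0_sections G Q C qq pp"
    and s': "s' \<in> lifts G Q C pp s"
  shows "fund_deriv C s' \<sigma> u = - bullet G Q \<rho> s \<sigma> u"
proof -
  obtain L where L: "linear L"
    "\<And>X \<gamma>. one_param_subgroup G X \<gamma> \<Longrightarrow> range \<gamma> \<subseteq> Q \<Longrightarrow> ((\<lambda>t. \<rho> (\<gamma> t)) has_vector_derivative L X) (at 0)"
    by (rule inf_rep_exists[OF rep subgroup.one_closed[OF Q]]) blast
  have inf: "inf_rep G Q \<rho> X = L X" if X: "X \<in> qq" for X
    unfolding inf_rep_def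
  proof (rule the_equality)
    show "\<forall>\<gamma>. one_param_subgroup G X \<gamma> \<and> range \<gamma> \<subseteq> Q \<longrightarrow> ((\<lambda>t. \<rho> (\<gamma> t)) has_vector_derivative L X) (at 0)"
      using L(2) by blast
    fix D assume D: "\<forall>\<gamma>. one_param_subgroup G X \<gamma> \<and> range \<gamma> \<subseteq> Q \<longrightarrow> ((\<lambda>t. \<rho> (\<gamma> t)) has_vector_derivative D) (at 0)"
    obtain \<gamma> where "one_param_subgroup G X \<gamma>" "range \<gamma> \<subseteq> Q" by (rule qq_curve[OF X])
    then show "D = L X" using D L(2) vector_derivative_unique_at by blast
  qed
  \<comment> \<open>The one-parameter subgroup of such an X acts as the identity at all times, so
    the derivative \<open>L X\<close> is that of a constant.\<close>
  have L0: "L X = 0" if X: "X \<in> nn" for X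
  proof -
    obtain \<gamma> where \<gamma>: "one_param_subgroup G X \<gamma>" "range \<gamma> \<subseteq> Q"
      using X nn_qq by (auto intro: qq_curve)
    have "(\<lambda>t. \<rho> (\<gamma> t)) = (\<lambda>t. id_blinfun)"
      using \<rho> one_param_subgroup_exp_image[OF \<gamma>(1) X nn_subspace] by simp
    then have "((\<lambda>t::real. id_blinfun) has_vector_derivative L X) (at 0)" using L(2)[OF \<gamma>] by simp
    then show ?thesis using vector_derivative_unique_at[OF _ has_vector_derivative_const] by blast
  qed
  have "s u \<in> coset nn ` qq" using s0 by (simp add: rel_adjoint0_sections_def quotient_sections_def)
  then have su: "s u \<subseteq> qq" using nn_qq by (auto simp: coset_def subset_iff intro!: subspace_add[OF subspace_qq])
  have s'u: "s' u \<in> s u" by (rule liftsD(4)[OF s'])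
  have const: "inf_rep G Q \<rho> X = L (s' u)" if "X \<in> s u" for X
    using L0[OF liftsD(5)[OF s' that]] linear_diff[OF L(1), of X "s' u"] inf[OF subsetD[OF su that]] by simp
  have bul: "bullet G Q \<rho> s \<sigma> u = L (s' u) (\<sigma> u)"
    unfolding bullet_def
  proof (rule the_equality)
    show "\<forall>X\<in>s u. inf_rep G Q \<rho> X (\<sigma> u) = L (s' u) (\<sigma> u)" by (simp add: const)
    show "w = L (s' u) (\<sigma> u)" if "\<forall>X\<in>s u. inf_rep G Q \<rho> X (\<sigma> u) = w" for w
      using bspec[OF that s'u] const[OF s'u] by simp
  qed
  obtain \<gamma> where \<gamma>: "one_param_subgroup G (s' u) \<gamma>" "range \<gamma> \<subseteq> Q"
    using s'u su by (auto intro: qq_curve)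
  \<comment> \<open>The base point is written as \<open>- 0\<close>, the image of 0 under t -> -t,
    so that the chain rule applies to the reversed subgroup.\<close>
  have "((\<lambda>t. \<rho> (\<gamma> t)) has_vector_derivative L (s' u)) (at (- 0))" using L(2)[OF \<gamma>] by simp
  moreover have "((\<lambda>t. - t) has_vector_derivative - 1) (at (0::real))"
    by (auto intro!: derivative_eq_intros)
  ultimately have "((\<lambda>t. \<rho> (\<gamma> t)) \<circ> (\<lambda>t. - t) has_vector_derivative (- 1) *\<^sub>R L (s' u)) (at 0)"
    by (intro vector_diff_chain_at)
  from bounded_linear.has_vector_derivative[OF blinfun.bounded_linear_left this]
  have "((\<lambda>t. \<rho> (\<gamma> (- t)) (\<sigma> u)) has_vector_derivative - L (s' u) (\<sigma> u)) (at 0)"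
    by (simp add: o_def blinfun.minus_left)
  with vertical_section_derivative[OF \<sigma> \<gamma>, of u]
  show ?thesis unfolding bul fund_deriv_eq by (rule vector_derivative_unique_at)
qed

text \<open>Two ambiguities have to disappear. Another representative modulo \<open>qq\<close>
  changes the tangent vector by a vertical one, which the projection kills; another point of the
  fibre is a translate, and equivariance of \<open>s'\<close> and of the connection absorbs
  it.\<close>

lemma tangent_field_Pi:
  assumes s': "s' \<in> lifts G Q C pp s"
  shows "Pi_rho C qq s (proj C u) = tmap tot base (proj C) u (conn_inv C u (s' u))"
  unfolding Pi_rho_def tangent_field_def conn_inv_def[symmetric]
proof (rule the_equality)
  let ?t = "\<lambda>u. tmap tot base (proj C) u"
  show "\<forall>u'. proj C u' = proj C u \<longrightarrow> (\<forall>X\<in>(\<Union>X\<in>s u'. coset qq X). ?t u (conn_inv C u (s' u)) = ?t u' (conn_inv C u' X))"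
  proof (intro allI impI ballI)
    fix u' X assume p: "proj C u' = proj C u" and X: "X \<in> (\<Union>X\<in>s u'. coset qq X)"
    obtain g where g: "g \<in> Q" "u' = act C u g"
      by (rule fibre_transitive[OF p[symmetric]])
    obtain Y Z where Y: "Y \<in> s u'" "Z \<in> qq" "X = Y + Z" using X by (auto simp: coset_def)
    \<comment> \<open>The difference between \<open>X\<close> and the value of the lift: a
      nilradical part, from moving within \<open>s u'\<close>, plus the explicit part in
      \<open>qq\<close>. Both lie in \<open>qq\<close>, so the difference is vertical.\<close>
    define W where "W = (Y - s' u') + Z"
    have "W \<in> qq" unfolding W_def
      using liftsD(5)[OF s' Y(1)] nn_qq Y(2) by (intro subspace_add[OF subspace_qq]) auto
    then obtain \<gamma> where \<gamma>: "one_param_subgroup G W \<gamma>" "range \<gamma> \<subseteq> Q" by (rule qq_curve)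
    have XW: "X = 1 *\<^sub>R s' u' + 1 *\<^sub>R W" by (simp add: W_def Y)
    have "?t u' (conn_inv C u' X) = (\<lambda>d. 1 *\<^sub>R ?t u' (conn_inv C u' (s' u')) d + 1 *\<^sub>R ?t u' (conn_inv C u' W) d)"
      unfolding XW conn_inv_lincomb
      by (rule tmap_lincomb[OF pbD(1) mdiff_proj conn_inv_tangent_space conn_inv_tangent_space])
    also have "\<dots> = ?t u' (conn_inv C u' (s' u'))" by (simp add: vertical_proj[OF \<gamma>])
    also have "\<dots> = ?t (act C u g) (tmap tot tot (\<lambda>u. act C u g) u (conn_inv C u (s' u)))"
      by (simp add: g(2) liftsD(3)[OF s' g(1)] tmap_act_conn_inv[OF g(1)])
    also have "\<dots> = tmap tot base (\<lambda>u. proj C (act C u g)) u (conn_inv C u (s' u))"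
      by (rule tmap_compose[OF pbD(1) pbD(1) mdiff_act[OF g(1)] mdiff_proj conn_inv_tangent_space])
    also have "(\<lambda>u. proj C (act C u g)) = proj C" using pbD(7)[OF g(1)] by (rule ext)
    finally show "?t u (conn_inv C u (s' u)) = ?t u' (conn_inv C u' X)" by simp
  qed
  fix v assume v: "\<forall>u'. proj C u' = proj C u \<longrightarrow> (\<forall>X\<in>(\<Union>X\<in>s u'. coset qq X). v = ?t u' (conn_inv C u' X))"
  have "s' u \<in> coset qq (s' u)" unfolding coset_def
    using subspace_0[OF subspace_qq] by (intro CollectI exI[of _ 0]) simp
  then have "s' u \<in> (\<Union>X\<in>s u. coset qq X)" using liftsD(4)[OF s'] by blast
  then show "v = ?t u (conn_inv C u (s' u))" using v by blast
qed

section \<open>Functions, bundle maps, tensor products and duals\<close>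

lemma field_deriv_Pi:
  assumes s': "s' \<in> lifts G Q C pp s" and f: "smooth_fun C f"
  shows "field_deriv C (Pi_rho C qq s) f (proj C u) = fund_deriv C s' (\<lambda>u. f (proj C u)) u"
proof -
  have "mdiff base vs_atlas f (proj C u)"
    using f by (intro smooth_map_on_imp_mdiff[OF pbD(2) smooth_atlas_vs open_UNIV UNIV_I]) (simp add: smooth_fun_def)
  from tderiv_tmap[OF pbD(1,2) mdiff_proj this conn_inv_tangent_space, of "s' u"]
  show ?thesis
    unfolding field_deriv_def tangent_field_Pi[OF s'] fund_deriv_eq by simp
qed

lemma smooth_fun_proj:
  assumes "smooth_fun C f" shows "smooth_tot (\<lambda>u. f (proj C u))"
  by (rule smooth_map_on_compose[OF pbD(1,2) smooth_atlas_vs subset_UNIV pbD(3)])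
    (use assms in \<open>simp add: smooth_fun_def\<close>)

lemma fund_deriv_bilinear:
  assumes B: "bounded_bilinear B" and F: "smooth_tot F"
    and K: "smooth_tot K"
  shows "fund_deriv C s (\<lambda>u. B (F u) (K u)) u = B (F u) (fund_deriv C s K u) + B (fund_deriv C s F u) (K u)"
  unfolding fund_deriv_eq
  by (rule tderiv_bilinear[OF pbD(1) mdiff_smooth[OF F] mdiff_smooth[OF K] conn_inv_tangent_space B])

lemma smooth_bilinear:
  assumes B: "bounded_bilinear B" and F: "smooth_tot F"
    and K: "smooth_tot K"
  shows "smooth_tot (\<lambda>u. B (F u) (K u))"
  using F K unfolding smooth_tot_iff by (rule smooth_map_open_bilinear[OF pbD(1) open_UNIV B])

lemma rel_fund_deriv_function:
  assumes s': "s' \<in> lifts G Q C pp s" and f: "smooth_fun C f"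
  shows "rel_fund_deriv G Q C pp trivial_rep s (\<lambda>u. f (proj C u)) = fund_deriv C s' (\<lambda>u. f (proj C u))"
proof (rule rel_fund_deriv_eq[OF _ _ s'])
  show "(\<lambda>u. f (proj C u)) \<in> bundle_sections G Q C trivial_rep"
    using smooth_fun_proj[OF f] by (simp add: bundle_sections_def sections_def trivial_rep_def pbD(7))
qed (simp add: trivial_rep_def)

lemma rel_fund_deriv_bundle_map:
  assumes s': "s' \<in> lifts G Q C pp s" and \<sigma>: "\<sigma> \<in> bundle_sections G Q C \<rho>"
    and \<rho>': "\<forall>g\<in>exp_image G nn. \<rho>' g = id_blinfun"
    and \<phi>: "\<And>g w. g \<in> Q \<Longrightarrow> blinfun_apply \<phi> (\<rho> g w) = \<rho>' g (\<phi> w)"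
  shows "rel_fund_deriv G Q C pp \<rho>' s (\<lambda>u. \<phi> (\<sigma> u)) = (\<lambda>u. \<phi> (fund_deriv C s' \<sigma> u))"
proof -
  have sm: "smooth_tot (\<lambda>u. \<phi> (\<sigma> u))"
    using sectionD(1)[OF \<sigma>] unfolding smooth_tot_iff
    by (rule smooth_map_open_bounded_linear[OF pbD(1) open_UNIV blinfun.bounded_linear_right])
  have "(\<lambda>u. \<phi> (\<sigma> u)) \<in> bundle_sections G Q C \<rho>'"
    using sm sectionD(2)[OF \<sigma>] \<phi> subgroup.m_inv_closed[OF Q] by (simp add: bundle_sections_def sections_def)
  from rel_fund_deriv_eq[OF \<rho>' this s']
  have "rel_fund_deriv G Q C pp \<rho>' s (\<lambda>u. \<phi> (\<sigma> u)) = fund_deriv C s' (\<lambda>u. \<phi> (\<sigma> u))" .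
  also have "\<dots> = (\<lambda>u. \<phi> (fund_deriv C s' \<sigma> u))"
    unfolding fund_deriv_eq
    by (rule ext) (rule tderiv_bounded_linear[OF pbD(1) mdiff_smooth[OF sectionD(1)[OF \<sigma>]]
        conn_inv_tangent_space blinfun.bounded_linear_right])
  finally show ?thesis .
qed

lemma rel_fund_deriv_scale:
  assumes s': "s' \<in> lifts G Q C pp s" and \<sigma>: "\<sigma> \<in> bundle_sections G Q C \<rho>"
    and \<rho>: "\<forall>g\<in>exp_image G nn. \<rho> g = id_blinfun" and f: "smooth_fun C f"
  shows "rel_fund_deriv G Q C pp \<rho> s (\<lambda>u. f (proj C u) *\<^sub>R \<sigma> u)
    = (\<lambda>u. field_deriv C (Pi_rho C qq s) f (proj C u) *\<^sub>R \<sigma> u + f (proj C u) *\<^sub>R fund_deriv C s' \<sigma> u)"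
proof -
  note sm = smooth_bilinear[OF bounded_bilinear_scaleR smooth_fun_proj[OF f] sectionD(1)[OF \<sigma>]]
  have "(\<lambda>u. f (proj C u) *\<^sub>R \<sigma> u) \<in> bundle_sections G Q C \<rho>"
    using sm sectionD(2)[OF \<sigma>] by (simp add: bundle_sections_def sections_def pbD(7) blinfun.scaleR_right)
  from rel_fund_deriv_eq[OF \<rho> this s'] show ?thesis
    using fund_deriv_bilinear[OF bounded_bilinear_scaleR smooth_fun_proj[OF f] sectionD(1)[OF \<sigma>]]
    by (simp add: fun_eq_iff field_deriv_Pi[OF s' f] add.commute)
qed

lemma rel_fund_deriv_tensor:
  assumes s': "s' \<in> lifts G Q C pp s"
    and \<sigma>: "\<sigma> \<in> bundle_sections G Q C \<rho>" and \<rho>: "\<forall>g\<in>exp_image G nn. \<rho> g = id_blinfun"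
    and \<tau>: "\<tau> \<in> bundle_sections G Q C \<rho>'" and \<rho>': "\<forall>g\<in>exp_image G nn. \<rho>' g = id_blinfun"
  shows "rel_fund_deriv G Q C pp (tensor_rep \<rho> \<rho>') s (\<lambda>u. tensor (\<sigma> u) (\<tau> u))
    = (\<lambda>u. tensor (fund_deriv C s' \<sigma> u) (\<tau> u) + tensor (\<sigma> u) (fund_deriv C s' \<tau> u))"
proof -
  note sm = smooth_bilinear[OF bounded_bilinear_tensor sectionD(1)[OF \<sigma>] sectionD(1)[OF \<tau>]]
  have "(\<lambda>u. tensor (\<sigma> u) (\<tau> u)) \<in> bundle_sections G Q C (tensor_rep \<rho> \<rho>')"
    using sm sectionD(2)[OF \<sigma>] sectionD(2)[OF \<tau>]
    by (simp add: bundle_sections_def sections_def tensor_rep_def tensor_map_tensor)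
  moreover have "\<forall>g\<in>exp_image G nn. tensor_rep \<rho> \<rho>' g = id_blinfun"
    using \<rho> \<rho>' by (simp add: tensor_rep_def tensor_map_id)
  ultimately show ?thesis
    using rel_fund_deriv_eq[OF _ _ s', of "tensor_rep \<rho> \<rho>'" "\<lambda>u. tensor (\<sigma> u) (\<tau> u)"]
      fund_deriv_bilinear[OF bounded_bilinear_tensor sectionD(1)[OF \<sigma>] sectionD(1)[OF \<tau>]]
    by (simp add: fun_eq_iff add.commute)
qed

text \<open>Needed for duals, because \<open>dual_rep\<close> evaluates the representation at
  inverses.\<close>

lemma exp_image_inv:
  assumes g: "g \<in> exp_image G nn"
  shows "inv g \<in> exp_image G nn"
proof -
  obtain \<gamma> X where \<gamma>: "g = \<gamma> 1" "X \<in> nn" "one_param_subgroup G X \<gamma>"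
    using g unfolding exp_image_def by blast
  show ?thesis
    using one_param_subgroup_exp_image[OF \<gamma>(3,2) nn_subspace, of "- 1"] one_param_subgroup_minus[OF \<gamma>(3), of 1] \<gamma>(1)
    by simp
qed

lemma rel_fund_deriv_dual:
  assumes s': "s' \<in> lifts G Q C pp s" and l: "l \<in> bundle_sections G Q C (dual_rep G \<rho>)"
    and \<rho>: "\<forall>g\<in>exp_image G nn. \<rho> g = id_blinfun"
  shows "rel_fund_deriv G Q C pp (dual_rep G \<rho>) s l = fund_deriv C s' l"
proof (rule rel_fund_deriv_eq[OF _ l s'])
  show "\<forall>g\<in>exp_image G nn. dual_rep G \<rho> g = id_blinfun"
    using \<rho> exp_image_inv by (auto intro!: blinfun_eqI simp: dual_rep_apply)
qed

lemma descend_proj: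
  assumes F: "\<And>u g. g \<in> Q \<Longrightarrow> F (act C u g) = F u"
  shows "descend C F (proj C u) = F u"
  unfolding descend_def
proof (rule the_equality)
  show "\<forall>u'. proj C u' = proj C u \<longrightarrow> F u' = F u"
  proof (intro allI impI)
    fix u' assume "proj C u' = proj C u"
    then obtain g where "g \<in> Q" "u' = act C u g"
      by (metis fibre_transitive)
    then show "F u' = F u" using F by simp
  qed
qed blast

text \<open>Over the domain of a local section \<open>e\<close> the descended function is
  \<open>F\<close> composed with \<open>e\<close>.\<close>

lemma smooth_fun_descend:
  assumes F: "\<And>u g. g \<in> Q \<Longrightarrow> F (act C u g) = F u" and sm: "smooth_tot F"
  shows "smooth_fun C (descend C F)"
  unfolding smooth_fun_def smooth_map_on_iff_open[OF pbD(2) smooth_atlas_vs open_UNIV]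
proof (rule smooth_map_open_local[OF pbD(2) smooth_atlas_vs open_UNIV])
  fix x
  obtain U e where U: "open U" "x \<in> U" "smooth_map_on base U tot e"
    "\<And>y. y \<in> U \<Longrightarrow> proj C (e y) = y"
    by (rule local_section[of x]) blast
  have "smooth_map_open base U vs_atlas (\<lambda>y. F (e y))"
    using smooth_map_on_compose[OF pbD(2,1) smooth_atlas_vs subset_UNIV U(3) sm]
    unfolding smooth_map_on_iff_open[OF pbD(2) smooth_atlas_vs U(1)] .
  then have "smooth_map_open base U vs_atlas (descend C F)"
  proof (rule smooth_map_open_cong[OF pbD(2) smooth_atlas_vs U(1), rotated])
    show "F (e y) = descend C F y" if "y \<in> U" for y
      using descend_proj[OF F, of "e y"] U(4)[OF that] by simp
  qed
  then show "\<exists>W. open W \<and> x \<in> W \<and> smooth_map_open base W vs_atlas (descend C F)"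
    using U by blast
qed

text \<open>The pairing is constant on fibres, as the inverse in \<open>dual_rep\<close> cancels the
  action on \<sigma>; so it descends to a smooth function. Pulled back to the total space, its
  derivative is the product rule for the bilinear evaluation map.\<close>

lemma field_deriv_pairing:
  assumes s': "s' \<in> lifts G Q C pp s" and \<sigma>: "\<sigma> \<in> bundle_sections G Q C \<rho>"
    and l: "l \<in> bundle_sections G Q C (dual_rep G \<rho>)" and rep: "representation G Q \<rho>"
  shows "field_deriv C (Pi_rho C qq s) (descend C (\<lambda>u. blinfun_apply (l u) (\<sigma> u))) (proj C u)
    = blinfun_apply (fund_deriv C s' l u) (\<sigma> u) + blinfun_apply (l u) (fund_deriv C s' \<sigma> u)"
proof -
  let ?F = "\<lambda>u. blinfun_apply (l u) (\<sigma> u)"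
  have F: "?F (act C u g) = ?F u" if g: "g \<in> Q" for u g
  proof -
    have "\<rho> g o\<^sub>L \<rho> (inv g) = id_blinfun"
      using rep g subgroup.m_inv_closed[OF Q g] unfolding Defs.representation_def
      by (metis grp.r_inv in_carrier)
    then have "\<rho> g (\<rho> (inv g) (\<sigma> u)) = \<sigma> u"
      by (metis blinfun_apply_blinfun_compose blinfun_apply_id_blinfun id_apply)
    then show ?thesis
      using sectionD(2)[OF \<sigma> g] sectionD(2)[OF l g] in_carrier by (simp add: dual_rep_apply)
  qed
  note sm = smooth_bilinear[OF bounded_bilinear_blinfun_apply sectionD(1)[OF l] sectionD(1)[OF \<sigma>]]
  show ?thesis
    using field_deriv_Pi[OF s' smooth_fun_descend[OF F sm], of u]
      fund_deriv_bilinear[OF bounded_bilinear_blinfun_apply sectionD(1)[OF l] sectionD(1)[OF \<sigma>], of s' u]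
    by (simp add: descend_proj[OF F] add.commute)
qed

end

theorem proposition2p2:
  fixes G :: "('g::{t2_space,second_countable_topology}, 'v::{real_inner,heine_borel}) lie_grp"
    and qq pp :: "'v set" and P Q :: "'g set"
    and C :: "('b::{t2_space,second_countable_topology}, 'h::{real_inner,heine_borel},
               'm::{t2_space,second_countable_topology}, 'e::{real_inner,heine_borel}, 'g, 'v) cartan_geom"
    and \<rho> :: "'g \<Rightarrow> 'w::{real_normed_vector,heine_borel} \<Rightarrow>\<^sub>L 'w"
  assumes "lie_group G" and "lie_semisimple (lie_bracket G)"
    and "nested_parabolics G qq pp"
    and "parabolic_subgroup G pp P"
    and "Q = normalizer_in G P qq" and "lie_algebra_of G Q = qq"
    and "cartan_geometry G Q C"
    and "relative_rep G Q pp \<rho>"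
  shows
    "(\<forall>s\<in>rel_adjoint_sections G Q C pp. lifts G Q C pp s \<noteq> {} \<and>
       (\<forall>\<sigma>\<in>bundle_sections G Q C \<rho>.
          rel_fund_deriv G Q C pp \<rho> s \<sigma> \<in> bundle_sections G Q C \<rho> \<and>
          (\<forall>s'\<in>lifts G Q C pp s. rel_fund_deriv G Q C pp \<rho> s \<sigma> = fund_deriv C s' \<sigma>))) \<and>
     (\<forall>s\<in>rel_adjoint0_sections G Q C qq pp. \<forall>\<sigma>\<in>bundle_sections G Q C \<rho>.
       rel_fund_deriv G Q C pp \<rho> s \<sigma> = (\<lambda>u. - bullet G Q \<rho> s \<sigma> u)) \<and>
     (\<forall>s\<in>rel_adjoint_sections G Q C pp. \<forall>f. smooth_fun C f \<longrightarrow>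
       rel_fund_deriv G Q C pp trivial_rep s (\<lambda>u. f (proj C u))
         = (\<lambda>u. field_deriv C (Pi_rho C qq s) f (proj C u))) \<and>
     (\<forall>(\<rho>' :: 'g \<Rightarrow> 'f::{real_normed_vector,heine_borel} \<Rightarrow>\<^sub>L 'f) (\<phi> :: 'w \<Rightarrow>\<^sub>L 'f).
       relative_rep G Q pp \<rho>' \<and> (\<forall>g\<in>Q. \<forall>w. \<phi> (\<rho> g w) = \<rho>' g (\<phi> w)) \<longrightarrow>
       (\<forall>s\<in>rel_adjoint_sections G Q C pp. \<forall>\<sigma>\<in>bundle_sections G Q C \<rho>.
          rel_fund_deriv G Q C pp \<rho>' s (\<lambda>u. \<phi> (\<sigma> u))
            = (\<lambda>u. \<phi> (rel_fund_deriv G Q C pp \<rho> s \<sigma> u)))) \<and>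
     (\<forall>s\<in>rel_adjoint_sections G Q C pp. \<forall>\<sigma>\<in>bundle_sections G Q C \<rho>. \<forall>f. smooth_fun C f \<longrightarrow>
       rel_fund_deriv G Q C pp \<rho> s (\<lambda>u. f (proj C u) *\<^sub>R \<sigma> u)
         = (\<lambda>u. field_deriv C (Pi_rho C qq s) f (proj C u) *\<^sub>R \<sigma> u
                + f (proj C u) *\<^sub>R rel_fund_deriv G Q C pp \<rho> s \<sigma> u)) \<and>
     (\<forall>\<rho>' :: 'g \<Rightarrow> 'f \<Rightarrow>\<^sub>L 'f. relative_rep G Q pp \<rho>' \<longrightarrow>
       (\<forall>s\<in>rel_adjoint_sections G Q C pp.
        \<forall>\<sigma>\<in>bundle_sections G Q C \<rho>. \<forall>\<tau>\<in>bundle_sections G Q C \<rho>'.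
          rel_fund_deriv G Q C pp (tensor_rep \<rho> \<rho>') s (\<lambda>u. tensor (\<sigma> u) (\<tau> u))
            = (\<lambda>u. tensor (rel_fund_deriv G Q C pp \<rho> s \<sigma> u) (\<tau> u)
                   + tensor (\<sigma> u) (rel_fund_deriv G Q C pp \<rho>' s \<tau> u)))) \<and>
     (\<forall>s\<in>rel_adjoint_sections G Q C pp.
      \<forall>\<sigma>\<in>bundle_sections G Q C \<rho>. \<forall>l\<in>bundle_sections G Q C (dual_rep G \<rho>).
       (\<lambda>u. field_deriv C (Pi_rho C qq s) (descend C (\<lambda>u. blinfun_apply (l u) (\<sigma> u))) (proj C u))
         = (\<lambda>u. blinfun_apply (rel_fund_deriv G Q C pp (dual_rep G \<rho>) s l u) (\<sigma> u)
                + blinfun_apply (l u) (rel_fund_deriv G Q C pp \<rho> s \<sigma> u)))"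
proof -
  have "subgroup P G" using assms(4) by (simp add: parabolic_subgroup_def)
  then have Q: "subgroup Q G"
    unfolding assms(5) by (rule Lie_group.subgroup_normalizer_in[OF Lie_group.intro[OF assms(1)]])
  have cg: "principal_bundle G Q C" "cartan_connection G Q C"
    using assms(7) by (simp_all add: cartan_geometry_def)
  interpret Relative_geometry G Q C qq pp
    by (intro Relative_geometry.intro Cartan_geometry.intro Principal_bundle.intro Lie_group.intro
        Principal_bundle_axioms.intro Cartan_geometry_axioms.intro Relative_geometry_axioms.intro
        assms(1,3,6) Q cg)
  have triv: "\<forall>g\<in>exp_image G (nilradical (lie_bracket G) pp). \<rho> g = id_blinfun"
    and rep: "representation G Q \<rho>"
    using assms(8) by (simp_all add: relative_rep_def)
  have triv': "\<forall>g\<in>exp_image G (nilradical (lie_bracket G) pp). \<rho>' g = id_blinfun"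
    if "relative_rep G Q pp \<rho>'" for \<rho>' :: "'g \<Rightarrow> 'f \<Rightarrow>\<^sub>L 'f"
    using that by (simp add: relative_rep_def)
  \<comment> \<open>Each clause is turned into a statement about \<open>fund_deriv\<close> along one
    chosen lift, where no definite description is left.\<close>
  note rel = rel_fund_deriv_eq[OF triv]
  have lift: "\<exists>s'. s' \<in> lifts G Q C pp s" if "s \<in> rel_adjoint_sections G Q C pp" for s
    using lifts_nonempty[OF that] by blast
  show ?thesis
  proof (intro conjI ballI allI impI, goal_cases)
    case (1 s)
    then show ?case by (rule lifts_nonempty)
  next
    case (2 s \<sigma>)
    with lift obtain s' where s': "s' \<in> lifts G Q C pp s" by blast
    show ?case unfolding rel[OF 2(2) s'] by (rule fund_deriv_section[OF liftsD(1)[OF s'] 2(2)])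
  next
    case (3 s \<sigma> s')
    then show ?case by (intro rel)
  next
    case (4 s \<sigma>)
    \<comment> \<open>Since \<open>qq\<close> is contained in \<open>pp\<close>, a section with
      values in cosets of elements of \<open>qq\<close> is also one with values in cosets of
      elements of \<open>pp\<close>, and so has lifts.\<close>
    have "s \<in> rel_adjoint_sections G Q C pp"
      using 4(1) qq_pp unfolding rel_adjoint0_sections_def rel_adjoint_sections_def quotient_sections_def by blast
    with lift obtain s' where s': "s' \<in> lifts G Q C pp s" by blast
    show ?case
      unfolding rel[OF 4(2) s'] by (rule ext) (rule inf_rep_derivative[OF rep triv 4(2,1) s'])
  next
    case (5 s f)
    with lift obtain s' where s': "s' \<in> lifts G Q C pp s" by blast
    show ?case unfolding rel_fund_deriv_function[OF s' 5(2)] field_deriv_Pi[OF s' 5(2)] ..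
  next
    case (6 \<rho>' \<phi> s \<sigma>)
    with lift obtain s' where s': "s' \<in> lifts G Q C pp s" by blast
    show ?case
      unfolding rel[OF 6(3) s']
      by (rule rel_fund_deriv_bundle_map[OF s' 6(3) triv']) (use 6(1) in auto)
  next
    case (7 s \<sigma> f)
    with lift obtain s' where s': "s' \<in> lifts G Q C pp s" by blast
    show ?case unfolding rel[OF 7(2) s'] by (rule rel_fund_deriv_scale[OF s' 7(2) triv 7(3)])
  next
    case (8 \<rho>' s \<sigma> \<tau>)
    with lift obtain s' where s': "s' \<in> lifts G Q C pp s" by blast
    show ?case
      unfolding rel[OF 8(3) s'] rel_fund_deriv_eq[OF triv'[OF 8(1)] 8(4) s']
      by (rule rel_fund_deriv_tensor[OF s' 8(3) triv 8(4) triv'[OF 8(1)]])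
  next
    case (9 s \<sigma> l)
    with lift obtain s' where s': "s' \<in> lifts G Q C pp s" by blast
    show ?case
      unfolding rel[OF 9(2) s'] rel_fund_deriv_dual[OF s' 9(3) triv]
      by (rule ext) (rule field_deriv_pairing[OF s' 9(2,3) rep])
  qed
qed

end
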